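(* Let $K$ be any closed subset of $\mathbb{R}/\mathbb{Z}$. Then there are a sequence of pairs $(G_{K_i}, \alpha_i)$, where $G_{K_i}$ is a finitely presented group and $\alpha_i \in G_{K_i}$, and closed subsets $K_i$ of $\mathbb{R}/\mathbb{Z}$, such that: 1. $K_{i+1} \subset K_i$ for each $i$. 2. $\bigcap_i K_i = K$. 3. For each $i$, the set of rotation numbers $\mathrm{rot}(\rho(\alpha_i))$, as $\rho$ ranges over $\mathrm{Hom}(G_{K_i}, \mathrm{Homeo}^+(S^1))$, is exactly equal to $\{0\} \cup K_i \cup (-K_i)$. 4. For each $i$, there is an element $\nu_i \in G_{K_i}$ of order $3$ such that: for every $\rho \in \mathrm{Hom}(G_{K_i}, \mathrm{Homeo}^+(S^1))$ with $\mathrm{rot}(\rho(\nu_i)) = 0$, the homeomorphism $\rho(\alpha_i)$ is trivial; and the set of values $\mathrm{rot}(\rho(\alpha_i))$, as $\rho$ ranges over those $\rho \in \mathrm{Hom}(G_{K_i}, \mathrm{Homeo}^+(S^1))$ with $\mathrm{rot}(\rho(\nu_i)) = 1/3$, is exactly equal to $K_i$.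
   Context: $\mathrm{Homeo}^+(S^1)$ is the group of orientation-preserving homeomorphisms of the circle, and $\mathrm{rot}: \mathrm{Homeo}^+(S^1) \to \mathbb{R}/\mathbb{Z}$ is Poincaré's rotation number: $\mathrm{rot}(\alpha) = \lim_{n\to\infty} \tilde\alpha^n(0)/n \bmod \mathbb{Z}$ for any lift $\tilde\alpha \in \mathrm{Homeo}^+(\mathbb{R})$ of $\alpha$. For $K \subset \mathbb{R}/\mathbb{Z}$, $-K = \{-x : x \in K\}$. *)

theory Defs
  imports "HOL-Analysis.Analysis" "HOL-Algebra.Multiplicative_Group"
begin

section \<open>The circle \<open>\<real>/\<int>\<close>\<close>

quotient_type circle = real / "\<lambda>x y. x - y \<in> \<int>"
  morphisms rep_circle to_circle
proof (rule equivpI)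
  show "reflp (\<lambda>x y::real. x - y \<in> \<int>)" by (simp add: reflp_def)
  show "symp (\<lambda>x y::real. x - y \<in> \<int>)"
    unfolding symp_def by (metis Ints_minus minus_diff_eq)
  show "transp (\<lambda>x y::real. x - y \<in> \<int>)"
    unfolding transp_def by (metis Ints_add diff_add_cancel diff_diff_eq2 add_diff_eq)
qed

lemma to_circle_eq_iff: "to_circle x = to_circle y \<longleftrightarrow> x - y \<in> \<int>"
  by (rule circle.abs_eq_iff)

instantiation circle :: ab_group_add
begin

lift_definition zero_circle :: circle is "0::real" .

lift_definition plus_circle :: "circle \<Rightarrow> circle \<Rightarrow> circle" is "(+) :: real \<Rightarrow> real \<Rightarrow> real"
  by (metis Ints_add add_diff_add)

lift_definition uminus_circle :: "circle \<Rightarrow> circle" is "uminus :: real \<Rightarrow> real"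
  by (metis Ints_minus minus_diff_eq minus_diff_minus)

lift_definition minus_circle :: "circle \<Rightarrow> circle \<Rightarrow> circle" is "(-) :: real \<Rightarrow> real \<Rightarrow> real"
proof -
  fix a b c d :: real
  assume "a - b \<in> \<int>" "c - d \<in> \<int>"
  then have "(a - b) - (c - d) \<in> \<int>" by (rule Ints_diff)
  then show "a - c - (b - d) \<in> \<int>" by (simp add: algebra_simps)
qed

instance
  by standard (transfer, simp add: algebra_simps)+

end

text \<open>The quotient topology.\<close>

instantiation circle :: topological_space
begin

definition open_circle :: "circle set \<Rightarrow> bool" where
  "open_circle U \<longleftrightarrow> open (to_circle -` U)"

instance
  by standard (auto simp: open_circle_def vimage_Union intro: open_UN)

end


section \<open>Orientation-preserving homeomorphisms and the rotation number\<close>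

definition homeo_plus_real :: "(real \<Rightarrow> real) set" where
  "homeo_plus_real = {F. strict_mono F \<and> (\<exists>F'. homeomorphism UNIV UNIV F F')}"

definition is_lift :: "(real \<Rightarrow> real) \<Rightarrow> (circle \<Rightarrow> circle) \<Rightarrow> bool" where
  "is_lift F f \<longleftrightarrow> F \<in> homeo_plus_real \<and> (\<forall>x. to_circle (F x) = f (to_circle x))"

text \<open>
  A homeomorphism of the circle preserves orientation iff it lifts to an increasing
  homeomorphism of the line.
\<close>

definition homeo_plus_circle :: "(circle \<Rightarrow> circle) monoid" where
  "homeo_plus_circle =
     \<lparr>carrier = {f. (\<exists>f'. homeomorphism UNIV UNIV f f') \<and> (\<exists>F. is_lift F f)},
      mult = (\<circ>), one = id\<rparr>"

text \<open>
  The limit exists and its class does not depend on the lift (lemma \<open>rot_eq\<close> below), so for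
  elements of \<^const>\<open>homeo_plus_circle\<close> the description is a proper one.
\<close>

definition rot :: "(circle \<Rightarrow> circle) \<Rightarrow> circle" where
  "rot f = (THE t. \<forall>F. is_lift F f \<longrightarrow>
      (\<exists>r. (\<lambda>n. (F ^^ n) 0 / real n) \<longlonglongrightarrow> r \<and> t = to_circle r))"

lemma homeo_plus_real_id: "id \<in> homeo_plus_real"
  unfolding homeo_plus_real_def
  by (auto simp: strict_mono_def homeomorphism_def intro!: exI[of _ id] continuous_on_id')

lemma homeomorphism_id: "homeomorphism UNIV UNIV id id"
  by (auto simp: homeomorphism_def id_def)

lemma homeo_plus_real_comp:
  assumes "F \<in> homeo_plus_real" "G \<in> homeo_plus_real"
  shows "F \<circ> G \<in> homeo_plus_real"
  using assms unfolding homeo_plus_real_def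
  by (auto simp: strict_mono_def intro: homeomorphism_compose)

lemma homeo_plus_real_inverse:
  assumes "F \<in> homeo_plus_real"
  obtains F' where "F' \<in> homeo_plus_real" "\<And>x. F (F' x) = x" "\<And>x. F' (F x) = x"
proof -
  obtain F' where h: "homeomorphism UNIV UNIV F F'" and m: "strict_mono F"
    using assms by (auto simp: homeo_plus_real_def)
  have 1: "F (F' x) = x" "F' (F x) = x" for x
    using h by (auto simp: homeomorphism_def)
  have "strict_mono F'"
  proof (rule strict_monoI)
    fix x y :: real assume "x < y"
    then show "F' x < F' y" using strict_mono_less[OF m, of "F' x" "F' y"] by (simp add: 1)
  qed
  then have "F' \<in> homeo_plus_real"
    using homeomorphism_symD[OF h] by (auto simp: homeo_plus_real_def)
  then show thesis using 1 by (rule that)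
qed

lemma group_homeo_plus_circle: "group homeo_plus_circle"
proof (rule groupI)
  fix f g assume "f \<in> carrier homeo_plus_circle" "g \<in> carrier homeo_plus_circle"
  then obtain F G f' g' where "is_lift F f" "is_lift G g"
    "homeomorphism UNIV UNIV f f'" "homeomorphism UNIV UNIV g g'"
    by (auto simp: homeo_plus_circle_def)
  then have "is_lift (F \<circ> G) (f \<circ> g)" "homeomorphism UNIV UNIV (f \<circ> g) (g' \<circ> f')"
    by (auto simp: is_lift_def homeo_plus_real_comp intro: homeomorphism_compose)
  then show "f \<otimes>\<^bsub>homeo_plus_circle\<^esub> g \<in> carrier homeo_plus_circle"
    by (auto simp: homeo_plus_circle_def)
next
  have "is_lift id id"
    by (simp add: is_lift_def homeo_plus_real_id)
  then show "\<one>\<^bsub>homeo_plus_circle\<^esub> \<in> carrier homeo_plus_circle"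
    using homeomorphism_id by (auto simp: homeo_plus_circle_def)
next
  fix f assume "f \<in> carrier homeo_plus_circle"
  then obtain F f' where F: "is_lift F f" and f': "homeomorphism UNIV UNIV f f'"
    by (auto simp: homeo_plus_circle_def)
  obtain F' where F': "F' \<in> homeo_plus_real" "\<And>x. F (F' x) = x"
    using F by (auto simp: is_lift_def elim: homeo_plus_real_inverse)
  have inv: "f' (f y) = y" for y using f' by (auto simp: homeomorphism_def)
  have "to_circle (F' x) = f' (to_circle x)" for x
    using F F'(2)[of x] inv[of "to_circle (F' x)"] by (metis is_lift_def)
  then have "is_lift F' f'" using F' by (simp add: is_lift_def)
  then have "f' \<in> carrier homeo_plus_circle"
    using homeomorphism_symD[OF f'] by (auto simp: homeo_plus_circle_def)
  moreover have "f' \<otimes>\<^bsub>homeo_plus_circle\<^esub> f = \<one>\<^bsub>homeo_plus_circle\<^esub>"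
    using inv by (auto simp: homeo_plus_circle_def)
  ultimately show "\<exists>y\<in>carrier homeo_plus_circle.
      y \<otimes>\<^bsub>homeo_plus_circle\<^esub> f = \<one>\<^bsub>homeo_plus_circle\<^esub>" by blast
qed (auto simp: homeo_plus_circle_def)

lemma is_lift_add_1:
  assumes "is_lift F f" "inj f"
  shows "F (x + 1) = F x + 1"
proof -
  have F: "F \<in> homeo_plus_real" "\<And>x. to_circle (F x) = f (to_circle x)"
    using assms by (auto simp: is_lift_def)
  have m: "strict_mono F" using F by (simp add: homeo_plus_real_def)
  obtain F' where F': "\<And>x. F (F' x) = x"
    using F(1) by (auto elim: homeo_plus_real_inverse)
  have "to_circle (x + 1) = to_circle x" by (simp add: to_circle_eq_iff)
  then have "to_circle (F (x + 1)) = to_circle (F x)" by (simp add: F(2))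
  then obtain k where k: "F (x + 1) - F x = of_int k"
    by (auto simp: to_circle_eq_iff elim: Ints_cases)
  have "F (x + 1) > F x" using m by (simp add: strict_mono_def)
  with k have "k \<ge> 1" by linarith
  moreover have "k < 2"
  proof (rule ccontr)
    assume "\<not> k < 2"
    then have k2: "F (x + 1) \<ge> F x + 2" using k by linarith
    define y where "y = F' (F x + 1)"
    have Fy: "F y = F x + 1" by (simp add: y_def F')
    have "F x < F y" "F y < F (x + 1)" using Fy k2 by auto
    then have xy: "x < y" "y < x + 1" using m by (auto simp: strict_mono_less)
    have "to_circle (F y) = to_circle (F x)" by (simp add: Fy to_circle_eq_iff)
    then have "to_circle y = to_circle x" using assms(2) by (simp add: F(2) inj_eq)
    then obtain j where "y - x = of_int j" by (auto simp: to_circle_eq_iff elim: Ints_cases)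
    with xy have "0 < j" "j < 1" by linarith+
    then show False by simp
  qed
  ultimately have "k = 1" by simp
  with k show ?thesis by simp
qed

lemma add_of_int_of_add_1:
  fixes F :: "real \<Rightarrow> real"
  assumes "\<And>x. F (x + 1) = F x + 1"
  shows "F (x + of_int k) = F x + of_int k"
proof (induction k rule: int_induct[where k = 0])
  case base
  show ?case by simp
next
  case (step1 i)
  then show ?case using assms[of "x + of_int i"] by (simp add: add.assoc)
next
  case (step2 i)
  then show ?case using assms[of "x + of_int (i - 1)"] by (simp add: algebra_simps)
qed

lemma funpow_add_of_int:
  fixes F :: "real \<Rightarrow> real"
  assumes "\<And>x. F (x + 1) = F x + 1"
  shows "(F ^^ n) (x + of_int k) = (F ^^ n) x + of_int k"
  by (induction n) (simp_all add: add_of_int_of_add_1[of F, OF assms])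

lemma displacement_bound:
  fixes F :: "real \<Rightarrow> real"
  assumes "strict_mono F" "\<And>x. F (x + 1) = F x + 1"
  shows "\<bar>(F ^^ n) x - x - (F ^^ n) 0\<bar> \<le> 1"
proof -
  have m: "mono (F ^^ n)"
    by (rule mono_pow[OF strict_mono_mono[OF assms(1)]])
  have "(F ^^ n) (of_int \<lfloor>x\<rfloor>) \<le> (F ^^ n) x" by (intro monoD[OF m]) simp
  moreover have "(F ^^ n) x \<le> (F ^^ n) (of_int (\<lfloor>x\<rfloor> + 1))"
    by (intro monoD[OF m]) linarith
  moreover have "(F ^^ n) (of_int k) = (F ^^ n) 0 + of_int k" for k
    using funpow_add_of_int[of F n 0 k] assms(2) by simp
  ultimately have "(F ^^ n) 0 + of_int \<lfloor>x\<rfloor> \<le> (F ^^ n) x"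
    "(F ^^ n) x \<le> (F ^^ n) 0 + (of_int \<lfloor>x\<rfloor> + 1)"
    by (metis of_int_add of_int_1)+
  then show ?thesis by linarith
qed

lemma translation_number_converges:
  fixes F :: "real \<Rightarrow> real"
  assumes F: "strict_mono F" "\<And>x. F (x + 1) = F x + 1"
  shows "convergent (\<lambda>n. (F ^^ n) 0 / real n)"
proof -
  define a where "a n = (F ^^ n) 0" for n
  have mult: "\<bar>a (m * n) - real m * a n\<bar> \<le> real m" for m n
  proof (induction m)
    case 0
    show ?case by (simp add: a_def)
  next
    case (Suc m)
    have "\<bar>a (Suc m * n) - a (m * n) - a n\<bar> \<le> 1"
      using displacement_bound[of F n "a (m * n)"] F by (simp add: a_def funpow_add)
    with Suc show ?case by (simp add: algebra_simps)
  qed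
  have close: "\<bar>a m / real m - a n / real n\<bar> \<le> 1 / real m + 1 / real n"
    if "m > 0" "n > 0" for m n
  proof -
    have 1: "\<bar>real m * a n - real n * a m\<bar> \<le> real m + real n"
      using mult[of m n] mult[of n m] by (simp add: mult.commute)
    have 2: "a m / real m - a n / real n = (real n * a m - real m * a n) / (real m * real n)"
      using that by (simp add: field_simps)
    have "\<bar>a m / real m - a n / real n\<bar> = \<bar>real n * a m - real m * a n\<bar> / (real m * real n)"
      unfolding 2 by (simp add: abs_mult)
    also have "\<dots> \<le> (real m + real n) / (real m * real n)"
      using 1 that by (intro divide_right_mono) (auto simp: abs_minus_commute)
    also have "\<dots> = 1 / real m + 1 / real n" using that by (simp add: field_simps)
    finally show ?thesis .
  qed
  have "Cauchy (\<lambda>n. a n / real n)"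
  proof (rule metric_CauchyI)
    fix e :: real assume "e > 0"
    then obtain N where N: "N > 0" "inverse (real N) < e / 2"
      using ex_inverse_of_nat_less[of "e / 2"] by auto
    have "dist (a m / real m) (a n / real n) < e" if "m \<ge> N" "n \<ge> N" for m n
    proof -
      have "inverse (real m) \<le> inverse (real N)" "inverse (real n) \<le> inverse (real N)"
        using that N by auto
      then show ?thesis
        using close[of m n] that N by (simp add: dist_real_def inverse_eq_divide)
    qed
    then show "\<exists>N. \<forall>m\<ge>N. \<forall>n\<ge>N. dist (a m / real m) (a n / real n) < e" by blast
  qed
  then show ?thesis unfolding a_def by (rule Cauchy_convergent)
qed

lemma is_lift_unique:
  assumes "is_lift F f" "is_lift G f" "inj f"
  obtains k :: int where "\<And>x. G x = F x + of_int k"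
proof -
  have mF: "strict_mono F" and mG: "strict_mono G"
    using assms by (auto simp: is_lift_def homeo_plus_real_def)
  have diff: "\<exists>k. G x - F x = of_int k" for x
  proof -
    have "to_circle (G x) = to_circle (F x)" using assms by (simp add: is_lift_def)
    then show ?thesis by (auto simp: to_circle_eq_iff elim: Ints_cases)
  qed
  obtain k where k: "G 0 - F 0 = of_int k" using diff by blast
  have F1: "F (x + 1) = F x + 1" and G1: "G (x + 1) = G x + 1" for x
    using assms is_lift_add_1 by auto
  have unit: "G x = F x + of_int k" if x: "0 \<le> x" "x < 1" for x
  proof -
    obtain j where j: "G x - F x = of_int j" using diff by blast
    have "F 0 \<le> F x" "F x < F 1" "G 0 \<le> G x" "G x < G 1"
      using x mF mG by (auto simp: strict_mono_less strict_mono_less_eq)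
    then have "of_int j < of_int k + (1::real)" "of_int k < of_int j + (1::real)"
      using F1[of 0] G1[of 0] k j by simp_all
    then have "j = k" by linarith
    with j show ?thesis by simp
  qed
  have "G x = F x + of_int k" for x
    using unit[of "frac x"] frac_ge_0[of x] frac_lt_1[of x]
      add_of_int_of_add_1[of F "frac x" "\<lfloor>x\<rfloor>", OF F1]
      add_of_int_of_add_1[of G "frac x" "\<lfloor>x\<rfloor>", OF G1]
    by (simp add: frac_def)
  then show thesis by (rule that)
qed

lemma rot_eq:
  assumes f: "f \<in> carrier homeo_plus_circle" and F: "is_lift F f"
  obtains r where "(\<lambda>n. (F ^^ n) 0 / real n) \<longlonglongrightarrow> r" "rot f = to_circle r"
proof -
  obtain f' where "homeomorphism UNIV UNIV f f'" using f by (auto simp: homeo_plus_circle_def)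
  then have inj: "inj f" by (metis homeomorphism_apply1 injI UNIV_I)
  have F1: "F (x + 1) = F x + 1" for x using is_lift_add_1[OF F inj] .
  have "strict_mono F" using F by (simp add: is_lift_def homeo_plus_real_def)
  then obtain r where r: "(\<lambda>n. (F ^^ n) 0 / real n) \<longlonglongrightarrow> r"
    using translation_number_converges[of F] F1 by (auto simp: convergent_def)
  have other: "\<exists>r'. (\<lambda>n. (G ^^ n) 0 / real n) \<longlonglongrightarrow> r' \<and> to_circle r = to_circle r'"
    if G: "is_lift G f" for G
  proof -
    obtain k :: int where k: "\<And>x. G x = F x + of_int k"
      using is_lift_unique[OF F G inj] by blast
    have pow: "(G ^^ n) 0 = (F ^^ n) 0 + real n * of_int k" for n
    proof (induction n)
      case (Suc n)
      have "F ((F ^^ n) 0 + of_int (int n * k)) = F ((F ^^ n) 0) + of_int (int n * k)"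
        using add_of_int_of_add_1[of F, OF F1] .
      with Suc show ?case by (simp add: k algebra_simps)
    qed simp
    have "(\<lambda>n. (F ^^ n) 0 / real n + of_int k) \<longlonglongrightarrow> r + of_int k"
      by (intro tendsto_add r tendsto_const)
    moreover have "\<forall>\<^sub>F n in sequentially. (F ^^ n) 0 / real n + of_int k = (G ^^ n) 0 / real n"
      using eventually_gt_at_top[of 0] by eventually_elim (simp add: pow field_simps)
    ultimately have "(\<lambda>n. (G ^^ n) 0 / real n) \<longlonglongrightarrow> r + of_int k"
      by (rule Lim_transform_eventually)
    moreover have "to_circle r = to_circle (r + of_int k)" by (simp add: to_circle_eq_iff)
    ultimately show ?thesis by blast
  qed
  have "rot f = to_circle r"
    unfolding rot_def
  proof (rule the_equality)
    show "\<forall>F. is_lift F f \<longrightarrow>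
        (\<exists>r'. (\<lambda>n. (F ^^ n) 0 / real n) \<longlonglongrightarrow> r' \<and> to_circle r = to_circle r')"
      using other by blast
  next
    fix t assume "\<forall>F. is_lift F f \<longrightarrow>
        (\<exists>r. (\<lambda>n. (F ^^ n) 0 / real n) \<longlonglongrightarrow> r \<and> t = to_circle r)"
    then show "t = to_circle r" using F r LIMSEQ_unique by blast
  qed
  with r show thesis by (rule that)
qed


section \<open>Finitely presented groups\<close>

text \<open>
  A letter \<open>(x, True)\<close> stands for the generator \<open>x\<close>, \<open>(x, False)\<close> for its inverse. The free
  group on \<open>S\<close> consists of the freely reduced words, multiplied by concatenating and reducing.
\<close>

type_synonym 'x word = "('x \<times> bool) list"

fun push :: "'x \<times> bool \<Rightarrow> 'x word \<Rightarrow> 'x word" where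
  "push a [] = [a]"
| "push a (b # w) = (if fst a = fst b \<and> snd a \<noteq> snd b then w else a # b # w)"

definition reduce :: "'x word \<Rightarrow> 'x word" where
  "reduce w = foldr push w []"

definition free_group :: "'x set \<Rightarrow> 'x word monoid" where
  "free_group S = \<lparr>carrier = {w \<in> lists (S \<times> UNIV). reduce w = w},
     mult = (\<lambda>u v. reduce (u @ v)), one = []\<rparr>"

definition normal_closure :: "('a, 'b) monoid_scheme \<Rightarrow> 'a set \<Rightarrow> 'a set" where
  "normal_closure G R = \<Inter>{N. N \<lhd> G \<and> R \<subseteq> N}"

text \<open>
  Finitely presented groups are countable, so up to isomorphism each of them has a carrier
  contained in \<^typ>\<open>nat\<close>, whether it is finite or infinite.
\<close>

definition finitely_presented :: "('a, 'b) monoid_scheme \<Rightarrow> bool" where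
  "finitely_presented G \<longleftrightarrow> group G \<and>
     (\<exists>(S :: nat set) R. finite S \<and> finite R \<and> R \<subseteq> carrier (free_group S) \<and>
        G \<cong> free_group S Mod normal_closure (free_group S) R)"

definition inv_letter :: "'x \<times> bool \<Rightarrow> 'x \<times> bool" where
  "inv_letter a = (fst a, \<not> snd a)"

fun is_reduced :: "'x word \<Rightarrow> bool" where
  "is_reduced (a # b # w) \<longleftrightarrow> b \<noteq> inv_letter a \<and> is_reduced (b # w)"
| "is_reduced _ \<longleftrightarrow> True"

lemma push_Cons: "push a (b # w) = (if b = inv_letter a then w else a # b # w)"
  by (cases a; cases b) (auto simp: inv_letter_def)

lemma inv_letter_inv_letter [simp]: "inv_letter (inv_letter a) = a"
  by (simp add: inv_letter_def)

declare push.simps(2) [simp del]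
declare push_Cons [simp]

lemma reduced_push: "is_reduced w \<Longrightarrow> is_reduced (push a w)"
  by (cases w rule: is_reduced.cases) auto

lemma reduced_reduce: "is_reduced (reduce w)"
  by (induction w) (auto simp: reduce_def reduced_push)

lemma reduced_foldr_push: "is_reduced w \<Longrightarrow> is_reduced (foldr push u w)"
  by (induction u) (auto simp: reduced_push)

lemma push_reduced: "is_reduced (a # w) \<Longrightarrow> push a w = a # w"
  by (cases w) auto

lemma reduce_reduced: "is_reduced w \<Longrightarrow> reduce w = w"
proof (induction w)
  case (Cons a w)
  have "is_reduced w" using Cons.prems by (cases w) auto
  with Cons show ?case using push_reduced[of a w] by (simp add: reduce_def)
qed (simp add: reduce_def)

lemma reduce_eq_iff: "reduce w = w \<longleftrightarrow> is_reduced w"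
  by (metis reduce_reduced reduced_reduce)

lemma push_flip: "is_reduced w \<Longrightarrow> push a (push (inv_letter a) w) = w"
  by (cases w) (auto intro: push_reduced)

lemma foldr_push_reduce:
  assumes "is_reduced w"
  shows "foldr push (reduce u) w = foldr push u w"
proof (induction u)
  case (Cons a u)
  have "foldr push (push a v) w = push a (foldr push v w)" for v
  proof (cases v)
    case (Cons b v')
    then show ?thesis using push_flip[OF reduced_foldr_push[OF assms], of a v'] by simp
  qed simp
  with Cons show ?case by (simp add: reduce_def)
qed (simp add: reduce_def)

lemma reduce_append: "reduce (u @ v) = foldr push u (reduce v)"
  by (simp add: reduce_def)

lemma push_in_lists: "a \<in> A \<Longrightarrow> w \<in> lists A \<Longrightarrow> push a w \<in> lists A"
  by (cases w) auto

lemma reduce_in_lists: "w \<in> lists A \<Longrightarrow> reduce w \<in> lists A"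
  by (induction w rule: lists.induct) (simp_all add: reduce_def push_in_lists del: in_lists_conv_set)

lemma foldr_push_inverse: "is_reduced w \<Longrightarrow> foldr push (rev (map inv_letter w)) w = []"
proof (induction w)
  case (Cons a w)
  have "is_reduced w" using Cons.prems by (cases w) auto
  with Cons show ?case by simp
qed simp

lemma group_free_group: "group (free_group S)"
proof (rule groupI)
  fix u v w
  assume "u \<in> carrier (free_group S)" "v \<in> carrier (free_group S)" "w \<in> carrier (free_group S)"
  then have "is_reduced w" by (simp add: free_group_def reduce_eq_iff)
  then have "reduce (reduce (u @ v) @ w) = reduce (u @ reduce (v @ w))"
    by (metis append_assoc foldr_append foldr_push_reduce reduce_append reduce_reduced reduced_reduce)
  then show "u \<otimes>\<^bsub>free_group S\<^esub> v \<otimes>\<^bsub>free_group S\<^esub> w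
      = u \<otimes>\<^bsub>free_group S\<^esub> (v \<otimes>\<^bsub>free_group S\<^esub> w)"
    by (simp add: free_group_def)
next
  fix w assume w: "w \<in> carrier (free_group S)"
  define v where "v = reduce (rev (map inv_letter w))"
  have "rev (map inv_letter w) \<in> lists (S \<times> UNIV)"
    using w by (fastforce simp: free_group_def inv_letter_def)
  then have "v \<in> carrier (free_group S)"
    unfolding v_def free_group_def using reduce_in_lists
    by (auto simp: reduce_eq_iff reduced_reduce simp del: in_lists_conv_set)
  moreover have "v \<otimes>\<^bsub>free_group S\<^esub> w = \<one>\<^bsub>free_group S\<^esub>"
    using w by (simp add: v_def free_group_def reduce_append foldr_push_reduce
        foldr_push_inverse reduce_eq_iff reduce_reduced)
  ultimately show "\<exists>v\<in>carrier (free_group S). v \<otimes>\<^bsub>free_group S\<^esub> w = \<one>\<^bsub>free_group S\<^esub>"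
    by blast
qed (auto simp: free_group_def reduce_eq_iff reduced_reduce reduce_in_lists
      simp del: in_lists_conv_set intro!: reduce_in_lists)

lemma normal_normal_closure:
  assumes "group G" "R \<subseteq> carrier G"
  shows "normal_closure G R \<lhd> G"
proof -
  interpret group G by fact
  have car: "carrier G \<lhd> G"
    by (auto simp: normal_inv_iff subgroup_self)
  have ne: "{N. N \<lhd> G \<and> R \<subseteq> N} \<noteq> {}" using car assms(2) by blast
  have "subgroup (normal_closure G R) G"
    unfolding normal_closure_def using ne
    by (intro subgroups_Inter) (auto simp: normal_imp_subgroup)
  then show ?thesis
    unfolding normal_inv_iff by (auto simp: normal_closure_def normal_inv_iff)
qed

end

theory Submission
  imports Defs
begin

text \<open>
  A finitely presented group can force \<open>rot \<beta> \<in> [0, 1/3]\<close> exactly, relative to an element \<open>\<nu>\<close> of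
  order three with rotation number \<open>1/3\<close>. Let \<open>A\<^sup>2 = \<nu>\<close>. If \<open>E\<^sub>0, E\<^sub>1, E\<^sub>2\<close> are conjugates of \<open>A\<close> by
  elements commuting with \<open>\<nu>\<close>, then the lifts of \<open>E\<^sub>1\<close> and \<open>E\<^sub>2\<close> are square roots of one and the same
  lift \<open>N\<close> of \<open>\<nu>\<close>, so they agree somewhere; hence \<open>F = E\<^sub>0 E\<^sub>1 E\<^sub>2\<^sup>-\<^sup>1\<close> moves some point \<open>x\<close> into
  \<open>[x, N x]\<close>, and as \<open>F\<close> commutes with \<open>N\<close> its translation number lies in \<open>[0, 1/3]\<close>. For the same
  reason \<open>D = E\<^sub>3 E\<^sub>4\<^sup>-\<^sup>1\<close> has a fixed point, so \<open>\<beta> D = F\<close> with \<open>D\<close> commuting with \<open>\<beta>\<close> confines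
  \<open>rot \<beta>\<close> to \<open>[0, 1/3]\<close>. In the threefold cover of \<open>PSL(2, \<real>)\<close>, where the \<open>E\<^sub>i\<close> cover half turns,
  every rotation by an angle in \<open>[0, 1/3]\<close> occurs as such a \<open>\<beta>\<close>; the factor \<open>D\<close> is needed only at the
  two end points, where \<open>F\<close> has to be hyperbolic.

  The square root \<open>A = \<nu>\<^sup>2\<close>, with rotation number \<open>2/3\<close> instead of \<open>1/6\<close>, is excluded by requiring
  that \<open>A\<^sup>-\<^sup>1\<close> be a product of two conjugates of \<open>\<nu>\<close> (a hyperbolic triangle group); this also makes
  everything die with \<open>\<nu>\<close>.

  Imposing the condition on \<open>\<beta>, \<beta>\<^sup>2, \<dots>, \<beta>\<^sup>m\<close> confines \<open>rot \<beta>\<close> to \<open>[0, 1/(3m)]\<close>, and then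
  \<open>\<alpha> = A\<^sup>c \<beta>\<^sup>j \<beta>'\<^sup>-\<^sup>k\<close> with commuting factors forces \<open>rot \<alpha>\<close> into an arc with rational end points, of
  any length. Every such value is attained with \<open>\<alpha>\<close> a rigid rotation, so conditions on the same
  \<open>\<alpha>\<close> can be imposed simultaneously, and finite intersections of such arcs shrink to any closed set.
\<close>

section \<open>Lifts of circle homeomorphisms\<close>

text \<open>Surjectivity and continuity of the inverse follow from these conditions, by the
  intermediate value theorem and by monotonicity. Up to \<open>circ\<close>, these are exactly the
  lifts of elements of \<open>homeo_plus_circle\<close>.\<close>

definition lifts :: "(real \<Rightarrow> real) set" where
  "lifts = {F. strict_mono F \<and> continuous_on UNIV F \<and> (\<forall>x. F (x + 1) = F x + 1)}"

lemma lifts_mono: "F \<in> lifts \<Longrightarrow> strict_mono F"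
  and lifts_cont: "F \<in> lifts \<Longrightarrow> continuous_on UNIV F"
  and lifts_1: "F \<in> lifts \<Longrightarrow> F (x + 1) = F x + 1"
  by (auto simp: lifts_def)

lemma lifts_less: "F \<in> lifts \<Longrightarrow> F x < F y \<longleftrightarrow> x < y"
  and lifts_le: "F \<in> lifts \<Longrightarrow> F x \<le> F y \<longleftrightarrow> x \<le> y"
  and lifts_eq: "F \<in> lifts \<Longrightarrow> F x = F y \<longleftrightarrow> x = y"
  by (auto dest!: lifts_mono simp: strict_mono_less strict_mono_less_eq strict_mono_eq)

lemma lifts_int: "F \<in> lifts \<Longrightarrow> F (x + of_int k) = F x + of_int k"
  by (simp add: add_of_int_of_add_1 lifts_1)

lemma lifts_translation: "(\<lambda>x. x + a) \<in> lifts"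
  by (auto simp: lifts_def strict_mono_def intro!: continuous_intros)

lemma lifts_id: "(\<lambda>x. x) \<in> lifts" "id \<in> lifts"
  using lifts_translation[of 0] by (simp_all add: id_def)

lemma lifts_comp: "F \<in> lifts \<Longrightarrow> G \<in> lifts \<Longrightarrow> F \<circ> G \<in> lifts"
  unfolding lifts_def
  by (auto simp: strict_mono_def intro: continuous_on_compose2[of UNIV F UNIV G])

lemma lifts_shift: "F \<in> lifts \<Longrightarrow> (\<lambda>x. F x + a) \<in> lifts"
  by (auto simp: lifts_def strict_mono_def intro!: continuous_intros)

abbreviation linv :: "(real \<Rightarrow> real) \<Rightarrow> real \<Rightarrow> real" where
  "linv \<equiv> inv_into UNIV"

lemma lifts_surj:
  assumes F: "F \<in> lifts"
  shows "\<exists>x. F x = y"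
proof -
  define k where "k = \<lceil>\<bar>y - F 0\<bar>\<rceil>"
  have k: "F (of_int (- k)) = F 0 - of_int k" "F (of_int k) = F 0 + of_int k"
    using lifts_int[OF F, of 0 k] lifts_int[OF F, of 0 "- k"] by simp_all
  have b: "\<bar>y - F 0\<bar> \<le> of_int k" by (simp add: k_def)
  then have "0 \<le> k" by linarith
  then show ?thesis
    using IVT'[of F "of_int (- k)" y "of_int k"] k b continuous_on_subset[OF lifts_cont[OF F]]
    by (auto simp: abs_le_iff)
qed

lemma
  assumes F: "F \<in> lifts"
  shows lifts_f_inv: "F (linv F x) = x" and lifts_inv_f: "linv F (F x) = x"
    and lifts_inv: "linv F \<in> lifts"
proof -
  have 1: "F (linv F x) = x" for x
    using lifts_surj[OF F, of x] by (auto intro: f_inv_into_f simp: image_iff)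
  have 2: "linv F (F x) = x" for x
    by (rule inv_f_f) (simp add: inj_def lifts_eq[OF F])
  show "F (linv F x) = x" "linv F (F x) = x" by (rule 1, rule 2)
  have mono: "strict_mono (linv F)"
    by (rule strict_monoI) (metis 1 lifts_less[OF F])
  moreover have "surj (linv F)" by (metis 2 surjI)
  then have "continuous_on UNIV (linv F)"
    using mono by (intro continuous_onI_mono) (auto simp: strict_mono_less_eq)
  moreover have "linv F (x + 1) = linv F x + 1" for x
    by (metis 1 2 lifts_1[OF F])
  ultimately show "linv F \<in> lifts" by (simp add: lifts_def)
qed

lemma lifts_homeo_plus_real: "F \<in> lifts \<Longrightarrow> F \<in> homeo_plus_real"
  unfolding homeo_plus_real_def homeomorphism_def
  by (auto intro!: exI[of _ "linv F"] lifts_mono lifts_cont lifts_inv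
      simp: lifts_f_inv lifts_inv_f image_def) (metis lifts_f_inv lifts_inv_f)+

section \<open>From lifts on the line to homeomorphisms of the circle\<close>

lemma to_circle_surj: "\<exists>x. c = to_circle x"
  by (metis Quotient_circle Quotient_abs_rep)

lemma to_circle_add: "to_circle (x + y) = to_circle x + to_circle y"
  and to_circle_diff: "to_circle (x - y) = to_circle x - to_circle y"
  and to_circle_minus: "to_circle (- x) = - to_circle x"
  and to_circle_0: "to_circle 0 = 0"
  by (simp_all add: plus_circle.abs_eq minus_circle.abs_eq uminus_circle.abs_eq zero_circle_def)

lemma to_circle_eqE:
  assumes "to_circle x = to_circle y"
  obtains k :: int where "x = y + of_int k"
  using assms by (auto simp: to_circle_eq_iff elim!: Ints_cases) (metis add.commute diff_add_cancel)

lemma to_circle_add_int: "to_circle (x + of_int k) = to_circle x"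
  by (simp add: to_circle_eq_iff)

text \<open>The representative picked by \<open>rep_circle\<close> makes \<open>circ\<close> total;
  for \<open>F\<close> in \<open>lifts\<close> the choice is immaterial by
  \<open>circ_to_circle\<close>.\<close>

definition circ :: "(real \<Rightarrow> real) \<Rightarrow> circle \<Rightarrow> circle" where
  "circ F c = to_circle (F (rep_circle c))"

lemma circ_to_circle:
  assumes "F \<in> lifts" shows "circ F (to_circle x) = to_circle (F x)"
proof -
  have "to_circle (rep_circle (to_circle x)) = to_circle x"
    by (metis Quotient_circle Quotient_abs_rep)
  then obtain k :: int where "rep_circle (to_circle x) = x + of_int k" by (rule to_circle_eqE)
  then show ?thesis by (simp add: circ_def lifts_int[OF assms] to_circle_add_int)
qed

lemma circ_comp:
  assumes "F \<in> lifts" "G \<in> lifts" shows "circ (F \<circ> G) = circ F \<circ> circ G"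
proof
  fix c obtain x where "c = to_circle x" using to_circle_surj by blast
  then show "circ (F \<circ> G) c = (circ F \<circ> circ G) c"
    by (simp add: circ_to_circle assms lifts_comp)
qed

lemma circ_id: "circ id = id"
proof
  fix c obtain x where "c = to_circle x" using to_circle_surj by blast
  then show "circ id c = id c" by (simp add: circ_to_circle lifts_id)
qed

lemma circ_shift: "F \<in> lifts \<Longrightarrow> circ (\<lambda>x. F x + of_int k) = circ F"
  by (simp add: circ_def fun_eq_iff to_circle_add_int)

lemma is_lift_circ: "F \<in> lifts \<Longrightarrow> is_lift F (circ F)"
  by (simp add: is_lift_def lifts_homeo_plus_real circ_to_circle)

lemma continuous_circ:
  assumes "F \<in> lifts" shows "continuous_on UNIV (circ F)"
proof -
  have "open (circ F -` U)" if "open U" for U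
  proof -
    have "open (F -` (to_circle -` U))"
      using that lifts_cont[OF assms] by (simp add: open_circle_def open_vimage)
    moreover have "to_circle -` (circ F -` U) = F -` (to_circle -` U)"
      by (auto simp: circ_to_circle assms)
    ultimately show ?thesis by (simp add: open_circle_def)
  qed
  then show ?thesis by (simp add: continuous_on_open_vimage)
qed

lemma circ_inverse:
  assumes "F \<in> lifts"
  shows "circ F \<circ> circ (linv F) = id" "circ (linv F) \<circ> circ F = id"
proof -
  have "F \<circ> linv F = id" "linv F \<circ> F = id"
    by (auto simp: lifts_f_inv lifts_inv_f assms)
  then show "circ F \<circ> circ (linv F) = id" "circ (linv F) \<circ> circ F = id"
    by (metis circ_comp circ_id assms lifts_inv)+
qed

lemma circ_carrier:
  assumes "F \<in> lifts" shows "circ F \<in> carrier homeo_plus_circle"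
proof -
  have "homeomorphism UNIV UNIV (circ F) (circ (linv F))"
    unfolding homeomorphism_def
    using circ_inverse[OF assms, unfolded fun_eq_iff] continuous_circ assms lifts_inv[OF assms]
    by (auto simp: continuous_circ image_iff) metis+
  then show ?thesis using is_lift_circ[OF assms] by (auto simp: homeo_plus_circle_def)
qed

lemma is_lift_lifts:
  assumes "f \<in> carrier homeo_plus_circle" "is_lift F f"
  shows "F \<in> lifts" "f = circ F"
proof -
  have "inj f" using assms(1) by (auto simp: homeo_plus_circle_def) (metis homeomorphism_apply1 injI UNIV_I)
  then have 1: "F (x + 1) = F x + 1" for x using is_lift_add_1 assms by blast
  show F: "F \<in> lifts" using assms(2) 1
    by (auto simp: lifts_def is_lift_def homeo_plus_real_def homeomorphism_def)
  show "f = circ F"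
  proof
    fix c obtain x where "c = to_circle x" using to_circle_surj by blast
    then show "f c = circ F c" using assms(2) F by (simp add: circ_to_circle is_lift_def)
  qed
qed

lemma carrier_liftE:
  assumes "f \<in> carrier homeo_plus_circle"
  obtains F where "F \<in> lifts" "f = circ F"
  using assms is_lift_lifts unfolding homeo_plus_circle_def by fastforce

lemma circ_eqE:
  assumes "F \<in> lifts" "G \<in> lifts" "circ F = circ G"
  obtains k :: int where "\<And>x. F x = G x + of_int k"
proof -
  have "inj (circ G)"
    using circ_inverse(2)[OF assms(2)] by (metis inj_on_id inj_on_imageI2)
  then show thesis
    using is_lift_unique[of G "circ G" F] is_lift_circ assms that by metis
qed

lemma circ_eqI: "F \<in> lifts \<Longrightarrow> (\<And>x. F x = G x + of_int k) \<Longrightarrow> circ F = circ G"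
  by (simp add: circ_def fun_eq_iff to_circle_add_int)

lemma mult_homeo: "f \<otimes>\<^bsub>homeo_plus_circle\<^esub> g = f \<circ> g"
  and one_homeo: "\<one>\<^bsub>homeo_plus_circle\<^esub> = id"
  by (simp_all add: homeo_plus_circle_def)

interpretation homeo: group homeo_plus_circle
  by (rule group_homeo_plus_circle)

section \<open>Translation numbers and forcing\<close>

definition has_trn :: "(real \<Rightarrow> real) \<Rightarrow> real \<Rightarrow> bool" where
  "has_trn F r \<longleftrightarrow> (\<lambda>n. (F ^^ n) 0 / real n) \<longlonglongrightarrow> r"

text \<open>The bounded difference disappears after division by \<open>n\<close>. This makes
  translation numbers insensitive to the starting point and to conjugation.\<close>

lemma lim_bounded_diff:
  fixes a b :: "nat \<Rightarrow> real"
  assumes "\<And>n. \<bar>a n - b n\<bar> \<le> C" "(\<lambda>n. a n / real n) \<longlonglongrightarrow> r"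
  shows "(\<lambda>n. b n / real n) \<longlonglongrightarrow> r"
proof -
  have "(\<lambda>n. (b n - a n) / real n) \<longlonglongrightarrow> 0"
  proof (rule Lim_null_comparison)
    show "\<forall>\<^sub>F n in sequentially. norm ((b n - a n) / real n) \<le> C / real n"
      using assms(1) by (auto intro!: always_eventually divide_right_mono simp: abs_minus_commute)
    show "(\<lambda>n. C / real n) \<longlonglongrightarrow> 0" by (rule lim_const_over_n)
  qed
  from tendsto_add[OF assms(2) this] show ?thesis by (simp add: diff_divide_distrib)
qed

lemma has_trn_unique: "has_trn F r \<Longrightarrow> has_trn F s \<Longrightarrow> r = s"
  by (auto simp: has_trn_def intro: LIMSEQ_unique)

lemma has_trn_exists: "F \<in> lifts \<Longrightarrow> \<exists>r. has_trn F r"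
  using translation_number_converges[of F] by (auto simp: has_trn_def convergent_def lifts_mono lifts_1)

lemma lifts_displacement: "F \<in> lifts \<Longrightarrow> \<bar>(F ^^ n) x - x - (F ^^ n) 0\<bar> \<le> 1"
  by (rule displacement_bound) (simp_all add: lifts_mono lifts_1)

lemma has_trn_at:
  assumes "F \<in> lifts"
  shows "has_trn F r \<longleftrightarrow> (\<lambda>n. (F ^^ n) x / real n) \<longlonglongrightarrow> r"
proof -
  have "\<bar>(F ^^ n) x - (F ^^ n) 0\<bar> \<le> 1 + \<bar>x\<bar>" for n
    using lifts_displacement[OF assms, of n x] by linarith
  then show ?thesis unfolding has_trn_def
    using lim_bounded_diff[of "\<lambda>n. (F ^^ n) x" "\<lambda>n. (F ^^ n) 0" "1 + \<bar>x\<bar>"]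
      lim_bounded_diff[of "\<lambda>n. (F ^^ n) 0" "\<lambda>n. (F ^^ n) x" "1 + \<bar>x\<bar>"]
    by (auto simp: abs_minus_commute)
qed

lemma rot_circ:
  assumes "F \<in> lifts" "has_trn F r" shows "rot (circ F) = to_circle r"
  using rot_eq[OF circ_carrier[OF assms(1)] is_lift_circ[OF assms(1)]] assms(2)
  by (metis has_trn_def LIMSEQ_unique)

lemma has_trn_translation: "has_trn (\<lambda>x. x + a) a"
proof -
  have "((\<lambda>x. x + a) ^^ n) 0 = real n * a" for n
    by (induction n) (simp_all add: algebra_simps)
  then have "\<forall>\<^sub>F n in sequentially. a = ((\<lambda>x. x + a) ^^ n) 0 / real n"
    by (intro eventually_mono[OF eventually_gt_at_top[of 0]]) simp
  then show ?thesis unfolding has_trn_def by (rule Lim_transform_eventually[OF tendsto_const])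
qed

lemma has_trn_id: "has_trn id 0"
  using has_trn_translation[of 0] by (simp add: id_def)

lemma lifts_funpow: "F \<in> lifts \<Longrightarrow> F ^^ n \<in> lifts"
  by (induction n) (simp_all add: lifts_id lifts_comp)

lemma funpow_commute:
  fixes F G :: "'a \<Rightarrow> 'a"
  assumes "\<And>x. F (G x) = G (F x)" shows "(F ^^ n) (G x) = G ((F ^^ n) x)"
  by (induction n) (simp_all add: assms)

text \<open>Commutation turns the iterates of the product into \<open>F^n G^n\<close>, and
  \<open>F^n\<close> displaces a point and 0 by amounts that differ by at most 1.\<close>

lemma has_trn_comp:
  assumes F: "F \<in> lifts" and G: "G \<in> lifts" and c: "\<And>x. F (G x) = G (F x)"
    and "has_trn F r" "has_trn G s"
  shows "has_trn (F \<circ> G) (r + s)"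
proof -
  have e: "((F \<circ> G) ^^ n) x = (F ^^ n) ((G ^^ n) x)" for n x
  proof (induction n)
    case (Suc n)
    then show ?case using funpow_commute[of F G n "(G ^^ n) x", OF c] by simp
  qed simp
  have "\<bar>(F ^^ n) 0 + (G ^^ n) 0 - ((F \<circ> G) ^^ n) 0\<bar> \<le> 1" for n
    using lifts_displacement[OF F, of n "(G ^^ n) 0"] unfolding e by linarith
  moreover have "(\<lambda>n. ((F ^^ n) 0 + (G ^^ n) 0) / real n) \<longlonglongrightarrow> r + s"
    using tendsto_add[OF assms(4,5)[unfolded has_trn_def]] by (simp add: add_divide_distrib)
  ultimately show ?thesis unfolding has_trn_def by (rule lim_bounded_diff)
qed

lemma has_trn_shift:
  assumes "F \<in> lifts" "has_trn F r" shows "has_trn (\<lambda>x. F x + of_int k) (r + of_int k)"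
proof -
  have "(\<lambda>x. F x + of_int k) = F \<circ> (\<lambda>x. x + of_int k)"
    by (auto simp: lifts_int assms)
  then show ?thesis
    using has_trn_comp[OF assms(1) lifts_translation[of "of_int k"] _ assms(2) has_trn_translation]
    by (simp add: lifts_int assms)
qed

lemma lifts_near_id:
  assumes F: "F \<in> lifts" shows "\<bar>F x - x\<bar> \<le> 1 + \<bar>F 0\<bar>"
  using lifts_displacement[OF F, of 1 x] by simp

text \<open>The conjugate moves \<open>G 0\<close> along the \<open>G\<close>-image of the
  \<open>F\<close>-orbit of 0, and \<open>G\<close> displaces all points by a bounded
  amount.\<close>

lemma has_trn_conj:
  assumes F: "F \<in> lifts" and G: "G \<in> lifts" and r: "has_trn F r"
  shows "has_trn (G \<circ> F \<circ> linv G) r"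
proof -
  have e: "((G \<circ> F \<circ> linv G) ^^ n) (G 0) = G ((F ^^ n) 0)" for n
    by (induction n) (simp_all add: lifts_inv_f G)
  have "\<bar>(F ^^ n) 0 - ((G \<circ> F \<circ> linv G) ^^ n) (G 0)\<bar> \<le> 1 + \<bar>G 0\<bar>" for n
    unfolding e using lifts_near_id[OF G, of "(F ^^ n) 0"] by (simp add: abs_minus_commute)
  then show ?thesis
    using lim_bounded_diff[OF _ r[unfolded has_trn_def], of "\<lambda>n. ((G \<circ> F \<circ> linv G) ^^ n) (G 0)"]
    by (subst has_trn_at[where x = "G 0"]) (auto intro: lifts_comp lifts_inv F G)
qed

text \<open>One point \<open>y\<close> suffices, since commutation propagates the comparison:
  \<open>F^(n+1) y \<le> F^n (G y) = G (F^n y) \<le> G^(n+1) y\<close>.\<close>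

lemma has_trn_mono:
  assumes "F \<in> lifts" "G \<in> lifts" "\<And>x. F (G x) = G (F x)" "F y \<le> G y" "has_trn F r" "has_trn G s"
  shows "r \<le> s"
proof -
  have "(F ^^ n) y \<le> (G ^^ n) y" for n
  proof (induction n)
    case (Suc n)
    have "(F ^^ Suc n) y \<le> (F ^^ n) (G y)"
      unfolding funpow_Suc_right by (simp add: lifts_le lifts_funpow assms)
    also have "\<dots> = G ((F ^^ n) y)" using assms(3) by (rule funpow_commute)
    also have "\<dots> \<le> (G ^^ Suc n) y" using Suc by (simp add: lifts_le assms)
    finally show ?case .
  qed simp
  then show ?thesis using assms(5,6) unfolding has_trn_at[OF assms(1), of _ y] has_trn_at[OF assms(2), of _ y]
    by (metis (no_types, lifting) LIMSEQ_le divide_right_mono of_nat_0_le_iff)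
qed

text \<open>On the line the two products might differ by an integer \<open>k\<close>. Then
  \<open>F\<close> would be conjugate to \<open>F + k\<close>, and invariance of the translation
  number forces \<open>k = 0\<close>.\<close>

lemma lifts_commute:
  assumes F: "F \<in> lifts" and G: "G \<in> lifts" and c: "circ F \<circ> circ G = circ G \<circ> circ F"
  shows "F (G x) = G (F x)"
proof -
  have "circ (F \<circ> G) = circ (G \<circ> F)" using c by (simp add: circ_comp F G)
  then obtain k :: int where k: "\<And>x. (F \<circ> G) x = (G \<circ> F) x + of_int k"
    using circ_eqE[OF lifts_comp[OF F G] lifts_comp[OF G F]] by metis
  obtain r where r: "has_trn F r" using has_trn_exists[OF F] by blast
  have "linv G \<circ> F \<circ> linv (linv G) = (\<lambda>x. F x + of_int k)"
  proof
    fix x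
    have "linv (linv G) x = G x"
      by (metis G lifts_inv lifts_f_inv lifts_inv_f)
    then show "(linv G \<circ> F \<circ> linv (linv G)) x = F x + of_int k"
      using k[of x] by (simp add: lifts_int lifts_inv lifts_inv_f G)
  qed
  then have "has_trn (\<lambda>x. F x + of_int k) r"
    using has_trn_conj[OF F lifts_inv[OF G] r] by simp
  from has_trn_unique[OF this has_trn_shift[OF F r, of k]] have "k = 0" by simp
  with k show ?thesis by simp
qed

lemma rot_comp:
  assumes "f \<in> carrier homeo_plus_circle" "g \<in> carrier homeo_plus_circle" "f \<circ> g = g \<circ> f"
  shows "rot (f \<circ> g) = rot f + rot g"
proof -
  obtain F G where FG: "F \<in> lifts" "f = circ F" "G \<in> lifts" "g = circ G"
    using assms carrier_liftE by metis
  obtain r s where rs: "has_trn F r" "has_trn G s" using FG has_trn_exists by metis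
  have "has_trn (F \<circ> G) (r + s)"
    using FG rs assms(3) by (intro has_trn_comp lifts_commute) auto
  then have "rot (circ (F \<circ> G)) = to_circle (r + s)" by (simp add: rot_circ lifts_comp FG)
  then show ?thesis using FG rs by (simp add: circ_comp rot_circ to_circle_add)
qed

lemma homeo_funpow: "f \<in> carrier homeo_plus_circle \<Longrightarrow> f ^^ n \<in> carrier homeo_plus_circle"
  using homeo.m_closed homeo.one_closed by (induction n) (auto simp: mult_homeo one_homeo)

lemma rot_id: "rot id = 0"
  using rot_circ[OF lifts_id(2) has_trn_id] unfolding circ_id to_circle_0 .

lemma rot_funpow:
  assumes "f \<in> carrier homeo_plus_circle" "rot f = to_circle t"
  shows "rot (f ^^ n) = to_circle (real n * t)"
proof (induction n)
  case 0 show ?case by (simp add: rot_id rot_id[unfolded id_def] to_circle_0)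
next
  case (Suc n)
  have "rot (f \<circ> f ^^ n) = rot f + rot (f ^^ n)"
    by (rule rot_comp) (auto simp: assms homeo_funpow fun_eq_iff funpow_swap1)
  also have "\<dots> = to_circle (t + real n * t)" unfolding Suc assms(2) to_circle_add ..
  also have "f \<circ> f ^^ n = f ^^ Suc n" by (simp add: fun_eq_iff)
  finally show ?case by (simp add: algebra_simps)
qed

lemma carrier_cancel:
  assumes "h \<in> carrier homeo_plus_circle" "f \<circ> h = g \<circ> h" shows "f = g"
proof -
  obtain H where "H \<in> lifts" "h = circ H" using assms carrier_liftE by metis
  then have "h \<circ> circ (linv H) = id" by (simp add: circ_inverse)
  then show ?thesis using assms(2) by (metis comp_assoc comp_id)
qed

section \<open>Elements of order three and their lifts\<close>

lemma lifts_cube_mono: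
  assumes F: "F \<in> lifts" and G: "G \<in> lifts" and less: "\<And>x. F x < G x"
  shows "F (F (F x)) < G (G (G x))"
  by (meson F G less lifts_less less_trans)

lemma lifts_cube_eq_id:
  assumes F: "F \<in> lifts" and c: "F (F (F x)) = x" shows "F x = x"
  by (metis F c lifts_less less_asym linorder_neqE order.strict_trans)

lemma torsion3_lift:
  assumes "n \<in> carrier homeo_plus_circle" "n \<circ> n \<circ> n = id"
  obtains N :: "real \<Rightarrow> real" and m :: int
  where "N \<in> lifts" "n = circ N" "\<And>x. N (N (N x)) = x + of_int m" "m \<in> {0, 1, 2}"
    "has_trn N (of_int m / 3)" "rot n = to_circle (of_int m / 3)"
proof -
  obtain N0 where N0: "N0 \<in> lifts" "n = circ N0" using assms carrier_liftE by metis
  have "circ (N0 \<circ> N0 \<circ> N0) = circ id" using assms(2) N0 by (simp add: circ_comp lifts_comp circ_id)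
  then obtain j :: int where j: "\<And>x. (N0 \<circ> N0 \<circ> N0) x = id x + of_int j"
    using circ_eqE N0 lifts_comp lifts_id by metis
  \<comment> \<open>Adding \<open>k\<close> to a lift adds \<open>3 * k\<close> to its cube, so
    \<open>j\<close> can be reduced to its residue modulo 3.\<close>
  define m where "m = j mod 3"
  define k where "k = - (j div 3)"
  define N where "N = (\<lambda>x. N0 x + of_int k)"
  have N: "N \<in> lifts" "n = circ N" using N0 by (simp_all add: N_def lifts_shift circ_shift)
  have "j = m + 3 * (j div 3)" by (simp add: m_def)
  then have jm: "of_int j = of_int m - 3 * (of_int k :: real)" unfolding k_def by linarith
  have cube: "N (N (N x)) = x + of_int m" for x
    using j[of x] jm unfolding N_def lifts_int[OF N0(1)] by simp
  have m: "m \<in> {0, 1, 2}" using pos_mod_bound[of 3 j] pos_mod_sign[of 3 j] by (auto simp: m_def)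
  obtain r where r: "has_trn N r" using has_trn_exists[OF N(1)] by blast
  have "has_trn (N \<circ> N \<circ> N) (r + r + r)"
    using N(1) r by (intro has_trn_comp lifts_comp) auto
  moreover have "N \<circ> N \<circ> N = (\<lambda>x. x + of_int m)" using cube by auto
  ultimately have "r + r + r = of_int m" using has_trn_translation has_trn_unique by metis
  then have "r = of_int m / 3" by simp
  with that N cube m r show thesis using rot_circ by blast
qed

lemma to_circle_thirds:
  assumes "m \<in> {0, 1, 2}" "m' \<in> {0, 1, 2}" "to_circle (of_int m / 3) = to_circle (of_int m' / 3)"
  shows "m = m'"
proof -
  obtain k :: int where "of_int m / 3 = of_int m' / 3 + (of_int k :: real)"
    using assms(3) by (rule to_circle_eqE)
  then have "of_int m = (of_int (m' + 3 * k) :: real)" by simp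
  then have "m = m' + 3 * k" by (simp only: of_int_eq_iff)
  with assms(1,2) show ?thesis by auto
qed

lemma torsion3_rot_0:
  assumes "n \<in> carrier homeo_plus_circle" "n \<circ> n \<circ> n = id" "rot n = 0"
  shows "n = id"
proof -
  from assms(1,2) obtain N :: "real \<Rightarrow> real" and m :: int
    where N: "N \<in> lifts" "n = circ N" "\<And>x. N (N (N x)) = x + of_int m" "m \<in> {0, 1, 2}"
      "rot n = to_circle (of_int m / 3)"
    by (rule torsion3_lift) blast
  have "m = 0" using to_circle_thirds[of m 0] N assms(3) by (simp add: to_circle_0)
  then have "N = id" using N(3) lifts_cube_eq_id[OF N(1)] by fastforce
  then show ?thesis by (simp add: N circ_id)
qed

lemma torsion3_rot_third:
  assumes "n \<in> carrier homeo_plus_circle" "n \<circ> n \<circ> n = id" "rot n = to_circle (1/3)"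
  obtains N where "N \<in> lifts" "n = circ N" "\<And>x. N (N (N x)) = x + 1" "has_trn N (1/3)"
proof -
  from assms(1,2) obtain N :: "real \<Rightarrow> real" and m :: int
    where N: "N \<in> lifts" "n = circ N" "\<And>x. N (N (N x)) = x + of_int m" "m \<in> {0, 1, 2}"
      "has_trn N (of_int m / 3)" "rot n = to_circle (of_int m / 3)"
    by (rule torsion3_lift) blast
  have "m = 1" using to_circle_thirds[of m 1] N assms(3) by simp
  with N that show thesis by simp
qed

section \<open>Square roots of a common lift, and the forcing relations\<close>

text \<open>If \<open>E < F\<close> everywhere, then \<open>E (E x) < E (F x) < F (F x)\<close>,
  against the equality of the squares. So \<open>E - F\<close> takes both weak signs, and the
  intermediate value theorem applies.\<close>

lemma lifts_cross:
  assumes E: "E \<in> lifts" and F: "F \<in> lifts" and eq: "\<And>x. E (E x) = F (F x)"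
  obtains x where "E x = F x"
proof -
  have c: "continuous_on S (\<lambda>x. E x - F x)" for S
    using continuous_on_subset[OF lifts_cont[OF E]] continuous_on_subset[OF lifts_cont[OF F]]
    by (intro continuous_intros) auto
  have no: False if "\<And>x. E x < F x" "E \<in> lifts" "F \<in> lifts" "\<And>x. E (E x) = F (F x)" for E F :: "real \<Rightarrow> real"
    using that by (metis lifts_less less_trans less_irrefl)
  obtain x where x: "E x \<ge> F x" using no[of E F] E F eq by (meson not_le)
  obtain y where y: "E y \<le> F y" using no[of F E] E F eq by (metis not_le)
  show thesis
  proof (cases x y rule: linorder_cases)
    case less
    then show thesis using IVT2'[of "\<lambda>x. E x - F x" y 0 x] c x y that by auto
  next
    case greater
    then show thesis using IVT'[of "\<lambda>x. E x - F x" y 0 x] c x y that by auto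
  qed (use x y that antisym in blast)
qed

text \<open>Conjugacy is written \<open>e \<circ> w = w \<circ> a\<close> so that it can serve as a
  relation without inverses. The lift obtained for \<open>e\<close> is conjugate to the given
  \<open>A\<close> itself, with no integer ambiguity.\<close>

lemma conj_lift:
  assumes w: "w \<in> carrier homeo_plus_circle" and A: "A \<in> lifts" and eq: "e \<circ> w = w \<circ> circ A"
  obtains W where "W \<in> lifts" "w = circ W" "e = circ (W \<circ> A \<circ> linv W)" "W \<circ> A \<circ> linv W \<in> lifts"
proof -
  obtain W where W: "W \<in> lifts" "w = circ W" using w carrier_liftE by metis
  have E: "W \<circ> A \<circ> linv W \<in> lifts" using W A by (simp add: lifts_comp lifts_inv)
  have "circ (W \<circ> A \<circ> linv W) \<circ> w = w \<circ> circ A"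
    using circ_inverse(2)[OF W(1)] W A
    by (simp add: circ_comp lifts_comp lifts_inv comp_assoc)
  then have "e = circ (W \<circ> A \<circ> linv W)" using carrier_cancel[OF w] eq by metis
  with that W E show thesis by blast
qed

lemma rot_conj:
  assumes "w \<in> carrier homeo_plus_circle" "f \<in> carrier homeo_plus_circle" "e \<circ> w = w \<circ> f"
  shows "rot e = rot f"
proof -
  obtain F where F: "F \<in> lifts" "f = circ F" using assms carrier_liftE by metis
  obtain r where r: "has_trn F r" using has_trn_exists[OF F(1)] by blast
  obtain W where "W \<in> lifts" "w = circ W" "e = circ (W \<circ> F \<circ> linv W)" "W \<circ> F \<circ> linv W \<in> lifts"
    using conj_lift[OF assms(1) F(1)] assms(3) F(2) by metis
  then show ?thesis using rot_circ has_trn_conj F r by metis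
qed

text \<open>
  The group generated by \<open>a\<close>, \<open>n1\<close>, \<open>n2\<close> is a quotient of the \<open>(3,3,6)\<close> triangle group once \<open>n\<close> has
  order three. The element \<open>a = n\<^sup>2\<close> is also a square root of such an \<open>n\<close>, but is ruled out
  by the last equation.
\<close>

definition triangle :: "_ \<Rightarrow> _ \<Rightarrow> _ \<Rightarrow> _ \<Rightarrow> _ \<Rightarrow> _ \<Rightarrow> bool" where
  "triangle a n n1 n2 u v \<longleftrightarrow>
     a \<circ> a = n \<and> n1 \<circ> u = u \<circ> n \<and> n2 \<circ> v = v \<circ> n \<and> a \<circ> n1 \<circ> n2 = (id :: circle \<Rightarrow> circle)"

text \<open>Any lift of \<open>a\<close> squares to \<open>N + k\<close> for some integer
  \<open>k\<close>. An even \<open>k\<close> is absorbed by changing the lift. An odd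
  \<open>k\<close> leads to \<open>a = n \<circ> n\<close>, which the last triangle equation
  excludes by comparing cubes of lifts.\<close>

lemma triangle_lift:
  assumes car: "a \<in> carrier homeo_plus_circle" "u \<in> carrier homeo_plus_circle" "v \<in> carrier homeo_plus_circle"
    and N: "N \<in> lifts" "\<And>x. N (N (N x)) = x + 1"
    and tri: "triangle a (circ N) n1 n2 u v"
  obtains A where "A \<in> lifts" "a = circ A" "\<And>x. A (A x) = N x"
proof -
  obtain A0 where A0: "A0 \<in> lifts" "a = circ A0" using car carrier_liftE by metis
  have "circ (A0 \<circ> A0) = circ N" using tri A0 by (simp add: triangle_def circ_comp)
  then obtain k :: int where k: "\<And>x. (A0 \<circ> A0) x = N x + of_int k"
    using circ_eqE A0 N lifts_comp by metis
  have k: "A0 (A0 x) = N x + of_int k" for x using k[of x] by simp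
  show thesis
  proof (cases "even k")
    case True
    then obtain j where j: "k = 2 * j" by blast
    define A where "A = (\<lambda>x. A0 x + of_int (- j))"
    have "A \<in> lifts" "a = circ A" using A0 circ_shift[of A0 "- j"] by (simp_all add: A_def lifts_shift del: of_int_minus)
    moreover have "A (A x) = N x" for x
      using k[of x] lifts_int[OF A0(1), of "A0 x" "- j"] by (simp add: A_def j)
    ultimately show thesis by (rule that)
  next
    case False
    then obtain j where j: "k = 2 * j + 1" by (metis oddE)
    define A where "A = (\<lambda>x. A0 x + of_int (- j))"
    have A: "A \<in> lifts" "a = circ A" using A0 circ_shift[of A0 "- j"] by (simp_all add: A_def lifts_shift del: of_int_minus)
    have A2: "A (A x) = N x + 1" for x
      using k[of x] lifts_int[OF A0(1), of "A0 x" "- j"] by (simp add: A_def j)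
    have N1: "N (x + 1) = N x + 1" for x by (rule lifts_1[OF N(1)])
    have comm: "A (N x) = N (A x)" for x
    proof -
      have "A (N x) + 1 = A (A (A x))" using A2[of x] lifts_1[OF A(1)] by metis
      then show ?thesis using A2[of "A x"] by simp
    qed
    \<comment> \<open>\<open>A\<close> and \<open>N \<circ> N\<close> commute and have the same
      square \<open>N + 1\<close>; a strict inequality between them at one point would pass to the
      squares.\<close>
    have AN: "A x = N (N x)" for x
    proof (rule ccontr)
      have 4: "N (N (N (N x))) = A (A x)" by (simp add: A2 N N1 lifts_1)
      have c: "A (N (N x)) = N (N (A x))" by (simp add: comm)
      assume "A x \<noteq> N (N x)"
      then consider "A x < N (N x)" | "N (N x) < A x" by linarith
      then show False
      proof cases
        case 1
        then have "A (A x) < N (N (A x))" using A(1) c by (metis lifts_less)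
        also have "\<dots> < N (N (N (N x)))" using 1 by (simp add: lifts_less N(1))
        finally show False by (simp add: 4)
      next
        case 2
        then have "N (N (N (N x))) < N (N (A x))" by (simp add: lifts_less N(1))
        also have "\<dots> < A (A x)" using A(1) c 2 by (metis lifts_less)
        finally show False by (simp add: 4)
      qed
    qed
    then have a: "a = circ (N \<circ> N)" using A by (metis (no_types, lifting) comp_def ext)
    obtain U where U: "U \<in> lifts" "n1 = circ (U \<circ> N \<circ> linv U)" "U \<circ> N \<circ> linv U \<in> lifts"
      using conj_lift[OF car(2) N(1)] tri unfolding triangle_def by metis
    obtain V where V: "V \<in> lifts" "n2 = circ (V \<circ> N \<circ> linv V)" "V \<circ> N \<circ> linv V \<in> lifts"
      using conj_lift[OF car(3) N(1)] tri unfolding triangle_def by metis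
    define N1 N2 where "N1 = U \<circ> N \<circ> linv U" and "N2 = V \<circ> N \<circ> linv V"
    have N12: "N1 \<in> lifts" "N2 \<in> lifts" using U V by (simp_all add: N1_def N2_def)
    have cube: "N1 (N1 (N1 x)) = x + 1" "N2 (N2 (N2 x)) = x + 1" for x
      using U(1) V(1) by (simp_all add: N1_def N2_def lifts_inv_f N lifts_1 lifts_f_inv)
    have "circ (N \<circ> N \<circ> N1 \<circ> N2) = circ id"
      using tri U V N(1) N12 a by (simp add: triangle_def circ_comp lifts_comp circ_id N1_def N2_def)
    then obtain m :: int where m: "\<And>x. (N \<circ> N \<circ> N1 \<circ> N2) x = id x + of_int m"
      using circ_eqE N(1) N12 lifts_comp lifts_id by metis
    have m: "N1 (N2 x) = N x + of_int (m - 1)" for x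
    proof -
      have "N1 (N2 x) + 1 = N (x + of_int m)" using m[of x] N(2)[of "N1 (N2 x)"] by simp
      then show ?thesis using lifts_int[OF N(1)] by simp
    qed
    have gt: "x < N2 x" for x
    proof (rule ccontr)
      assume "\<not> x < N2 x"
      then have "N2 x \<le> x" by simp
      moreover from this have "N2 (N2 x) \<le> N2 x" by (simp add: lifts_le N12)
      moreover from this have "N2 (N2 (N2 x)) \<le> N2 (N2 x)" by (simp add: lifts_le N12)
      ultimately show False using cube(2)[of x] by linarith
    qed
    define G where "G = (\<lambda>x. N x + of_int (m - 1))"
    have G: "G \<in> lifts" unfolding G_def by (rule lifts_shift[OF N(1)])
    \<comment> \<open>\<open>N2\<close> moves points up, so \<open>N1 < N1 \<circ> N2 = G\<close>;
      cubing turns this into \<open>1 < 1 + 3 * (m - 1)\<close>.\<close>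
    have "N1 x < G x" for x
      unfolding G_def m[symmetric] using gt by (simp add: lifts_less N12)
    from lifts_cube_mono[OF N12(1) G this, of 0]
    have "1 < 1 + 3 * real_of_int (m - 1)"
      unfolding G_def lifts_int[OF N(1)] cube N(2) by (simp add: algebra_simps)
    then have "0 < real_of_int (m - 1)" by simp
    then have m2: "m - 1 \<ge> 1" unfolding of_int_0_less_iff by linarith
    have ngt: "x < N x" for x
    proof (rule ccontr)
      assume "\<not> x < N x"
      then have "N x \<le> x" by simp
      moreover from this have "N (N x) \<le> N x" by (simp add: lifts_le N)
      moreover from this have "N (N (N x)) \<le> N (N x)" by (simp add: lifts_le N(1))
      ultimately show False using N(2)[of x] by linarith
    qed
    \<comment> \<open>\<open>N1 \<circ> N2\<close> now exceeds the unit translation, which is the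
      cube of \<open>N1\<close>, so \<open>N2\<close> exceeds \<open>N1 \<circ> N1\<close>. But
      their cubes translate by 1 and by 2.\<close>
    have "(N1 \<circ> N1) x < N2 x" for x
    proof -
      have "N1 (N1 (N1 x)) < N1 (N2 x)"
        using ngt[of x] m2 unfolding cube m by (smt (verit) of_int_1_le_iff)
      then show ?thesis by (simp add: lifts_less N12)
    qed
    from lifts_cube_mono[OF lifts_comp[OF N12(1) N12(1)] N12(2) this, of 0]
    have False by (simp add: cube)
    then show thesis ..
  qed
qed

text \<open>Quotients are cleared so that only products occur: \<open>d\<close> stands for
  \<open>e 3\<close> times the inverse of \<open>e 4\<close>, and \<open>b \<circ> d\<close> for
  \<open>e 0 \<circ> e 1\<close> times the inverse of \<open>e 2\<close>.\<close>

definition gadget ::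
  "(circle \<Rightarrow> circle) \<Rightarrow> (circle \<Rightarrow> circle) \<Rightarrow> (circle \<Rightarrow> circle) \<Rightarrow>
   (nat \<Rightarrow> circle \<Rightarrow> circle) \<Rightarrow> (nat \<Rightarrow> circle \<Rightarrow> circle) \<Rightarrow> (circle \<Rightarrow> circle) \<Rightarrow> bool" where
  "gadget a n b w e d \<longleftrightarrow>
     (\<forall>i<5. w i \<circ> n = n \<circ> w i \<and> e i \<circ> w i = w i \<circ> a) \<and>
     d \<circ> e 4 = e 3 \<and> d \<circ> b = b \<circ> d \<and> b \<circ> d \<circ> e 2 = e 0 \<circ> e 1"

lemma gadget_rot:
  assumes N: "N \<in> lifts" "\<And>x. N (N (N x)) = x + 1" "has_trn N (1/3)"
    and A: "A \<in> lifts" "\<And>x. A (A x) = N x"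
    and w: "\<And>i. w i \<in> carrier homeo_plus_circle"
    and b: "b \<in> carrier homeo_plus_circle" and d: "d \<in> carrier homeo_plus_circle"
    and gad: "gadget (circ A) (circ N) b w e d"
  obtains t where "0 \<le> t" "t \<le> 1/3" "rot b = to_circle t"
proof -
  \<comment> \<open>The conjugators commute with \<open>N\<close> already on the line, by
    \<open>lifts_commute\<close>, so each \<open>e i\<close> has a lift whose square is exactly
    \<open>N\<close>.\<close>
  have "\<exists>E. E \<in> lifts \<and> e i = circ E \<and> (\<forall>x. E (E x) = N x)" if i: "i < 5" for i
  proof -
    have ew: "e i \<circ> w i = w i \<circ> circ A" and wn: "w i \<circ> circ N = circ N \<circ> w i"
      using gad i by (auto simp: gadget_def)
    obtain W where W: "W \<in> lifts" "w i = circ W" "e i = circ (W \<circ> A \<circ> linv W)" "W \<circ> A \<circ> linv W \<in> lifts"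
      using conj_lift[OF w A(1) ew] by metis
    have "W (N x) = N (W x)" for x using wn W N by (intro lifts_commute) auto
    then have "(W \<circ> A \<circ> linv W) ((W \<circ> A \<circ> linv W) x) = N x" for x
      by (simp add: lifts_inv_f lifts_f_inv A W)
    with W show ?thesis by blast
  qed
  then obtain E where E: "\<And>i. i < 5 \<Longrightarrow> E i \<in> lifts" "\<And>i. i < 5 \<Longrightarrow> e i = circ (E i)"
    "\<And>i x. i < 5 \<Longrightarrow> E i (E i x) = N x" by metis
  have El: "E 0 \<in> lifts" "E 1 \<in> lifts" "E 2 \<in> lifts" "E 3 \<in> lifts" "E 4 \<in> lifts"
    using E(1) by auto
  have EN: "E i (N x) = N (E i x)" if "i < 5" for i x using E(3)[OF that] by metis
  obtain D0 where D0: "D0 \<in> lifts" "d = circ D0" using d carrier_liftE by metis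
  have "circ (D0 \<circ> E 4) = circ (E 3)" using gad D0 E by (simp add: gadget_def circ_comp)
  then obtain k :: int where k: "\<And>x. (D0 \<circ> E 4) x = E 3 x + of_int k"
    using circ_eqE[OF lifts_comp[OF D0(1) El(5)] El(4)] by blast
  define D where "D = (\<lambda>x. D0 x + of_int (- k))"
  have D: "D \<in> lifts" "d = circ D" using D0 circ_shift[of D0 "- k"] by (simp_all add: D_def lifts_shift del: of_int_minus)
  have D4: "D (E 4 x) = E 3 x" for x using k[of x] by (simp add: D_def)
  obtain p where "E 3 p = E 4 p" using lifts_cross[of "E 3" "E 4"] E by auto
  then have p: "D (E 4 p) = E 4 p" using D4 by simp
  obtain B0 where B0: "B0 \<in> lifts" "b = circ B0" using b carrier_liftE by metis
  have "circ (B0 \<circ> D \<circ> E 2) = circ (E 0 \<circ> E 1)"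
    using gad B0 D E by (simp add: gadget_def circ_comp lifts_comp)
  then obtain l :: int where l: "\<And>x. (B0 \<circ> D \<circ> E 2) x = (E 0 \<circ> E 1) x + of_int l"
    using circ_eqE[OF lifts_comp[OF lifts_comp[OF B0(1) D(1)] El(3)] lifts_comp[OF El(1,2)]] by blast
  define B where "B = (\<lambda>x. B0 x + of_int (- l))"
  have B: "B \<in> lifts" "b = circ B" using B0 circ_shift[of B0 "- l"] by (simp_all add: B_def lifts_shift del: of_int_minus)
  have BD: "B (D (E 2 x)) = E 0 (E 1 x)" for x using l[of x] by (simp add: B_def)
  have comm: "D (B x) = B (D x)" for x
    using gad B D by (intro lifts_commute) (auto simp: gadget_def)
  define F where "F = B \<circ> D"
  have F: "F \<in> lifts" using B D by (simp add: F_def lifts_comp)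
  have FN: "F (N x) = N (F x)" for x
  proof -
    obtain y where y: "x = E 2 y" using lifts_surj[OF El(3), of x] by blast
    have "F (N x) = E 0 (E 1 (N y))" using EN[of 2 y] BD[of "N y"] by (simp add: F_def y)
    also have "\<dots> = N (F x)" using EN[of 0] EN[of 1] BD[of y] by (simp add: F_def y)
    finally show ?thesis .
  qed
  obtain q where q: "E 1 q = E 2 q" using lifts_cross[of "E 1" "E 2"] E by auto
  define y where "y = E 2 q"
  have Fy: "F y = E 0 y" using BD[of q] q by (simp add: F_def y_def)
  have ngt: "x < N x" for x
  proof (rule ccontr)
    assume "\<not> x < N x"
    then have "N x \<le> x" by simp
    moreover from this have "N (N x) \<le> N x" by (simp add: lifts_le N)
    moreover from this have "N (N (N x)) \<le> N (N x)" by (simp add: lifts_le N(1))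
    ultimately show False using N(2)[of x] by linarith
  qed
  have E0: "E 0 \<in> lifts" "E 0 (E 0 x) = N x" for x using E by auto
  \<comment> \<open>A square root of a map that moves every point up moves points up too, and one
    application goes at most as far as two.\<close>
  have lo: "y \<le> E 0 y" using ngt[of y] E0 by (metis lifts_less not_le order.strict_trans less_asym)
  have hi: "E 0 y \<le> N y" using lo E0 by (metis lifts_le)
  obtain r where r: "has_trn F r" using has_trn_exists[OF F] by blast
  have "0 \<le> r"
    using has_trn_mono[OF lifts_id(2) F _ _ has_trn_id r, of y] lo Fy by simp
  moreover have "r \<le> 1/3"
    using has_trn_mono[OF F N(1) FN _ r N(3), of y] hi Fy by simp
  \<comment> \<open>\<open>F^n = B^n D^n\<close>, and \<open>D\<close> fixes \<open>E 4 p\<close>;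
    so \<open>F\<close> and \<open>B\<close> have the same iterates at that point.\<close>
  moreover have "has_trn B r"
  proof -
    have "(D ^^ n) (E 4 p) = E 4 p" for n by (induction n) (simp_all add: p)
    moreover have "(F ^^ n) x = (B ^^ n) ((D ^^ n) x)" for n x
    proof (induction n)
      case (Suc n)
      have "B (D ((B ^^ n) ((D ^^ n) x))) = B ((B ^^ n) (D ((D ^^ n) x)))"
        by (simp add: funpow_commute[of B D, OF comm[symmetric]])
      with Suc show ?case by (simp add: F_def)
    qed simp
    ultimately have "(F ^^ n) (E 4 p) = (B ^^ n) (E 4 p)" for n by simp
    then show ?thesis using r by (simp add: has_trn_at[OF F, of _ "E 4 p"] has_trn_at[OF B(1), of _ "E 4 p"])
  qed
  ultimately show thesis using that B rot_circ by blast
qed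

text \<open>The \<open>e i\<close> become conjugates of the identity, after which \<open>d\<close>
  and then \<open>b\<close> collapse.\<close>

lemma gadget_kill:
  assumes "gadget id n b w e d"
    "\<And>i. w i \<in> carrier homeo_plus_circle"
  shows "b = id"
proof -
  have e: "e i = id" if "i < 5" for i
    using assms that carrier_cancel[of "w i" "e i" id] by (simp add: gadget_def)
  have "d = id" using assms(1) e[of 3] e[of 4] by (simp add: gadget_def)
  then show ?thesis using assms(1) e[of 0] e[of 1] e[of 2] by (simp add: gadget_def)
qed

lemma triangle_kill:
  assumes "triangle a id n1 n2 u v" "u \<in> carrier homeo_plus_circle" "v \<in> carrier homeo_plus_circle"
  shows "a = id"
proof -
  have "n1 = id" "n2 = id"
    using assms carrier_cancel[of u n1 id] carrier_cancel[of v n2 id] by (simp_all add: triangle_def)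
  then show ?thesis using assms(1) by (simp add: triangle_def)
qed

section \<open>Realisation in covers of SU(1,1)\<close>

text \<open>
  The pair \<open>(a, b)\<close> stands for the real linear map \<open>z \<mapsto> a z + b cnj z\<close>, an element of \<open>SU(1,1)\<close> if
  \<open>|a|\<^sup>2 - |b|\<^sup>2 = 1\<close>, and the real number \<open>t\<close> for the ray in direction \<open>cis (pi * t)\<close>. Translation by
  one is multiplication by \<open>-1\<close>, so a lift is determined by its linear map up to even integers.
\<close>

definition ray :: "(real \<Rightarrow> real) \<Rightarrow> complex \<Rightarrow> complex \<Rightarrow> bool" where
  "ray F a b \<longleftrightarrow>
     (\<forall>t. \<exists>r>0. a * cis (pi * t) + b * cis (- (pi * t)) = of_real r * cis (pi * F t))"

lemma ray_comp:
  assumes F: "ray F a b" and G: "ray G c d"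
  shows "ray (F \<circ> G) (a * c + b * cnj d) (a * d + b * cnj c)"
  unfolding ray_def
proof
  fix t
  obtain r where r: "r > 0" "c * cis (pi * t) + d * cis (- (pi * t)) = of_real r * cis (pi * G t)"
    using G unfolding ray_def by blast
  obtain s where s: "s > 0"
    "a * cis (pi * G t) + b * cis (- (pi * G t)) = of_real s * cis (pi * F (G t))"
    using F unfolding ray_def by blast
  have r': "cnj c * cis (- (pi * t)) + cnj d * cis (pi * t) = of_real r * cis (- (pi * G t))"
    using arg_cong[OF r(2), of cnj] by (simp add: cis_cnj)
  have "(a * c + b * cnj d) * cis (pi * t) + (a * d + b * cnj c) * cis (- (pi * t)) =
      a * (c * cis (pi * t) + d * cis (- (pi * t))) +
      b * (cnj c * cis (- (pi * t)) + cnj d * cis (pi * t))"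
    by (simp add: algebra_simps)
  also have "\<dots> = of_real r * (a * cis (pi * G t) + b * cis (- (pi * G t)))"
    unfolding r r' by (simp add: algebra_simps)
  also have "\<dots> = of_real (r * s) * cis (pi * (F \<circ> G) t)"
    unfolding s by simp
  finally show "\<exists>r>0. (a * c + b * cnj d) * cis (pi * t) + (a * d + b * cnj c) * cis (- (pi * t)) =
      of_real r * cis (pi * (F \<circ> G) t)"
    using r(1) s(1) by (metis mult_pos_pos)
qed

lemma ray_translation: "ray (\<lambda>x. x + t) (cis (pi * t)) 0"
  unfolding ray_def by (auto simp: cis_mult algebra_simps intro!: exI[of _ 1])

text \<open>The matrix with rows \<open>(a, b)\<close> and \<open>(cnj b, cnj a)\<close> has
  determinant 1, so its inverse has first row \<open>(cnj a, - b)\<close>.\<close>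

lemma ray_inv:
  assumes F: "F \<in> lifts" "ray F a b" and "(norm a)\<^sup>2 - (norm b)\<^sup>2 = 1"
  shows "ray (linv F) (cnj a) (- b)"
  unfolding ray_def
proof
  have det: "a * cnj a - b * cnj b = 1"
    using assms(3) by (metis complex_norm_square of_real_1 of_real_diff)
  fix t
  define s where "s = linv F t"
  have Fs: "F s = t" by (simp add: s_def lifts_f_inv F)
  obtain r where r: "r > 0" "a * cis (pi * s) + b * cis (- (pi * s)) = of_real r * cis (pi * t)"
    using F(2) Fs unfolding ray_def by metis
  have r': "cnj a * cis (- (pi * s)) + cnj b * cis (pi * s) = of_real r * cis (- (pi * t))"
    using arg_cong[OF r(2), of cnj] by (simp add: cis_cnj)
  have "of_real r * (cnj a * cis (pi * t) + - b * cis (- (pi * t))) =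
      cnj a * (of_real r * cis (pi * t)) - b * (of_real r * cis (- (pi * t)))"
    by (simp add: algebra_simps)
  also have "\<dots> = (a * cnj a - b * cnj b) * cis (pi * s)"
    unfolding r(2)[symmetric] r'[symmetric] by (simp add: algebra_simps)
  finally have "of_real r * (cnj a * cis (pi * t) + - b * cis (- (pi * t))) = cis (pi * s)"
    using det by simp
  then have "cnj a * cis (pi * t) + - b * cis (- (pi * t)) = of_real (1 / r) * cis (pi * s)"
    using r(1) by (simp add: field_simps)
  then show "\<exists>r>0. cnj a * cis (pi * t) + - b * cis (- (pi * t)) = of_real r * cis (pi * linv F t)"
    using r(1) unfolding s_def by (metis zero_less_divide_1_iff)
qed

lemma ray_diff:
  assumes "a * cis (pi * t) + b * cis (- (pi * t)) = of_real r * cis (pi * x)" "r > 0"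
    "a * cis (pi * t) + b * cis (- (pi * t)) = of_real s * cis (pi * y)" "s > 0"
  obtains m :: int where "x = y + 2 * of_int m"
proof -
  have eq: "of_real r * cis (pi * x) = of_real s * cis (pi * y)" using assms by simp
  from arg_cong[OF this, of norm] have "r = s" using assms by (simp add: norm_mult)
  with eq assms have "cis (pi * x) = cis (pi * y)" by simp
  then have "sin (pi * x) = sin (pi * y) \<and> cos (pi * x) = cos (pi * y)"
    by (simp add: complex_eq_iff)
  then obtain m :: int where "pi * x = pi * y + 2 * pi * of_int m"
    by (auto simp: sin_cos_eq_iff)
  then have "pi * x = pi * (y + 2 * of_int m)" by (simp add: algebra_simps)
  then have "x = y + 2 * of_int m" by simp
  then show thesis by (rule that)
qed

text \<open>A ray, unlike a line, determines its parameter modulo 2. The even integer does not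
  depend on the point because both lifts induce the same circle map.\<close>

lemma ray_unique:
  assumes F: "F \<in> lifts" "ray F a b" and G: "G \<in> lifts" "ray G a b"
  obtains m :: int where "\<And>x. F x = G x + 2 * of_int m"
proof -
  have ex: "\<exists>m::int. F x = G x + 2 * of_int m" for x
    using F(2) G(2) unfolding ray_def by (metis ray_diff)
  have "circ F = circ G"
    unfolding circ_def
  proof
    fix c
    obtain m :: int where "F (rep_circle c) = G (rep_circle c) + of_int (2 * m)"
      using ex[of "rep_circle c"] by auto
    then show "to_circle (F (rep_circle c)) = to_circle (G (rep_circle c))"
      using to_circle_add_int by presburger
  qed
  then obtain k :: int where k: "\<And>x. F x = G x + of_int k" using circ_eqE F G by metis
  obtain m :: int where "F 0 = G 0 + 2 * of_int m" using ex by blast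
  with k[of 0] have "of_int k = (2 * of_int m :: real)" by simp
  with k that show thesis by metis
qed

text \<open>For \<open>z = cis (pi * t)\<close> the image is \<open>g z\<close> times
  \<open>h t\<close>. Since \<open>norm d < g\<close>, the factor \<open>h t\<close> stays in the
  right half plane, and its argument is a continuous correction to the angle.\<close>

lemma ray_exists:
  assumes g: "norm d < g"
  obtains F where "F \<in> lifts" "ray F (of_real g) d"
proof -
  have g0: "g > 0" using g norm_ge_zero[of d] by linarith
  define h where "h t = 1 + d / of_real g * cis (- (2 * pi * t))" for t
  define F where "F t = t + Arg (h t) / pi" for t
  have nh: "norm (h t - 1) < 1" for t
    using g g0 by (simp add: h_def norm_mult norm_divide)
  have h: "Re (h t) > 0" for t
    using nh[of t] abs_Re_le_cmod[of "h t - 1"] by simp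
  have ray: "ray F (of_real g) d" unfolding ray_def
  proof
    fix t
    have "h t \<noteq> 0" using h[of t] by auto
    then have "of_real (norm (h t)) * cis (Arg (h t)) = h t"
      by (simp add: rcis_cmod_Arg flip: rcis_def)
    then have "of_real (g * norm (h t)) * cis (pi * F t) = of_real g * cis (pi * t) * h t"
      by (simp add: F_def distrib_left algebra_simps flip: cis_mult)
    also have "\<dots> = of_real g * cis (pi * t) + d * (cis (pi * t) * cis (- (2 * pi * t)))"
      using g0 by (simp add: h_def field_simps)
    also have "cis (pi * t) * cis (- (2 * pi * t)) = cis (- (pi * t))"
      by (simp add: cis_mult)
    finally show "\<exists>r>0. of_real g * cis (pi * t) + d * cis (- (pi * t)) = of_real r * cis (pi * F t)"
      using g0 \<open>h t \<noteq> 0\<close> by (metis mult_pos_pos zero_less_norm_iff)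
  qed
  have F1: "F (t + 1) = F t + 1" for t
  proof -
    have "cis (- (2 * pi * (t + 1))) = cis (- (2 * pi * t))"
      by (simp add: complex_eq_iff algebra_simps cos_add sin_add sin_diff cos_diff)
    then show ?thesis by (simp add: F_def h_def)
  qed
  have cont: "continuous_on UNIV F"
    unfolding F_def
  proof (intro continuous_intros continuous_on_Arg)
    show "continuous_on UNIV h" unfolding h_def cis_conv_exp
      using g0 by (intro continuous_intros) auto
  next
    show "h t \<notin> \<real>\<^sub>\<le>\<^sub>0" for t using h[of t] by (auto simp: complex_nonpos_Reals_iff)
  qed (auto simp: pi_neq_zero)
  \<comment> \<open>Equal image rays come from proportional vectors, as the linear map is injective
    for \<open>norm d < g\<close>; the even integer that remains is excluded by
    \<open>F1\<close>.\<close>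
  have inj: "inj F"
  proof (rule injI)
    fix x y assume xy: "F x = F y"
    obtain r where r: "r > 0" "of_real g * cis (pi * x) + d * cis (- (pi * x)) = of_real r * cis (pi * F x)"
      using ray unfolding ray_def by blast
    obtain s where s: "s > 0" "of_real g * cis (pi * y) + d * cis (- (pi * y)) = of_real s * cis (pi * F y)"
      using ray unfolding ray_def by blast
    define u where "u = cis (pi * x)"
    define v where "v = of_real (r / s) * cis (pi * y)"
    have cu: "cis (- (pi * x)) = cnj u" and cv: "of_real (r / s) * cis (- (pi * y)) = cnj v"
      by (simp_all add: u_def v_def cis_cnj)
    have "of_real g * u + d * cnj u = of_real g * v + d * cnj v"
      unfolding cu[symmetric] cv[symmetric]
      using r s(1) arg_cong[OF s(2), of "\<lambda>z. of_real (r / s) * z"] xy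
      by (simp add: u_def v_def algebra_simps)
    then have "of_real g * (u - v) = - d * cnj (u - v)" by (simp add: algebra_simps)
    from arg_cong[OF this, of norm] have "g * norm (u - v) = norm d * norm (u - v)"
      using g0 by (simp add: norm_mult flip: complex_cnj_diff)
    with g have "u = v" by simp
    from this have "1 * cis (pi * x) + 0 * cis (- (pi * x)) = of_real (r / s) * cis (pi * y)"
      by (simp add: u_def v_def)
    then obtain m :: int where m: "x = y + 2 * of_int m"
      using r(1) s(1) ray_diff[of 1 x 0 1 x "r / s" y] by auto
    have "F (y + of_int (2 * m)) = F y + of_int (2 * m)" by (rule add_of_int_of_add_1[of F, OF F1])
    with m xy show "x = y" by simp
  qed
  have mono: "strict_mono F"
  proof -
    have "strict_mono F \<or> (\<forall>x y. x < y \<longrightarrow> F y < F x)"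
      using injective_eq_monotone_map[of UNIV F] cont inj
      by (auto simp: strict_mono_def monotone_on_def is_interval_univ)
    moreover have "F 0 < F 1" using F1[of 0] by simp
    ultimately show ?thesis by (metis less_asym zero_less_one)
  qed
  have "F \<in> lifts" using mono cont F1 by (simp add: lifts_def)
  with ray that show thesis by blast
qed

section \<open>Elliptic elements as conjugates of translations\<close>

text \<open>An elliptic element together with a lift: \<open>t\<close> is its translation number as
  a real number, not only modulo integers.\<close>

definition conj_by :: "(real \<Rightarrow> real) \<Rightarrow> real \<Rightarrow> real \<Rightarrow> real" where
  "conj_by K t = K \<circ> (\<lambda>x. x + t) \<circ> linv K"

lemma conj_by_lifts: "K \<in> lifts \<Longrightarrow> conj_by K t \<in> lifts"
  by (simp add: conj_by_def lifts_comp lifts_inv lifts_translation)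

lemma conj_by_trn: "K \<in> lifts \<Longrightarrow> has_trn (conj_by K t) t"
  unfolding conj_by_def by (intro has_trn_conj lifts_translation has_trn_translation)

lemma conj_by_comp: "K \<in> lifts \<Longrightarrow> conj_by K s (conj_by K t x) = conj_by K (s + t) x"
  by (simp add: conj_by_def lifts_inv_f algebra_simps)

lemma conj_by_1: "K \<in> lifts \<Longrightarrow> conj_by K 1 x = x + 1"
  by (simp add: conj_by_def lifts_1 lifts_f_inv)

lemma conj_by_id: "conj_by id t = (\<lambda>x. x + t)"
  by (simp add: conj_by_def fun_eq_iff inv_id[unfolded id_def] id_def)

lemma linv_linv: "K \<in> lifts \<Longrightarrow> linv (linv K) = K"
  by (metis ext lifts_f_inv lifts_inv lifts_inv_f)

lemma linv_comp: "K \<in> lifts \<Longrightarrow> G \<in> lifts \<Longrightarrow> linv (K \<circ> G) = linv G \<circ> linv K"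
  by (rule ext) (metis comp_apply lifts_comp lifts_eq lifts_f_inv)

lemma conj_by_conj:
  "K \<in> lifts \<Longrightarrow> G \<in> lifts \<Longrightarrow> conj_by (linv G \<circ> K) t x = linv G (conj_by K t (G x))"
  by (simp add: conj_by_def linv_comp lifts_inv linv_linv)

text \<open>An element of \<open>SU(1,1)\<close> with trace strictly between -2 and 2 is conjugate
  to a rotation, and the sign of \<open>Im a\<close> decides between the angles \<open>t\<close> and
  \<open>- t\<close>. The conjugator is taken with positive real first coefficient, as
  \<open>ray_exists\<close> requires.\<close>

lemma elliptic_conj:
  assumes det: "(norm a)\<^sup>2 - (norm b)\<^sup>2 = 1" and re: "Re a = cos (pi * t)" and im: "Im a > 0"
    and t: "0 < t" "t < 1"
  obtains K where "K \<in> lifts" "ray (conj_by K t) a b"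
proof -
  define s where "s = sin (pi * t)"
  define y where "y = Im a"
  \<comment> \<open>Conjugating the rotation by \<open>(g, d)\<close> gives a first coefficient with
    imaginary part \<open>(g^2 + |d|^2) * s\<close> and the second coefficient
    \<open>- 2 * \<i> * g * d * s\<close>. Equating these with \<open>y\<close> and
    \<open>b\<close>, under \<open>g^2 - |d|^2 = 1\<close>, determines \<open>g\<close> and
    \<open>d\<close>.\<close>
  define g where "g = sqrt ((y / s + 1) / 2)"
  define d where "d = \<i> * b / of_real (2 * g * s)"
  have s: "s > 0" unfolding s_def using t by (intro sin_gt_zero) auto
  have y: "y > 0" using im by (simp add: y_def)
  have nb: "(norm b)\<^sup>2 = y\<^sup>2 - s\<^sup>2"
    using det by (simp add: cmod_power2[of a] re y_def s_def sin_squared_eq)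
  then have ys: "y \<ge> s" using s y zero_le_power2[of "norm b"] by (metis abs_le_square_iff abs_of_pos diff_ge_0_iff_ge)
  have g2: "g\<^sup>2 = (y / s + 1) / 2" using s y by (simp add: g_def)
  have g: "g > 0" using divide_pos_pos[OF y s] by (simp add: g_def)
  have d2: "(norm d)\<^sup>2 = (y / s - 1) / 2"
  proof -
    have "(norm d)\<^sup>2 = (y\<^sup>2 - s\<^sup>2) / (4 * g\<^sup>2 * s\<^sup>2)"
      using g s by (simp add: d_def norm_mult norm_divide power_divide power_mult_distrib nb)
    also have "4 * g\<^sup>2 * s\<^sup>2 = 2 * s * (y + s)" unfolding g2 using s by (simp add: field_simps power2_eq_square)
    also have "(y\<^sup>2 - s\<^sup>2) / (2 * s * (y + s)) = (y / s - 1) / 2"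
    proof -
      have "y\<^sup>2 - s\<^sup>2 = (y - s) * (y + s)" by (simp add: power2_eq_square algebra_simps)
      moreover have "(y - s) * (y + s) / (2 * s * (y + s)) = (y - s) / (2 * s)"
        using s y by (intro mult_divide_mult_cancel_right) simp
      moreover have "(y - s) / (2 * s) = (y / s - 1) / 2" using s by (simp add: field_simps)
      ultimately show ?thesis by (simp only:)
    qed
    finally show ?thesis .
  qed
  have gd: "g\<^sup>2 - (norm d)\<^sup>2 = 1" by (simp add: g2 d2 field_simps)
  then have "(norm d)\<^sup>2 < g\<^sup>2" by simp
  then have "norm d < g" using g by (simp add: power_less_imp_less_base)
  then obtain K where K: "K \<in> lifts" "ray K (of_real g) d" using ray_exists by blast
  have dd: "d * cnj d = of_real ((norm d)\<^sup>2)" using complex_norm_square[of d] by simp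
  have rinv: "ray (linv K) (of_real g) (- d)"
    using ray_inv[OF K] gd by simp
  have r1: "ray (K \<circ> (\<lambda>x. x + t)) (of_real g * cis (pi * t)) (d * cis (- (pi * t)))"
    using ray_comp[OF K(2) ray_translation[of t]] by (simp add: cis_cnj)
  have r2: "ray (conj_by K t) (of_real g * cis (pi * t) * of_real g + d * cis (- (pi * t)) * cnj (- d))
      (of_real g * cis (pi * t) * - d + d * cis (- (pi * t)) * cnj (of_real g))"
    unfolding conj_by_def using ray_comp[OF r1 rinv] .
  have "of_real g * cis (pi * t) * of_real g + d * cis (- (pi * t)) * cnj (- d) =
      of_real (g\<^sup>2) * cis (pi * t) - (d * cnj d) * cis (- (pi * t))"
    by (simp add: power2_eq_square)
  also have "\<dots> = a"
    unfolding dd d2 g2 using s by (simp add: complex_eq_iff re y_def[symmetric] s_def[symmetric] field_simps)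
  finally have e1: "of_real g * cis (pi * t) * of_real g + d * cis (- (pi * t)) * cnj (- d) = a" .
  have "of_real g * cis (pi * t) * - d + d * cis (- (pi * t)) * cnj (of_real g) =
      - (of_real g * d) * (cis (pi * t) - cis (- (pi * t)))"
    by (simp add: algebra_simps)
  also have "cis (pi * t) - cis (- (pi * t)) = 2 * \<i> * of_real s"
    by (simp add: complex_eq_iff s_def)
  also have "- (of_real g * d) * (2 * \<i> * of_real s) = b"
    using g s by (simp add: d_def field_simps)
  finally show thesis using r2 K(1) that unfolding e1 by simp
qed


section \<open>Products of half turns\<close>

text \<open>For \<open>K\<close> coming from \<open>SU(1,1)\<close> this is a lift of a half turn of
  the hyperbolic plane; its square is the unit translation, trivial on the circle.\<close>

abbreviation half :: "(real \<Rightarrow> real) \<Rightarrow> real \<Rightarrow> real" where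
  "half K \<equiv> conj_by K (1/2)"

lemma half_half: "K \<in> lifts \<Longrightarrow> half K (half K x) = x + 1"
  by (simp add: conj_by_comp conj_by_1)

lemma half_ray:
  assumes "c > 0" "c\<^sup>2 - (norm b)\<^sup>2 = 1"
  obtains K where "K \<in> lifts" "ray (half K) (\<i> * of_real c) b"
  using elliptic_conj[of "\<i> * of_real c" b "1/2"] assms that by (auto simp: norm_mult)

lemma conj_by_bounds:
  assumes "K \<in> lifts" "0 < t" "t < 1"
  shows "x < conj_by K t x" "conj_by K t x < x + 1"
proof -
  have "K (linv K x) < K (linv K x + t)" "K (linv K x + t) < K (linv K x + 1)"
    using assms by (simp_all add: lifts_less)
  then show "x < conj_by K t x" "conj_by K t x < x + 1"
    using assms by (simp_all add: conj_by_def lifts_f_inv lifts_1)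
qed

text \<open>As \<open>half K1\<close> and \<open>half K2\<close> agree somewhere, the product acts
  at one point like \<open>half K0\<close>, which advances by less than 1. The bound later singles
  out a lift when only the linear map is known.\<close>

lemma three_halves_trn:
  assumes K: "K0 \<in> lifts" "K1 \<in> lifts" "K2 \<in> lifts"
    and r: "has_trn (half K0 \<circ> half K1 \<circ> linv (half K2)) r"
  shows "0 \<le> r" "r \<le> 1"
proof -
  let ?F = "half K0 \<circ> half K1 \<circ> linv (half K2)"
  have F: "?F \<in> lifts" using K by (simp add: lifts_comp lifts_inv conj_by_lifts)
  obtain q where q: "half K1 q = half K2 q"
    using lifts_cross[of "half K1" "half K2"] K by (auto simp: conj_by_lifts half_half)
  have Fq: "?F (half K2 q) = half K0 (half K2 q)"
    using K q by (simp add: lifts_inv_f conj_by_lifts)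
  show "0 \<le> r"
    using conj_by_bounds[of K0 "1/2" "half K2 q"] K Fq
    by (intro has_trn_mono[OF lifts_id(2) F _ _ has_trn_id r, of "half K2 q"]) auto
  show "r \<le> 1"
    using conj_by_bounds[of K0 "1/2" "half K2 q"] K Fq lifts_1[OF F]
    by (intro has_trn_mono[OF F lifts_translation _ _ r has_trn_translation, of _ "half K2 q"]) auto
qed

lemma two_halves_trn:
  assumes K: "K0 \<in> lifts" "K1 \<in> lifts"
  shows "has_trn (half K0 \<circ> linv (half K1)) 0"
proof -
  obtain q where q: "half K0 q = half K1 q"
    using lifts_cross[of "half K0" "half K1"] K by (auto simp: conj_by_lifts half_half)
  have "((half K0 \<circ> linv (half K1)) ^^ n) (half K1 q) = half K1 q" for n
    by (induction n) (simp_all add: lifts_inv_f conj_by_lifts K q)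
  then show ?thesis
    using K by (subst has_trn_at[where x = "half K1 q"])
      (simp_all add: lifts_comp lifts_inv conj_by_lifts lim_const_over_n)
qed

text \<open>
  Products of three half turns, one of them varying with \<open>b\<close>: every real number occurs as half
  the trace \<open>- b\<close>, so elliptic elements of every angle occur as well as hyperbolic ones.
\<close>

lemma three_halves_ray:
  fixes b :: real
  obtains K0 K1 K2 where "K0 \<in> lifts" "K1 \<in> lifts" "K2 \<in> lifts"
    "ray (half K0 \<circ> half K1 \<circ> linv (half K2))
      (Complex (- b) (sqrt 2 * sqrt (1 + b\<^sup>2))) (Complex (sqrt 2 * b) (sqrt (1 + b\<^sup>2)))"
proof -
  obtain K0 where K0: "K0 \<in> lifts" "ray (half K0) (\<i> * of_real 1) 0"
    using half_ray[of 1 0] by auto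
  obtain K1 where K1: "K1 \<in> lifts" "ray (half K1) (\<i> * of_real (sqrt 2)) (- \<i>)"
    using half_ray[of "sqrt 2" "- \<i>"] by auto
  have pos: "1 + b\<^sup>2 > 0" by (simp add: add_pos_nonneg)
  obtain K2 where K2: "K2 \<in> lifts" "ray (half K2) (\<i> * of_real (sqrt (1 + b\<^sup>2))) (of_real b)"
    using half_ray[of "sqrt (1 + b\<^sup>2)" "of_real b"] pos by auto
  have det: "(norm (\<i> * of_real (sqrt (1 + b\<^sup>2))))\<^sup>2 - (norm (of_real b :: complex))\<^sup>2 = 1"
    using pos by (simp add: norm_mult)
  have "ray (linv (half K2)) (cnj (\<i> * of_real (sqrt (1 + b\<^sup>2)))) (- of_real b)"
    by (rule ray_inv[OF conj_by_lifts[OF K2(1)] K2(2) det])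
  from ray_comp[OF ray_comp[OF K0(2) K1(2)] this]
  show thesis using that K0(1) K1(1) K2(1)
    by (simp add: Complex_eq algebra_simps)
qed

text \<open>A product of three half turns with the trace of a rotation by \<open>t\<close> is
  conjugate to that rotation; conjugating the half turns back makes the product an exact
  translation.\<close>

lemma gadget_lifts_interior:
  assumes t: "0 < t" "t < 1"
  obtains K0 K1 K2 where "K0 \<in> lifts" "K1 \<in> lifts" "K2 \<in> lifts"
    "\<And>x. half K2 x + t = half K0 (half K1 x)"
proof -
  \<comment> \<open>The first coefficient in \<open>three_halves_ray\<close> has real part
    \<open>- b\<close>, which becomes \<open>cos (pi * t)\<close>.\<close>
  define b where "b = - cos (pi * t)"
  obtain L0 L1 L2 where L: "L0 \<in> lifts" "L1 \<in> lifts" "L2 \<in> lifts"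
    and ray: "ray (half L0 \<circ> half L1 \<circ> linv (half L2))
      (Complex (- b) (sqrt 2 * sqrt (1 + b\<^sup>2))) (Complex (sqrt 2 * b) (sqrt (1 + b\<^sup>2)))"
    by (rule three_halves_ray)
  let ?F = "half L0 \<circ> half L1 \<circ> linv (half L2)"
  have F: "?F \<in> lifts" using L by (simp add: lifts_comp lifts_inv conj_by_lifts)
  have pos: "1 + b\<^sup>2 > 0" by (simp add: add_pos_nonneg)
  obtain K where K: "K \<in> lifts" and rK: "ray (conj_by K t)
      (Complex (- b) (sqrt 2 * sqrt (1 + b\<^sup>2))) (Complex (sqrt 2 * b) (sqrt (1 + b\<^sup>2)))"
  proof (rule elliptic_conj[of "Complex (- b) (sqrt 2 * sqrt (1 + b\<^sup>2))"
        "Complex (sqrt 2 * b) (sqrt (1 + b\<^sup>2))" t])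
    show "(norm (Complex (- b) (sqrt 2 * sqrt (1 + b\<^sup>2))))\<^sup>2 -
        (norm (Complex (sqrt 2 * b) (sqrt (1 + b\<^sup>2))))\<^sup>2 = 1"
      using pos unfolding cmod_power2 by (simp add: power_mult_distrib)
  qed (use pos t in \<open>auto simp: b_def\<close>)
  obtain m :: int where m: "\<And>x. conj_by K t x = ?F x + 2 * of_int m"
    using ray_unique[OF conj_by_lifts[OF K] rK F ray] by blast
  obtain r where r: "has_trn ?F r" using has_trn_exists[OF F] by blast
  have "has_trn (\<lambda>x. ?F x + of_int (2 * m)) (r + of_int (2 * m))"
    by (rule has_trn_shift[OF F r])
  moreover have "(\<lambda>x. ?F x + of_int (2 * m)) = conj_by K t" using m by auto
  ultimately have "t = r + of_int (2 * m)" using conj_by_trn[OF K] has_trn_unique by metis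
  moreover have "0 \<le> r" "r \<le> 1" using three_halves_trn L r by blast+
  \<comment> \<open>\<open>t\<close> and \<open>r\<close> lie in the same unit interval, so no
    nonzero even integer can separate them.\<close>
  ultimately have "of_int (2 * m) < (2::real)" "of_int (2 * m) > (- 2::real)" using t by linarith+
  then have "m = 0" by linarith
  with m have eq: "conj_by K t x = ?F x" for x by simp
  let ?K = "\<lambda>L. linv K \<circ> L"
  have half: "half (?K L) x = linv K (half L (K x))" if "L \<in> lifts" for L x
    by (rule conj_by_conj[OF that K])
  have "half (?K L2) x + t = half (?K L0) (half (?K L1) x)" for x
  proof -
    have "K (linv K (half L2 (K x)) + t) = half L0 (half L1 (K x))"
      using eq[of "half L2 (K x)"] L by (simp add: lifts_inv_f conj_by_lifts conj_by_def[of K t])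
    then have "linv K (half L2 (K x)) + t = linv K (half L0 (half L1 (K x)))"
      using lifts_inv_f[OF K] by metis
    then show ?thesis using L K by (simp add: half lifts_f_inv)
  qed
  then show thesis using that[of "?K L0" "?K L1" "?K L2"] L K by (simp add: lifts_comp lifts_inv)
qed

text \<open>Translation by an integer \<open>t\<close> acts linearly as the sign \<open>c\<close>. A
  hyperbolic product of three half turns is therefore matched, up to this sign, with a product
  \<open>D\<close> of two half turns.\<close>

lemma gadget_lifts_end:
  assumes t: "t = 0 \<or> t = 1"
  obtains K0 K1 K2 K3 K4 where
    "K0 \<in> lifts" "K1 \<in> lifts" "K2 \<in> lifts" "K3 \<in> lifts" "K4 \<in> lifts"
    "\<And>x. half K3 (linv (half K4) (half K2 x)) + t = half K0 (half K1 x)"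
proof -
  define c where "c = cos (pi * t)"
  have c2: "c\<^sup>2 = 1" and c: "c * c = 1" "cis (pi * t) = of_real c" using t by (auto simp: c_def complex_eq_iff)
  have c1: "c * (c * x) = x" for x using c(1) by (metis mult.assoc mult_1)
  \<comment> \<open>\<open>|b| > 1\<close> makes the triple product hyperbolic; this value gives
    half trace \<open>c * sqrt 2\<close> and \<open>1 + b^2 = 3\<close>.\<close>
  define b where "b = - c * sqrt 2"
  have b: "1 + b\<^sup>2 = 3" using c2 by (simp add: b_def power_mult_distrib)
  obtain K0 K1 K2 where K: "K0 \<in> lifts" "K1 \<in> lifts" "K2 \<in> lifts"
    and ray: "ray (half K0 \<circ> half K1 \<circ> linv (half K2))
      (Complex (- b) (sqrt 2 * sqrt 3)) (Complex (sqrt 2 * b) (sqrt 3))"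
    using three_halves_ray[of b] unfolding b by metis
  \<comment> \<open>\<open>D\<close> is to have coefficients \<open>(v, u)\<close>, which are
    \<open>c\<close> times those of the triple product. Composing it with the half turn
    \<open>(\<i> * sqrt 7, k)\<close> must give a half turn again, that is, an imaginary first
    coefficient. The factor \<open>q\<close> cancels the real part and makes \<open>norm k\<close>
    squared equal to \<open>6 = 7 - 1\<close>.\<close>
  define q where "q = sqrt (6 / 7 :: real)"
  have q: "q * q = 6 / 7" "q * (q * x) = 6 / 7 * x" "q * sqrt 7 = sqrt 2 * sqrt 3" for x
    unfolding mult.assoc[symmetric] by (simp_all add: q_def flip: real_sqrt_mult)
  define u where "u = Complex (-2) (c * sqrt 3)"
  define k where "k = of_real (c * q) * u"
  have u: "(norm u)\<^sup>2 = 7" using c2 by (simp add: u_def cmod_power2 power_mult_distrib)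
  have k: "(norm k)\<^sup>2 = 6" using c2 by (simp add: k_def norm_mult power_mult_distrib u) (simp add: q_def)
  obtain K4 where K4: "K4 \<in> lifts" "ray (half K4) (\<i> * of_real (sqrt 7)) k"
    using half_ray[of "sqrt 7" k] k by auto
  define v where "v = Complex (sqrt 2) (c * (sqrt 2 * sqrt 3))"
  define k' where "k' = v * k - u * (\<i> * of_real (sqrt 7))"
  have e: "v * (\<i> * of_real (sqrt 7)) + u * cnj k = \<i> * of_real (sqrt 2 * sqrt 7)"
  proof -
    have "u * cnj k = of_real (c * q) * of_real ((norm u)\<^sup>2)"
      unfolding complex_norm_square by (simp add: k_def)
    also have "\<dots> = of_real (c * (sqrt 2 * sqrt 3 * sqrt 7))"
    proof -
      have "q * 7 = q * sqrt 7 * sqrt 7" by simp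
      then have "c * q * 7 = c * (sqrt 2 * sqrt 3 * sqrt 7)" unfolding q(3) by simp
      then show ?thesis unfolding u by (metis of_real_mult)
    qed
    finally show ?thesis by (simp add: v_def complex_eq_iff)
  qed
  have kk: "k * cnj k = 6" "cnj k * k = 6"
    using complex_norm_square[of k] k by (simp_all add: mult.commute)
  have s7: "of_real (sqrt 7) * of_real (sqrt 7) = (7 :: complex)"
    "of_real (sqrt 7) * (of_real (sqrt 7) * x) = 7 * x" for x :: complex
    unfolding mult.assoc[symmetric] by (simp_all flip: of_real_mult)
  have v2: "(norm v)\<^sup>2 = 8" using c2 by (simp add: v_def cmod_power2 power_mult_distrib)
  have k'2: "(norm k')\<^sup>2 = 13"
  proof -
    let ?j = "\<i> * of_real (sqrt 7) :: complex"
    have "(v * ?j + u * cnj k) * cnj (v * ?j + u * cnj k) - k' * cnj k' =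
        (v * cnj v - u * cnj u) * (7 - k * cnj k)"
      by (simp add: k'_def algebra_simps s7)
    also have "(v * cnj v - u * cnj u) * (7 - k * cnj k) = 1"
      using complex_norm_square[of v] complex_norm_square[of u] by (simp add: kk v2 u)
    finally have "(v * ?j + u * cnj k) * cnj (v * ?j + u * cnj k) - k' * cnj k' = 1" .
    moreover have s14: "sqrt 2 * (sqrt 2 * 7) = 14" by (simp flip: mult.assoc)
    ultimately have "k' * cnj k' = 13"
      unfolding e by (simp add: algebra_simps s14 flip: of_real_mult)
    then have "of_real ((norm k')\<^sup>2) = (of_real 13 :: complex)" unfolding complex_norm_square by simp
    then show ?thesis by (simp only: of_real_eq_iff)
  qed
  obtain K3 where K3: "K3 \<in> lifts" "ray (half K3) (\<i> * of_real (sqrt 2 * sqrt 7)) k'"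
    using half_ray[of "sqrt 2 * sqrt 7" k'] k'2 by (auto simp: power_mult_distrib)
  let ?D = "half K3 \<circ> linv (half K4)"
  have D: "?D \<in> lifts" using K3 K4 by (simp add: lifts_comp lifts_inv conj_by_lifts)
  have "ray (linv (half K4)) (cnj (\<i> * of_real (sqrt 7))) (- k)"
    using K4 k by (intro ray_inv) (auto simp: conj_by_lifts norm_mult)
  from ray_comp[OF K3(2) this]
  have "ray ?D ((v * (\<i> * of_real (sqrt 7)) + u * cnj k) * cnj (\<i> * of_real (sqrt 7)) + k' * cnj (- k))
     ((v * (\<i> * of_real (sqrt 7)) + u * cnj k) * - k + k' * cnj (cnj (\<i> * of_real (sqrt 7))))"
    unfolding e .
  moreover have "(v * (\<i> * of_real (sqrt 7)) + u * cnj k) * cnj (\<i> * of_real (sqrt 7)) + k' * cnj (- k) = v"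
    using s7 kk by (simp add: k'_def algebra_simps)
  moreover have "(v * (\<i> * of_real (sqrt 7)) + u * cnj k) * - k + k' * cnj (cnj (\<i> * of_real (sqrt 7))) = u"
    using s7 kk by (simp add: k'_def algebra_simps)
  ultimately have rD: "ray ?D v u" by simp
  have "ray ((\<lambda>x. x + t) \<circ> ?D) (of_real c * v) (of_real c * u)"
    using ray_comp[OF ray_translation[of t] rD] c(2) by simp
  moreover have "of_real c * v = Complex (- b) (sqrt 2 * sqrt 3)"
    by (simp add: v_def b_def complex_eq_iff c(1) c1)
  moreover have "of_real c * u = Complex (sqrt 2 * b) (sqrt 3)"
    by (simp add: u_def b_def complex_eq_iff c(1) c1)
  ultimately have rT: "ray ((\<lambda>x. x + t) \<circ> ?D) (Complex (- b) (sqrt 2 * sqrt 3)) (Complex (sqrt 2 * b) (sqrt 3))"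
    by simp
  let ?F = "half K0 \<circ> half K1 \<circ> linv (half K2)"
  have F: "?F \<in> lifts" using K by (simp add: lifts_comp lifts_inv conj_by_lifts)
  obtain m :: int where m: "\<And>x. ?F x = ((\<lambda>x. x + t) \<circ> ?D) x + 2 * of_int m"
    using ray_unique[OF F ray lifts_comp[OF lifts_translation D] rT] by blast
  obtain l :: int where l: "t = of_int l" using t by (metis of_int_0 of_int_1)
  have Fl: "?F = (\<lambda>x. ?D x + of_int (l + 2 * m))" using m by (auto simp: l)
  \<comment> \<open>\<open>D\<close> has translation number 0, so that of the triple product is
    \<open>l + 2 * m\<close>. It lies between 0 and 1, and \<open>l\<close> is 0 or 1, which leaves
    \<open>m = 0\<close>.\<close>
  have "has_trn ?F (0 + of_int (l + 2 * m))"
    using has_trn_shift[OF D two_halves_trn[OF K3(1) K4(1)]] unfolding Fl comp_apply .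
  from three_halves_trn[OF K this] have "0 \<le> l + 2 * m" "l + 2 * m \<le> 1" by simp_all
  moreover have "l = 0 \<or> l = 1" using t l by auto
  ultimately have "m = 0" by linarith
  then have "half K3 (linv (half K4) (half K2 x)) + t = half K0 (half K1 x)" for x
    using m[of "half K2 x"] K by (simp add: lifts_inv_f conj_by_lifts)
  with that K K3 K4 show thesis by blast
qed


section \<open>Passage to the threefold cover\<close>

text \<open>Conjugation by \<open>x \<mapsto> 3 * x\<close> lifts to the threefold cover of the
  circle. The unit translation becomes translation by \<open>1/3\<close>, which realises \<nu>, and
  half turns become conjugates of translation by \<open>1/6\<close>.\<close>

definition cover3 :: "(real \<Rightarrow> real) \<Rightarrow> real \<Rightarrow> real" where
  "cover3 F x = F (3 * x) / 3"

lemma cover3_lifts: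
  assumes F: "F \<in> lifts" shows "cover3 F \<in> lifts"
proof -
  have "F (3 * x + 3) = F (3 * x) + 3" for x using lifts_int[OF F, of _ 3] by simp
  moreover have "continuous_on UNIV (\<lambda>x. F (3 * x) / 3)"
    by (intro continuous_intros continuous_on_compose2[OF lifts_cont[OF F]]) auto
  ultimately show ?thesis
    using F by (auto simp: lifts_def cover3_def strict_mono_def algebra_simps cong: continuous_on_cong)
qed

abbreviation rotation :: "real \<Rightarrow> circle \<Rightarrow> circle" where
  "rotation t \<equiv> circ (\<lambda>x. x + t)"

lemma rotation_carrier: "rotation t \<in> carrier homeo_plus_circle"
  by (rule circ_carrier[OF lifts_translation])

lemma rot_rotation: "rot (rotation t) = to_circle t"
  by (rule rot_circ[OF lifts_translation has_trn_translation])

lemma rotation_comp: "rotation s \<circ> rotation t = rotation (s + t)"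
proof -
  have "rotation s \<circ> rotation t = circ ((\<lambda>x. x + s) \<circ> (\<lambda>x. x + t))"
    by (rule circ_comp[symmetric, OF lifts_translation lifts_translation])
  also have "(\<lambda>x. x + s) \<circ> (\<lambda>x. x + t) = (\<lambda>x. x + (s + t))" by auto
  finally show ?thesis .
qed

lemma rotation_0: "rotation 0 = id"
  using circ_id by (simp add: id_def)

lemma rotation_funpow: "rotation t ^^ n = rotation (real n * t)"
proof (induction n)
  case 0
  then show ?case using rotation_0 by simp
next
  case (Suc n)
  then show ?case by (simp add: rotation_comp algebra_simps)
qed

lemma rotation_int: "rotation (t + of_int k) = rotation t"
  by (rule circ_eqI[OF lifts_translation, of _ _ k]) simp

lemma gadget_real:
  assumes t: "0 \<le> t" "t \<le> 1/3"
  obtains w e :: "nat \<Rightarrow> circle \<Rightarrow> circle" and d where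
    "\<And>i. w i \<in> carrier homeo_plus_circle" "\<And>i. e i \<in> carrier homeo_plus_circle"
    "d \<in> carrier homeo_plus_circle" "gadget (rotation (1/6)) (rotation (1/3)) (rotation t) w e d"
proof -
  have "\<exists>K0 K1 K2 K3 K4. K0 \<in> lifts \<and> K1 \<in> lifts \<and> K2 \<in> lifts \<and> K3 \<in> lifts \<and> K4 \<in> lifts \<and>
      (\<forall>x. half K3 (linv (half K4) (half K2 x)) + 3 * t = half K0 (half K1 x)) \<and>
      (\<forall>x. half K3 (linv (half K4) (x + 3 * t)) = half K3 (linv (half K4) x) + 3 * t)"
  proof (cases "0 < 3 * t \<and> 3 * t < 1")
    case True
    then obtain K0 K1 K2 where K: "K0 \<in> lifts" "K1 \<in> lifts" "K2 \<in> lifts"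
      "\<And>x. half K2 x + 3 * t = half K0 (half K1 x)"
      using gadget_lifts_interior[of "3 * t"] by blast
    \<comment> \<open>In the interior \<open>d\<close> is trivial: its two half turns are taken
      equal.\<close>
    have "half id (linv (half id) x) = x" for x by (simp add: lifts_f_inv conj_by_lifts lifts_id)
    with K lifts_id show ?thesis by (metis (no_types, lifting))
  next
    case False
    then have t01: "3 * t = 0 \<or> 3 * t = 1" using t by auto
    then obtain K0 K1 K2 K3 K4 where K: "K0 \<in> lifts" "K1 \<in> lifts" "K2 \<in> lifts" "K3 \<in> lifts" "K4 \<in> lifts"
      "\<And>x. half K3 (linv (half K4) (half K2 x)) + 3 * t = half K0 (half K1 x)"
      by (rule gadget_lifts_end) blast
    \<comment> \<open>At the end points \<open>3 * t\<close> is 0 or 1, and translation by an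
      integer commutes with every lift.\<close>
    have "half K3 (linv (half K4) (x + 3 * t)) = half K3 (linv (half K4) x) + 3 * t" for x
      using t01 K by (auto simp: lifts_1 conj_by_lifts lifts_inv)
    with K show ?thesis by blast
  qed
  then obtain K0 K1 K2 K3 K4 where K: "K0 \<in> lifts" "K1 \<in> lifts" "K2 \<in> lifts" "K3 \<in> lifts" "K4 \<in> lifts"
    and prod: "\<And>x. half K3 (linv (half K4) (half K2 x)) + 3 * t = half K0 (half K1 x)"
    and comm: "\<And>x. half K3 (linv (half K4) (x + 3 * t)) = half K3 (linv (half K4) x) + 3 * t"
    by blast
  define K where "K i = (if i = 0 then K0 else if i = 1 then K1 else if i = 2 then K2
      else if i = 3 then K3 else K4)" for i :: nat
  have KL: "K i \<in> lifts" for i using K by (simp add: K_def)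
  have KE: "K 0 = K0" "K 1 = K1" "K 2 = K2" "K 3 = K3" "K 4 = K4" by (simp_all add: K_def)
  define D where "D = half K3 \<circ> linv (half K4)"
  have D: "D \<in> lifts" using K by (simp add: D_def lifts_comp lifts_inv conj_by_lifts)
  define w where "w i = circ (cover3 (K i))" for i
  define e where "e i = circ (cover3 (half (K i)))" for i
  define d where "d = circ (cover3 D)"
  have cc: "circ F \<circ> circ G = circ H \<circ> circ J"
    if "F \<in> lifts" "G \<in> lifts" "H \<in> lifts" "J \<in> lifts" "\<And>x. F (G x) = H (J x)" for F G H J
  proof -
    have "F \<circ> G = H \<circ> J" using that by auto
    then show ?thesis using that by (metis circ_comp)
  qed
  have "gadget (rotation (1/6)) (rotation (1/3)) (rotation t) w e d"
    unfolding gadget_def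
  proof (intro conjI allI impI)
    fix i :: nat
    show "w i \<circ> rotation (1/3) = rotation (1/3) \<circ> w i"
      unfolding w_def
      by (intro cc cover3_lifts KL lifts_translation)
        (simp add: cover3_def distrib_left lifts_1[OF KL] add_divide_distrib)
    show "e i \<circ> w i = w i \<circ> rotation (1/6)"
      unfolding w_def e_def
      by (intro cc cover3_lifts KL lifts_translation conj_by_lifts)
        (simp add: cover3_def conj_by_def lifts_inv_f KL algebra_simps)
  next
    have "circ (cover3 D \<circ> cover3 (half K4)) = e 3"
      unfolding e_def
      by (rule arg_cong[of _ _ circ]) (auto simp: cover3_def D_def KE lifts_inv_f conj_by_lifts K)
    then show "d \<circ> e 4 = e 3"
      unfolding d_def e_def KE using D K by (simp add: circ_comp cover3_lifts conj_by_lifts)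
  next
    show "d \<circ> rotation t = rotation t \<circ> d"
      unfolding d_def
      by (intro cc cover3_lifts D lifts_translation)
        (simp add: cover3_def distrib_left comm[folded comp_apply[of "half K3"], folded D_def] add_divide_distrib)
  next
    have "circ ((\<lambda>x. x + t) \<circ> cover3 D \<circ> cover3 (half K2)) = circ (cover3 (half K0) \<circ> cover3 (half K1))"
      by (rule arg_cong[of _ _ circ])
        (auto simp: cover3_def D_def prod[symmetric] add_divide_distrib)
    then show "rotation t \<circ> d \<circ> e 2 = e 0 \<circ> e 1"
      unfolding d_def e_def KE using D K
      by (simp add: circ_comp cover3_lifts conj_by_lifts lifts_translation lifts_comp)
  qed
  moreover have "w i \<in> carrier homeo_plus_circle" "e i \<in> carrier homeo_plus_circle" for i
    by (simp_all add: w_def e_def circ_carrier cover3_lifts KL conj_by_lifts)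
  moreover have "d \<in> carrier homeo_plus_circle"
    by (simp add: d_def circ_carrier cover3_lifts D)
  ultimately show thesis using that by blast
qed

lemma triangle_real:
  obtains n1 n2 u v where
    "n1 \<in> carrier homeo_plus_circle" "n2 \<in> carrier homeo_plus_circle"
    "u \<in> carrier homeo_plus_circle" "v \<in> carrier homeo_plus_circle"
    "triangle (rotation (1/6)) (rotation (1/3)) n1 n2 u v"
proof -
  \<comment> \<open>The rotation by \<open>1/3\<close> times an elliptic element with first
    coefficient \<open>1/2 + \<i> * y\<close> has half trace \<open>1/4 - sqrt 3 / 2 * y\<close>.
    This \<open>y\<close> makes it \<open>cos (5 * pi / 6)\<close>, so the product is conjugate to
    translation by \<open>5/6\<close>, which the factor \<open>1/6\<close> completes to a full
    turn.\<close>
  define y :: real where "y = 1 + sqrt 3 / 6"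
  define b where "b = sqrt (y\<^sup>2 - 3/4)"
  define a where "a = Complex (1/2) y"
  have y1: "y \<ge> 1" by (simp add: y_def)
  then have "y\<^sup>2 \<ge> 1" by (simp add: one_le_power)
  then have b: "b\<^sup>2 = y\<^sup>2 - 3/4" by (simp add: b_def)
  obtain L where L: "L \<in> lifts" "ray (conj_by L (1/3)) a (of_real b)"
  proof (rule elliptic_conj[of a "of_real b" "1/3"])
    show "(norm a)\<^sup>2 - (norm (of_real b :: complex))\<^sup>2 = 1"
      by (simp add: cmod_power2 a_def b power2_eq_square[of "1/2"])
  qed (use y1 in \<open>auto simp: a_def cos_60\<close>)
  let ?E = "(\<lambda>x. x + 1/3) \<circ> conj_by L (1/3)"
  have E: "?E \<in> lifts" by (intro lifts_comp lifts_translation conj_by_lifts L)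
  have rE: "ray ?E (cis (pi * (1/3)) * a) (cis (pi * (1/3)) * of_real b)"
    using ray_comp[OF ray_translation[of "1/3"] L(2)] by simp
  obtain K where K: "K \<in> lifts" "ray (conj_by K (5/6)) (cis (pi * (1/3)) * a) (cis (pi * (1/3)) * of_real b)"
  proof (rule elliptic_conj[of "cis (pi * (1/3)) * a" "cis (pi * (1/3)) * of_real b" "5/6"])
    show "(norm (cis (pi * (1/3)) * a))\<^sup>2 - (norm (cis (pi * (1/3)) * of_real b))\<^sup>2 = 1"
      by (simp add: norm_mult) (simp add: cmod_power2 a_def b power2_eq_square[of "1/2"])
    have "cos (pi * (5/6)) = - (sqrt 3 / 2)"
      using cos_pi_minus[of "pi / 6"] by (simp add: cos_30 field_simps)
    moreover have "sqrt 3 * y = sqrt 3 + 1/2" by (simp add: y_def algebra_simps)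
    ultimately show "Re (cis (pi * (1/3)) * a) = cos (pi * (5/6))"
      by (simp add: a_def cos_60 sin_60 add_divide_distrib)
    show "0 < Im (cis (pi * (1/3)) * a)"
      using y1 by (simp add: a_def cos_60 sin_60 add_pos_pos)
  qed auto
  obtain m :: int where m: "\<And>x. ?E x = conj_by K (5/6) x + 2 * of_int m"
    using ray_unique[OF E rE conj_by_lifts[OF K(1)] K(2)] by blast
  have "has_trn (\<lambda>x. conj_by K (5/6) x + of_int (2 * m)) (5/6 + of_int (2 * m))"
    by (intro has_trn_shift conj_by_lifts conj_by_trn K)
  moreover have "(\<lambda>x. conj_by K (5/6) x + of_int (2 * m)) = ?E" using m by auto
  ultimately have trn: "has_trn ?E (5/6 + of_int (2 * m))" by simp
  \<comment> \<open>The product moves 0 by an amount between 0 and 2, which leaves only the lift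
    with \<open>m = 0\<close>.\<close>
  have "0 \<le> 5/6 + real_of_int (2 * m)"
    using conj_by_bounds[OF L(1), of "1/3" 0]
    by (intro has_trn_mono[OF lifts_id(2) E _ _ has_trn_id trn, of 0]) auto
  moreover have "5/6 + real_of_int (2 * m) \<le> 2"
    using conj_by_bounds[OF L(1), of "1/3" 0] lifts_int[OF E, of _ 2]
    by (intro has_trn_mono[OF E lifts_translation _ _ trn has_trn_translation, of _ 0]) auto
  ultimately have "of_int m > (-1::real)" "of_int m < (1::real)" by simp_all
  then have "m = 0" by linarith
  with m have E_eq: "conj_by L (1/3) x + 1/3 = conj_by K (5/6) x" for x by simp
  have half: "conj_by (linv K \<circ> J) t x = linv K (conj_by J t (K x))" if "J \<in> lifts" for J t x
    by (rule conj_by_conj[OF that K(1)])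
  let ?u = "linv K" and ?v = "linv K \<circ> L"
  have uv: "?u \<in> lifts" "?v \<in> lifts" using K L by (simp_all add: lifts_inv lifts_comp)
  have conj: "circ (conj_by J t) \<circ> circ J = circ J \<circ> rotation t" if J: "J \<in> lifts" for J t
  proof -
    have "conj_by J t \<circ> J = J \<circ> (\<lambda>x. x + t)" by (auto simp: conj_by_def lifts_inv_f J)
    then show ?thesis using J by (metis circ_comp conj_by_lifts lifts_translation)
  qed
  have "triangle (rotation (1/6)) (rotation (1/3)) (circ (conj_by ?u (1/3))) (circ (conj_by ?v (1/3)))
      (circ ?u) (circ ?v)"
    unfolding triangle_def
  proof (intro conjI conj uv)
    show "rotation (1/6) \<circ> rotation (1/6) = rotation (1/3)" by (simp add: rotation_comp)
    have u: "conj_by ?u (1/3) x = linv K (K x + 1/3)" for x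
      using half[OF lifts_id(2), of "1/3" x] by (simp add: conj_by_id)
    have "conj_by ?u (1/3) (conj_by ?v (1/3) x) = x + 5/6" for x
    proof -
      have "conj_by ?u (1/3) (conj_by ?v (1/3) x) = linv K (conj_by K (5/6) (K x))"
        using K L by (simp add: u half lifts_f_inv E_eq)
      also have "\<dots> = x + 5/6" using K by (simp add: conj_by_def lifts_inv_f)
      finally show ?thesis .
    qed
    then have "(\<lambda>x. x + 1/6) \<circ> conj_by ?u (1/3) \<circ> conj_by ?v (1/3) = (\<lambda>x. x + 1)" by auto
    then have "rotation (1/6) \<circ> circ (conj_by ?u (1/3)) \<circ> circ (conj_by ?v (1/3)) = rotation 1"
      using uv by (simp add: lifts_translation lifts_comp conj_by_lifts flip: circ_comp)
    also have "rotation 1 = id" using rotation_int[of 0 1] rotation_0 by simp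
    finally show "rotation (1/6) \<circ> circ (conj_by ?u (1/3)) \<circ> circ (conj_by ?v (1/3)) = id" .
  qed
  with that uv show thesis by (metis circ_carrier conj_by_lifts)
qed

section \<open>Presentations by positive equations\<close>

definition letter_val :: "('a, 'b) monoid_scheme \<Rightarrow> ('x \<Rightarrow> 'a) \<Rightarrow> 'x \<times> bool \<Rightarrow> 'a" where
  "letter_val H v a = (if snd a then v (fst a) else inv\<^bsub>H\<^esub> v (fst a))"

definition word_val :: "('a, 'b) monoid_scheme \<Rightarrow> ('x \<Rightarrow> 'a) \<Rightarrow> 'x word \<Rightarrow> 'a" where
  "word_val H v w = foldr (\<lambda>a. mult H (letter_val H v a)) w \<one>\<^bsub>H\<^esub>"

lemma word_val_simps [simp]:
  "word_val H v [] = \<one>\<^bsub>H\<^esub>"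
  "word_val H v (a # w) = letter_val H v a \<otimes>\<^bsub>H\<^esub> word_val H v w"
  by (simp_all add: word_val_def)

lemma inverse_lists: "w \<in> lists (S \<times> UNIV) \<Longrightarrow> rev (map inv_letter w) \<in> lists (S \<times> UNIV)"
  by (fastforce simp: inv_letter_def)

section \<open>Evaluation of words and the universal property of the free group\<close>

context group
begin

lemma letter_val_closed: "v ` S \<subseteq> carrier G \<Longrightarrow> a \<in> S \<times> UNIV \<Longrightarrow> letter_val G v a \<in> carrier G"
  by (auto simp: letter_val_def)

lemma word_val_closed: "v ` S \<subseteq> carrier G \<Longrightarrow> w \<in> lists (S \<times> UNIV) \<Longrightarrow> word_val G v w \<in> carrier G"
  by (induction w) (auto simp: letter_val_def)

lemma letter_val_inv:
  "v ` S \<subseteq> carrier G \<Longrightarrow> a \<in> S \<times> UNIV \<Longrightarrow> letter_val G v (inv_letter a) = inv (letter_val G v a)"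
  by (auto simp: letter_val_def inv_letter_def)

lemma word_val_append:
  assumes "v ` S \<subseteq> carrier G" "u \<in> lists (S \<times> UNIV)" "w \<in> lists (S \<times> UNIV)"
  shows "word_val G v (u @ w) = word_val G v u \<otimes> word_val G v w"
  using assms(2)
proof (induction u)
  case (Cons a u)
  then show ?case
    using assms by (simp add: m_assoc letter_val_closed word_val_closed)
qed (simp add: word_val_closed[OF assms(1,3)])

lemma word_val_push:
  assumes v: "v ` S \<subseteq> carrier G" and a: "a \<in> S \<times> UNIV" and w: "w \<in> lists (S \<times> UNIV)"
  shows "word_val G v (push a w) = letter_val G v a \<otimes> word_val G v w"
proof (cases w)
  case (Cons b w')
  have "letter_val G v a \<otimes> (letter_val G v (inv_letter a) \<otimes> word_val G v w') = word_val G v w'"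
    using w Cons v a
    by (simp add: letter_val_inv[OF v a] letter_val_closed[OF v a] word_val_closed[OF v] flip: m_assoc)
  then show ?thesis using Cons by auto
qed simp

lemma word_val_reduce:
  assumes v: "v ` S \<subseteq> carrier G" and w: "w \<in> lists (S \<times> UNIV)"
  shows "word_val G v (reduce w) = word_val G v w"
  using w
proof (induction w)
  case (Cons a w)
  then have "reduce w \<in> lists (S \<times> UNIV)" using reduce_in_lists by blast
  then have "word_val G v (push a (reduce w)) = letter_val G v a \<otimes> word_val G v (reduce w)"
    using Cons.hyps by (intro word_val_push[OF v]) auto
  then show ?case using Cons by (simp add: reduce_def)
qed (simp add: reduce_def)

lemma word_val_inverse:
  assumes v: "v ` S \<subseteq> carrier G" and w: "w \<in> lists (S \<times> UNIV)"
  shows "word_val G v (rev (map inv_letter w)) = inv (word_val G v w)"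
  using w
proof (induction w)
  case (Cons a w)
  have il: "inv_letter b \<in> S \<times> UNIV \<longleftrightarrow> b \<in> S \<times> UNIV" for b :: "'c \<times> bool"
    by (cases b) (auto simp: inv_letter_def)
  have "rev (map inv_letter w) \<in> lists (S \<times> UNIV)" "[inv_letter a] \<in> lists (S \<times> UNIV)"
    using inverse_lists[OF Cons.hyps(2)] Cons.hyps(1) il by simp_all
  from word_val_append[OF v this] show ?case
    using Cons letter_val_closed[OF v, of a] letter_val_closed[OF v, of "inv_letter a"] word_val_closed[OF v] il[of a]
    by (simp add: letter_val_inv[OF v] inv_mult_group)
qed simp

lemma word_val_hom:
  assumes v: "v ` S \<subseteq> carrier G"
  shows "word_val G v \<in> hom (free_group S) G"
proof (rule homI)
  fix u w assume "u \<in> carrier (free_group S)" "w \<in> carrier (free_group S)"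
  then have "u \<in> lists (S \<times> UNIV)" "w \<in> lists (S \<times> UNIV)" by (auto simp: free_group_def)
  then show "word_val G v (u \<otimes>\<^bsub>free_group S\<^esub> w) = word_val G v u \<otimes> word_val G v w"
    using word_val_append[OF v] word_val_reduce[OF v, of "u @ w"] by (simp add: free_group_def)
qed (use word_val_closed[OF v] in \<open>auto simp: free_group_def\<close>)

lemma free_group_hom_val:
  assumes h: "h \<in> hom (free_group S) G" and w: "w \<in> carrier (free_group S)"
  shows "h w = word_val G (\<lambda>s. h [(s, True)]) w"
proof -
  interpret F: group "free_group S" by (rule group_free_group)
  interpret h: group_hom "free_group S" G h
    by unfold_locales (rule h)
  have single: "[a] \<in> carrier (free_group S)" if "a \<in> S \<times> UNIV" for a
    using that by (auto simp: free_group_def reduce_def)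
  have letter: "h [a] = letter_val G (\<lambda>s. h [(s, True)]) a" if a: "a \<in> S \<times> UNIV" for a
  proof (cases "snd a")
    case True
    then show ?thesis by (cases a) (simp add: letter_val_def)
  next
    case False
    then obtain s where s: "a = (s, False)" by (cases a) auto
    have c: "[(s, True)] \<in> carrier (free_group S)" using a s by (intro single) auto
    have "[a] \<otimes>\<^bsub>free_group S\<^esub> [(s, True)] = \<one>\<^bsub>free_group S\<^esub>"
      by (simp add: free_group_def reduce_def s inv_letter_def)
    then have "inv\<^bsub>free_group S\<^esub> [(s, True)] = [a]"
      using c single[OF a] by (intro F.inv_equality)
    then show ?thesis using h.hom_inv[OF c] s by (simp add: letter_val_def)
  qed
  show ?thesis using w
  proof (induction w)
    case Nil
    then show ?case using h.hom_one by (simp add: free_group_def)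
  next
    case (Cons a w)
    then have red: "is_reduced (a # w)" "a \<in> S \<times> UNIV" "w \<in> lists (S \<times> UNIV)"
      by (auto simp: free_group_def reduce_eq_iff)
    then have "is_reduced w" by (cases w) auto
    then have w: "w \<in> carrier (free_group S)" using red by (simp add: free_group_def reduce_eq_iff)
    have "[a] \<otimes>\<^bsub>free_group S\<^esub> w = a # w"
      using red(1) reduce_reduced[of "a # w"] by (simp add: free_group_def)
    then have "h (a # w) = h [a] \<otimes> h w" using h.hom_mult[OF single[OF red(2)] w] by simp
    then show ?case using Cons.IH[OF w] letter[OF red(2)] by simp
  qed
qed

end

text \<open>Formulated for an abstract surjection \<open>p\<close>, so that it applies to a quotient
  transported to \<open>nat\<close> without mention of cosets.\<close>

lemma hom_factor:
  assumes F: "group F" and G: "group G" and H: "group H"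
    and p: "p \<in> hom F G" "p ` carrier F = carrier G" and q: "q \<in> hom F H"
    and ker: "\<And>w. w \<in> carrier F \<Longrightarrow> p w = \<one>\<^bsub>G\<^esub> \<Longrightarrow> q w = \<one>\<^bsub>H\<^esub>"
  shows "\<exists>r\<in>hom G H. \<forall>w\<in>carrier F. r (p w) = q w"
proof -
  interpret F: group F by fact
  interpret p: group_hom F G p using F G p(1) by (simp add: group_hom_def group_hom_axioms_def)
  interpret q: group_hom F H q using F H q by (simp add: group_hom_def group_hom_axioms_def)
  have eq: "q x = q y" if x: "x \<in> carrier F" and y: "y \<in> carrier F" and xy: "p x = p y" for x y
  proof -
    have "p (x \<otimes>\<^bsub>F\<^esub> inv\<^bsub>F\<^esub> y) = \<one>\<^bsub>G\<^esub>" using x y xy by simp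
    then have "q (x \<otimes>\<^bsub>F\<^esub> inv\<^bsub>F\<^esub> y) = \<one>\<^bsub>H\<^esub>" using x y by (intro ker) auto
    then have "q x \<otimes>\<^bsub>H\<^esub> inv\<^bsub>H\<^esub> q y = \<one>\<^bsub>H\<^esub>" using x y by simp
    then show ?thesis
      using x y q.H.inv_equality[of "q x" "inv\<^bsub>H\<^esub> q y"] by simp
  qed
  define r where "r g = q (SOME w. w \<in> carrier F \<and> p w = g)" for g
  have r: "r (p w) = q w" if w: "w \<in> carrier F" for w
  proof -
    have "\<exists>w'. w' \<in> carrier F \<and> p w' = p w" using w by blast
    from someI_ex[OF this] show ?thesis unfolding r_def using w by (intro eq) auto
  qed
  have "r \<in> hom G H"
  proof (rule homI)
    fix x assume "x \<in> carrier G"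
    then obtain u where "u \<in> carrier F" "x = p u" using p(2) by (metis imageE)
    then show "r x \<in> carrier H" by (simp add: r)
  next
    fix x y assume "x \<in> carrier G" "y \<in> carrier G"
    then obtain u w where "u \<in> carrier F" "x = p u" "w \<in> carrier F" "y = p w"
      using p(2) by (metis imageE)
    then show "r (x \<otimes>\<^bsub>G\<^esub> y) = r x \<otimes>\<^bsub>H\<^esub> r y"
      by (simp add: r flip: p.hom_mult)
  qed
  with r show ?thesis by blast
qed

section \<open>Groups presented by equations between positive words\<close>

definition list_prod :: "('a, 'b) monoid_scheme \<Rightarrow> 'a list \<Rightarrow> 'a" where
  "list_prod H xs = foldr (mult H) xs \<one>\<^bsub>H\<^esub>"

definition satisfies :: "('a, 'b) monoid_scheme \<Rightarrow> ('g \<Rightarrow> 'a) \<Rightarrow> ('g list \<times> 'g list) set \<Rightarrow> bool" where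
  "satisfies H v E \<longleftrightarrow> (\<forall>(l, r)\<in>E. list_prod H (map v l) = list_prod H (map v r))"

definition pos_word :: "'g :: countable list \<Rightarrow> nat word" where
  "pos_word = map (\<lambda>x. (to_nat x, True))"

definition relator :: "'g :: countable list \<times> 'g list \<Rightarrow> nat word" where
  "relator = (\<lambda>(l, r). reduce (pos_word l @ rev (map inv_letter (pos_word r))))"

text \<open>Only the image of the free group and the kernel are recorded, so the carrier can be any
  set of naturals. Coding the generators by \<open>to_nat\<close> matches
  \<open>finitely_presented\<close>.\<close>

definition presents ::
  "'g :: countable set \<Rightarrow> ('g list \<times> 'g list) set \<Rightarrow> nat monoid \<Rightarrow> ('g \<Rightarrow> nat) \<Rightarrow> bool" where
  "presents V E G gen \<longleftrightarrow> group G \<and> E \<subseteq> lists V \<times> lists V \<and>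
     (\<exists>p\<in>hom (free_group (to_nat ` V)) G. p ` carrier (free_group (to_nat ` V)) = carrier G \<and>
        (\<forall>w\<in>carrier (free_group (to_nat ` V)).
           p w = \<one>\<^bsub>G\<^esub> \<longleftrightarrow> w \<in> normal_closure (free_group (to_nat ` V)) (relator ` E)) \<and>
        (\<forall>x\<in>V. gen x = p [(to_nat x, True)]))"

lemma pos_word_lists: "l \<in> lists V \<Longrightarrow> pos_word l \<in> lists (to_nat ` V \<times> UNIV)"
  by (induction l) (auto simp: pos_word_def)

lemma relator_carrier:
  assumes "E \<subseteq> lists V \<times> lists V"
  shows "relator ` E \<subseteq> carrier (free_group (to_nat ` V))"
proof
  fix w assume "w \<in> relator ` E"
  then obtain l r where "(l, r) \<in> E" and w: "w = reduce (pos_word l @ rev (map inv_letter (pos_word r)))"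
    by (auto simp: relator_def)
  then have "l \<in> lists V" "r \<in> lists V" using assms by auto
  then have "pos_word l @ rev (map inv_letter (pos_word r)) \<in> lists (to_nat ` V \<times> UNIV)"
    using pos_word_lists[of l V] inverse_lists[OF pos_word_lists[of r V]]
    by (simp del: in_lists_conv_set)
  then show "w \<in> carrier (free_group (to_nat ` V))"
    unfolding w free_group_def
    by (auto dest!: reduce_in_lists simp: reduce_eq_iff reduced_reduce simp del: in_lists_conv_set append_in_lists_conv)
qed

lemma (in group) word_val_pos:
  assumes "\<And>x. x \<in> set l \<Longrightarrow> v' (to_nat x) = v x"
  shows "word_val G v' (pos_word l) = list_prod G (map v l)"
  using assms by (induction l) (auto simp: pos_word_def list_prod_def letter_val_def)

lemma (in group) word_val_relator:
  assumes E: "(l, r) \<in> lists V \<times> lists V" and v: "v ` V \<subseteq> carrier G"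
    and v': "\<And>x. x \<in> V \<Longrightarrow> v' (to_nat x) = v x"
  shows "word_val G v' (relator (l, r)) = \<one> \<longleftrightarrow> list_prod G (map v l) = list_prod G (map v r)"
proof -
  have v'S: "v' ` to_nat ` V \<subseteq> carrier G" using v v' by auto
  have l: "pos_word l \<in> lists (to_nat ` V \<times> UNIV)" and r: "pos_word r \<in> lists (to_nat ` V \<times> UNIV)"
    using E pos_word_lists by blast+
  have "word_val G v' (relator (l, r)) = word_val G v' (pos_word l) \<otimes> inv (word_val G v' (pos_word r))"
    using l r inverse_lists[OF r]
    by (simp add: relator_def word_val_reduce[OF v'S] word_val_append[OF v'S] word_val_inverse[OF v'S]
        del: in_lists_conv_set)
  moreover have "word_val G v' (pos_word l) = list_prod G (map v l)"
    "word_val G v' (pos_word r) = list_prod G (map v r)"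
    using E v' by (auto intro!: word_val_pos)
  moreover have "word_val G v' (pos_word l) \<in> carrier G" "word_val G v' (pos_word r) \<in> carrier G"
    using word_val_closed[OF v'S] l r by blast+
  ultimately show ?thesis
    using inv_solve_right'[of \<one>] by auto
qed

text \<open>Von Dyck's theorem: the relators lie in the kernel of evaluation, which is normal, so
  their normal closure does too and evaluation factors through \<open>G\<close>.\<close>

lemma presents_hom:
  assumes P: "presents V E G gen" and H: "group H" and v: "v ` V \<subseteq> carrier H" and sat: "satisfies H v E"
  shows "\<exists>\<rho>\<in>hom G H. \<forall>x\<in>V. \<rho> (gen x) = v x"
proof -
  interpret H: group H by fact
  let ?F = "free_group (to_nat ` V)"
  have F: "group ?F" by (rule group_free_group)
  obtain p where p: "p \<in> hom ?F G" "p ` carrier ?F = carrier G"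
    and ker: "\<And>w. w \<in> carrier ?F \<Longrightarrow> p w = \<one>\<^bsub>G\<^esub> \<longleftrightarrow> w \<in> normal_closure ?F (relator ` E)"
    and gen: "\<And>x. x \<in> V \<Longrightarrow> gen x = p [(to_nat x, True)]"
    and G: "group G" and E: "E \<subseteq> lists V \<times> lists V"
    using P unfolding presents_def by blast
  define v' where "v' n = v (from_nat n)" for n
  have v': "v' (to_nat x) = v x" for x by (simp add: v'_def)
  have v'S: "v' ` to_nat ` V \<subseteq> carrier H" using v v' by auto
  let ?q = "word_val H v'"
  have q: "?q \<in> hom ?F H" by (rule H.word_val_hom[OF v'S])
  interpret q: group_hom ?F H ?q using F H q by (simp add: group_hom_def group_hom_axioms_def)
  have "relator ` E \<subseteq> kernel ?F H ?q"
  proof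
    fix w assume w: "w \<in> relator ` E"
    then obtain l r where lr: "(l, r) \<in> E" "w = relator (l, r)" by auto
    then have "?q w = \<one>\<^bsub>H\<^esub>"
      using sat H.word_val_relator[OF _ v, of l r v'] E v' by (auto simp: satisfies_def)
    then show "w \<in> kernel ?F H ?q" using relator_carrier[OF E] w by (auto simp: kernel_def)
  qed
  then have "normal_closure ?F (relator ` E) \<subseteq> kernel ?F H ?q"
    using q.normal_kernel by (auto simp: normal_closure_def)
  then have "\<exists>\<rho>\<in>hom G H. \<forall>w\<in>carrier ?F. \<rho> (p w) = ?q w"
    using ker by (intro hom_factor F G H p q) (auto simp: kernel_def)
  then obtain \<rho> where \<rho>: "\<rho> \<in> hom G H" "\<And>w. w \<in> carrier ?F \<Longrightarrow> \<rho> (p w) = ?q w" by blast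
  have "\<rho> (gen x) = v x" if x: "x \<in> V" for x
  proof -
    have "[(to_nat x, True)] \<in> carrier ?F" using x by (auto simp: free_group_def reduce_def)
    then show ?thesis using \<rho>(2) gen[OF x] v v' x by (auto simp: letter_val_def)
  qed
  with \<rho> show ?thesis by blast
qed

lemma presents_gen:
  assumes P: "presents V E G gen"
  shows "gen ` V \<subseteq> carrier G" "satisfies G gen E"
proof -
  let ?F = "free_group (to_nat ` V)"
  obtain p where p: "p \<in> hom ?F G"
    and ker: "\<And>w. w \<in> carrier ?F \<Longrightarrow> p w = \<one>\<^bsub>G\<^esub> \<longleftrightarrow> w \<in> normal_closure ?F (relator ` E)"
    and gen: "\<And>x. x \<in> V \<Longrightarrow> gen x = p [(to_nat x, True)]"
    and G: "group G" and E: "E \<subseteq> lists V \<times> lists V"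
    using P unfolding presents_def by blast
  interpret G: group G by fact
  have "[(to_nat x, True)] \<in> carrier ?F" if "x \<in> V" for x
    using that by (auto simp: free_group_def reduce_def)
  then show gc: "gen ` V \<subseteq> carrier G" using p gen by (auto simp: hom_def)
  show "satisfies G gen E"
    unfolding satisfies_def
  proof (clarify)
    fix l r assume lr: "(l, r) \<in> E"
    have c: "relator (l, r) \<in> carrier ?F" using relator_carrier[OF E] lr by blast
    have "relator (l, r) \<in> normal_closure ?F (relator ` E)"
      using lr by (auto simp: normal_closure_def)
    then have "p (relator (l, r)) = \<one>\<^bsub>G\<^esub>" using ker[OF c] by simp
    then have "word_val G (\<lambda>s. p [(s, True)]) (relator (l, r)) = \<one>\<^bsub>G\<^esub>"
      using G.free_group_hom_val[OF p c] by simp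
    then show "list_prod G (map gen l) = list_prod G (map gen r)"
      using G.word_val_relator[OF _ gc, of l r "\<lambda>s. p [(s, True)]"] lr E gen by auto
  qed
qed

lemma satisfies_cong:
  assumes "E \<subseteq> lists V \<times> lists V" "\<And>x. x \<in> V \<Longrightarrow> v x = v' x"
  shows "satisfies H v E \<longleftrightarrow> satisfies H v' E"
proof -
  have "map v l = map v' l \<and> map v r = map v' r" if "(l, r) \<in> E" for l r
    using assms(2) subsetD[OF assms(1) that] by auto
  then show ?thesis unfolding satisfies_def by (metis (no_types, lifting) case_prodI2 case_prodD)
qed

lemma hom_list_prod:
  assumes "group G" "group H" "h \<in> hom G H" "set xs \<subseteq> carrier G"
  shows "h (list_prod G xs) = list_prod H (map h xs)"
proof -
  interpret h: group_hom G H h using assms by (simp add: group_hom_def group_hom_axioms_def)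
  have "list_prod G xs \<in> carrier G \<and> ?thesis"
    using assms(4) by (induction xs) (auto simp: list_prod_def)
  then show ?thesis ..
qed

lemma presents_sat:
  assumes P: "presents V E G gen" and H: "group H" and h: "h \<in> hom G H"
  shows "satisfies H (h \<circ> gen) E"
  unfolding satisfies_def
proof (clarify)
  fix l r assume lr: "(l, r) \<in> E"
  have E: "E \<subseteq> lists V \<times> lists V" and G: "group G" using P by (auto simp: presents_def)
  have "set (map gen l) \<subseteq> carrier G" "set (map gen r) \<subseteq> carrier G"
    using subsetD[OF E lr] presents_gen(1)[OF P] by auto
  moreover have "list_prod G (map gen l) = list_prod G (map gen r)"
    using presents_gen(2)[OF P] lr by (auto simp: satisfies_def)
  ultimately show "list_prod H (map (h \<circ> gen) l) = list_prod H (map (h \<circ> gen) r)"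
    using hom_list_prod[OF G H h] by (metis map_map)
qed

lemma presents_val:
  assumes P: "presents V E G gen" and H: "group H" and h: "h \<in> hom G H"
  obtains v where "\<And>x. v x \<in> carrier H" "satisfies H v E" "\<And>x. x \<in> V \<Longrightarrow> v x = h (gen x)"
proof -
  have E: "E \<subseteq> lists V \<times> lists V" using P by (simp add: presents_def)
  \<comment> \<open>Letters outside \<open>V\<close> get the neutral element, so that all values of
    \<open>v\<close> lie in the carrier.\<close>
  define v where "v x = (if x \<in> V then h (gen x) else \<one>\<^bsub>H\<^esub>)" for x
  have "satisfies H v E"
    using presents_sat[OF P H h] by (subst satisfies_cong[OF E, of v "h \<circ> gen"]) (simp_all add: v_def)
  moreover have "v x \<in> carrier H" for x
    using presents_gen(1)[OF P] h H by (auto simp: v_def hom_def group_def monoid.one_closed)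
  moreover have "v x = h (gen x)" if "x \<in> V" for x using that by (simp add: v_def)
  ultimately show thesis using that by blast
qed

lemma presents_exists:
  fixes V :: "'g :: countable set"
  assumes V: "finite V" and E: "finite E" "E \<subseteq> lists V \<times> lists V"
  obtains G gen where "presents V E G gen" "finitely_presented G"
proof -
  let ?F = "free_group (to_nat ` V)"
  define N where "N = normal_closure ?F (relator ` E)"
  interpret F: group ?F by (rule group_free_group)
  interpret N: normal N ?F
    unfolding N_def by (rule normal_normal_closure[OF group_free_group relator_carrier[OF E(2)]])
  let ?Q = "?F Mod N"
  have Q: "group ?Q" by (rule N.factorgroup_is_group)
  interpret Q: group ?Q by fact
  have "countable (carrier ?F)" by simp
  then have cQ: "countable (carrier ?Q)"
    unfolding FactGroup_def RCOSETS_def by simp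
  \<comment> \<open>The cosets are countably many; an injection into \<open>nat\<close> carries the
    group structure of the quotient along.\<close>
  define f where "f = to_nat_on (carrier ?Q)"
  have inj: "inj_on f (carrier ?Q)" unfolding f_def by (rule inj_on_to_nat_on[OF cQ])
  define g where "g = inv_into (carrier ?Q) f"
  have gf: "g (f x) = x" if "x \<in> carrier ?Q" for x
    using that inj by (simp add: g_def)
  define G :: "nat monoid" where
    "G = \<lparr>carrier = f ` carrier ?Q, mult = (\<lambda>a b. f (g a \<otimes>\<^bsub>?Q\<^esub> g b)), one = f \<one>\<^bsub>?Q\<^esub>\<rparr>"
  have G: "group G"
  proof (rule groupI)
    fix x assume "x \<in> carrier G"
    then obtain a where a: "a \<in> carrier ?Q" "x = f a" by (auto simp: G_def)
    then have "f (inv\<^bsub>?Q\<^esub> a) \<in> carrier G" "f (inv\<^bsub>?Q\<^esub> a) \<otimes>\<^bsub>G\<^esub> x = \<one>\<^bsub>G\<^esub>"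
      by (auto simp: G_def gf simp del: mult_FactGroup one_FactGroup)
    then show "\<exists>y\<in>carrier G. y \<otimes>\<^bsub>G\<^esub> x = \<one>\<^bsub>G\<^esub>" by blast
  qed (auto simp: G_def gf Q.m_assoc simp del: mult_FactGroup one_FactGroup)
  have hom: "f \<in> hom ?Q G"
    by (rule homI) (auto simp: G_def gf simp del: mult_FactGroup one_FactGroup)
  have "f \<in> iso ?Q G"
    using hom inj unfolding iso_def bij_betw_def by (simp add: G_def)
  then have iso: "G \<cong> ?Q" using Q.iso_sym by (auto simp: is_iso_def)
  have fp: "finitely_presented G"
    unfolding finitely_presented_def
    using G V E(1) relator_carrier[OF E(2)] iso
    by (intro conjI exI[of _ "to_nat ` V"] exI[of _ "relator ` E"]) (simp_all add: N_def)
  define p where "p w = f (N #>\<^bsub>?F\<^esub> w)" for w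
  define gen where "gen x = p [(to_nat x, True)]" for x :: 'g
  have coset: "N #>\<^bsub>?F\<^esub> w \<in> carrier ?Q" if "w \<in> carrier ?F" for w
    using that by (auto simp: FactGroup_def RCOSETS_def)
  have p: "p \<in> hom ?F G"
  proof -
    have "(\<lambda>w. N #>\<^bsub>?F\<^esub> w) \<in> hom ?F ?Q" by (rule N.r_coset_hom_Mod)
    from hom_compose[OF this hom] show ?thesis by (simp add: p_def[abs_def] comp_def)
  qed
  have "p ` carrier ?F = carrier G"
    by (auto simp: p_def G_def FactGroup_def RCOSETS_def)
  moreover have "p w = \<one>\<^bsub>G\<^esub> \<longleftrightarrow> w \<in> N" if w: "w \<in> carrier ?F" for w
  proof -
    have "p w = \<one>\<^bsub>G\<^esub> \<longleftrightarrow> N #>\<^bsub>?F\<^esub> w = \<one>\<^bsub>?Q\<^esub>"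
      using inj_on_eq_iff[OF inj coset[OF w] Q.one_closed] by (simp add: p_def G_def del: one_FactGroup)
    also have "\<dots> \<longleftrightarrow> w \<in> N"
      using w N.subgroup_axioms F.coset_join1[of N w] F.coset_join2[of w N] N.subset
      by auto
    finally show ?thesis .
  qed
  ultimately have "presents V E G gen"
    unfolding presents_def using G E p by (auto simp: N_def gen_def intro!: bexI[of _ p])
  with fp that show thesis by blast
qed

section \<open>The system of equations for finitely many arcs\<close>

type_synonym arc = "nat \<times> nat \<times> nat \<times> nat"

text \<open>
  \<open>Nu\<close>, \<open>Al\<close> and \<open>Rt\<close> are \<open>\<nu>\<close>, \<open>\<alpha>\<close> and the square root of \<open>\<nu>\<close>; \<open>Tn\<close> and \<open>Tc\<close> the conjugates of \<open>\<nu>\<close>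
  and the conjugators in the triangle relation. For the arc with parameters \<open>p = (c, j, j', M)\<close> the
  two factors are \<open>Arc p True\<close> and \<open>Arc p False\<close>, and \<open>Cw\<close>, \<open>Ce\<close>, \<open>Cd\<close> are the auxiliary elements
  \<open>w\<close>, \<open>e\<close>, \<open>d\<close> of the gadget imposed on their \<open>m\<close>-th powers.
\<close>

datatype letter = Nu | Al | Rt | Tn bool | Tc bool | Arc arc bool
  | Cw arc bool nat nat | Ce arc bool nat nat | Cd arc bool nat

instance letter :: countable by countable_datatype

definition base_eqs :: "(letter list \<times> letter list) set" where
  "base_eqs = {([Rt, Rt], [Nu]), ([Nu, Nu, Nu], []),
     ([Tn False, Tc False], [Tc False, Nu]), ([Tn True, Tc True], [Tc True, Nu]),
     ([Rt, Tn False, Tn True], [])}"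

definition gadget_eqs :: "arc \<Rightarrow> bool \<Rightarrow> nat \<Rightarrow> (letter list \<times> letter list) set" where
  "gadget_eqs p s m =
     (\<lambda>i. ([Cw p s m i, Nu], [Nu, Cw p s m i])) ` {..<5} \<union>
     (\<lambda>i. ([Ce p s m i, Cw p s m i], [Cw p s m i, Rt])) ` {..<5} \<union>
     {([Cd p s m, Ce p s m 4], [Ce p s m 3]),
      (Cd p s m # replicate m (Arc p s), replicate m (Arc p s) @ [Cd p s m]),
      (replicate m (Arc p s) @ [Cd p s m, Ce p s m 2], [Ce p s m 0, Ce p s m 1])}"

text \<open>The fourth equation solves \<alpha> as the \<open>c\<close>-th power of
  \<open>Rt\<close> times the \<open>j\<close>-th power of \<open>Arc p True\<close> times the
  inverse of the \<open>j'\<close>-th power of \<open>Arc p False\<close>; the first three give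
  commutation. Since the exponents run from 1 to \<open>Suc M\<close>, each factor carries at least
  one gadget.\<close>

definition arc_eqs :: "arc \<Rightarrow> (letter list \<times> letter list) set" where
  "arc_eqs p = (case p of (c, j, j', M) \<Rightarrow>
     {([Arc p True, Arc p False], [Arc p False, Arc p True]),
      ([Al, Arc p False], [Arc p False, Al]),
      ([Rt, Arc p True], [Arc p True, Rt]),
      (Al # replicate j' (Arc p False), replicate c Rt @ replicate j (Arc p True))} \<union>
     (\<Union>s. \<Union>m\<in>{1..Suc M}. gadget_eqs p s m))"

definition system :: "arc set \<Rightarrow> (letter list \<times> letter list) set" where
  "system P = base_eqs \<union> (\<Union>p\<in>P. arc_eqs p)"

lemma list_prod_simps:
  "list_prod homeo_plus_circle [] = id"
  "list_prod homeo_plus_circle (x # xs) = x \<circ> list_prod homeo_plus_circle xs"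
  "list_prod homeo_plus_circle (replicate n x @ xs) = x ^^ n \<circ> list_prod homeo_plus_circle xs"
  "list_prod homeo_plus_circle (replicate n x) = x ^^ n"
proof -
  show 1: "list_prod homeo_plus_circle [] = id"
    "list_prod homeo_plus_circle (x # xs) = x \<circ> list_prod homeo_plus_circle xs" for x xs
    by (simp_all add: list_prod_def mult_homeo one_homeo)
  show 2: "list_prod homeo_plus_circle (replicate n x @ xs) = x ^^ n \<circ> list_prod homeo_plus_circle xs" for xs
    by (induction n) (simp_all add: 1 comp_assoc)
  show "list_prod homeo_plus_circle (replicate n x) = x ^^ n" using 2[of "[]"] by (simp add: 1)
qed

lemma satisfies_Un: "satisfies H v (E \<union> E') \<longleftrightarrow> satisfies H v E \<and> satisfies H v E'"
  by (auto simp: satisfies_def)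

lemma satisfies_UN: "satisfies H v (\<Union>x\<in>X. E x) \<longleftrightarrow> (\<forall>x\<in>X. satisfies H v (E x))"
  by (auto simp: satisfies_def)

lemma satisfies_image: "satisfies H v (f ` X) \<longleftrightarrow> (\<forall>x\<in>X. satisfies H v {f x})"
  by (auto simp: satisfies_def)

lemma satisfies_insert: "satisfies H v (insert (l, r) E) \<longleftrightarrow>
    list_prod H (map v l) = list_prod H (map v r) \<and> satisfies H v E"
  and satisfies_empty: "satisfies H v {}"
  by (auto simp: satisfies_def)

lemma satisfies_gadget:
  "satisfies homeo_plus_circle v (gadget_eqs p s m) \<longleftrightarrow>
     gadget (v Rt) (v Nu) (v (Arc p s) ^^ m) (\<lambda>i. v (Cw p s m i)) (\<lambda>i. v (Ce p s m i)) (v (Cd p s m))"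
  unfolding gadget_eqs_def gadget_def satisfies_Un satisfies_image satisfies_insert
  by (auto simp: list_prod_simps satisfies_empty comp_assoc map_replicate)

definition arc_rel :: "(letter \<Rightarrow> circle \<Rightarrow> circle) \<Rightarrow> arc \<Rightarrow> bool" where
  "arc_rel v p \<longleftrightarrow> (case p of (c, j, j', M) \<Rightarrow>
     v (Arc p True) \<circ> v (Arc p False) = v (Arc p False) \<circ> v (Arc p True) \<and>
     v Al \<circ> v (Arc p False) = v (Arc p False) \<circ> v Al \<and>
     v Rt \<circ> v (Arc p True) = v (Arc p True) \<circ> v Rt \<and>
     v Al \<circ> v (Arc p False) ^^ j' = v Rt ^^ c \<circ> v (Arc p True) ^^ j \<and>
     (\<forall>s. \<forall>m\<in>{1..Suc M}. gadget (v Rt) (v Nu) (v (Arc p s) ^^ m)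
        (\<lambda>i. v (Cw p s m i)) (\<lambda>i. v (Ce p s m i)) (v (Cd p s m))))"

lemma satisfies_arc: "satisfies homeo_plus_circle v (arc_eqs p) \<longleftrightarrow> arc_rel v p"
proof -
  obtain c j j' M where p: "p = (c, j, j', M)" by (cases p)
  have "satisfies homeo_plus_circle v
     {([Arc p True, Arc p False], [Arc p False, Arc p True]),
      ([Al, Arc p False], [Arc p False, Al]),
      ([Rt, Arc p True], [Arc p True, Rt]),
      (Al # replicate j' (Arc p False), replicate c Rt @ replicate j (Arc p True))} \<longleftrightarrow>
     v (Arc p True) \<circ> v (Arc p False) = v (Arc p False) \<circ> v (Arc p True) \<and>
     v Al \<circ> v (Arc p False) = v (Arc p False) \<circ> v Al \<and>
     v Rt \<circ> v (Arc p True) = v (Arc p True) \<circ> v Rt \<and>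
     v Al \<circ> v (Arc p False) ^^ j' = v Rt ^^ c \<circ> v (Arc p True) ^^ j"
    unfolding satisfies_def by (simp add: list_prod_simps)
  then show ?thesis
    unfolding arc_eqs_def arc_rel_def
    by (simp only: p prod.case satisfies_Un satisfies_UN satisfies_gadget ball_UNIV conj_assoc)
qed

lemma satisfies_system:
  "satisfies homeo_plus_circle v (system P) \<longleftrightarrow>
     triangle (v Rt) (v Nu) (v (Tn False)) (v (Tn True)) (v (Tc False)) (v (Tc True)) \<and>
     v Nu \<circ> v Nu \<circ> v Nu = id \<and> (\<forall>p\<in>P. arc_rel v p)"
proof -
  have "satisfies homeo_plus_circle v base_eqs \<longleftrightarrow>
     triangle (v Rt) (v Nu) (v (Tn False)) (v (Tn True)) (v (Tc False)) (v (Tc True)) \<and>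
     v Nu \<circ> v Nu \<circ> v Nu = id"
    unfolding satisfies_def base_eqs_def triangle_def
    by (auto simp: list_prod_simps comp_assoc)
  then show ?thesis
    by (simp add: system_def satisfies_Un satisfies_UN satisfies_arc)
qed

lemma finite_system: "finite P \<Longrightarrow> finite (system P)"
  by (auto simp: system_def base_eqs_def arc_eqs_def gadget_eqs_def split: prod.split)

section \<open>Rotation numbers of the solutions of the system\<close>

text \<open>\<open>1/6\<close> is the rotation number of \<open>Rt\<close>, and
  \<open>1 / (3 * real (Suc M))\<close> is the bound for each arc factor. The interval may wrap
  around the whole circle.\<close>

definition arc_set :: "arc \<Rightarrow> circle set" where
  "arc_set p = (case p of (c, j, j', M) \<Rightarrow> to_circle `
     {real c / 6 - real j' / (3 * real (Suc M)) .. real c / 6 + real j / (3 * real (Suc M))})"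

text \<open>The triangle kills \<open>Rt\<close>, the gadgets with exponent 1 kill both factors of
  the arc \<open>p\<close>, and the equation for \<alpha> then has nothing left.\<close>

lemma system_kill:
  assumes v: "\<And>x. v x \<in> carrier homeo_plus_circle"
    and sat: "satisfies homeo_plus_circle v (system P)" and P: "p \<in> P" and nu: "v Nu = id"
  shows "v Al = id"
proof -
  obtain c j j' M where p: "p = (c, j, j', M)" by (cases p)
  have tri: "triangle (v Rt) id (v (Tn False)) (v (Tn True)) (v (Tc False)) (v (Tc True))"
    and rel: "arc_rel v p" using sat P nu by (simp_all add: satisfies_system)
  have Rt: "v Rt = id" using triangle_kill[OF tri] v by blast
  have gad: "\<forall>s. \<forall>m\<in>{1..Suc M}. gadget id id (v (Arc p s) ^^ m)
      (\<lambda>i. v (Cw p s m i)) (\<lambda>i. v (Ce p s m i)) (v (Cd p s m))"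
    using rel Rt nu by (simp add: arc_rel_def p)
  have "gadget id id (v (Arc p s) ^^ 1) (\<lambda>i. v (Cw p s 1 i)) (\<lambda>i. v (Ce p s 1 i)) (v (Cd p s 1))" for s
    by (rule gad[rule_format]) simp
  from gadget_kill[OF this] have "v (Arc p s) = id" for s using v by simp
  moreover have "id ^^ n = (id :: circle \<Rightarrow> circle)" for n by (induction n) auto
  ultimately show ?thesis using rel Rt by (simp add: arc_rel_def p)
qed

text \<open>From one multiple at most \<open>1/3\<close> the next is at most \<open>2/3\<close>,
  less than a full turn; so the condition modulo integers becomes an inequality of real
  numbers.\<close>

lemma multiples_bound:
  fixes t :: real
  assumes "\<And>m. m \<in> {1..Suc M} \<Longrightarrow> \<exists>s\<in>{0..1/3}. to_circle (real m * t) = to_circle s"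
    and "0 \<le> t" "t \<le> 1/3" "m \<in> {1..Suc M}"
  shows "real m * t \<le> 1/3"
  using assms(4)
proof (induction m)
  case (Suc m)
  show ?case
  proof (cases "m = 0")
    case False
    then have m: "m \<ge> 1" and "real m * t \<le> 1/3" using Suc by auto
    moreover have "t \<le> real m * t" using m assms(2) by (simp add: mult_le_cancel_right1)
    ultimately have le: "real (Suc m) * t \<le> 2/3" by (simp add: algebra_simps)
    obtain s where s: "0 \<le> s" "s \<le> 1/3" "to_circle (real (Suc m) * t) = to_circle s"
      using assms(1)[OF Suc.prems] by auto
    obtain k :: int where k: "real (Suc m) * t = s + of_int k" using s(3) by (rule to_circle_eqE)
    have "0 \<le> real (Suc m) * t" using assms(2) by simp
    with k le s have "of_int k < (1::real)" "of_int k > (-1::real)" by linarith+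
    then have "k = 0" by linarith
    with k s show ?thesis by simp
  qed (use assms(3) in simp)
qed simp

lemma system_rot:
  assumes v: "\<And>x. v x \<in> carrier homeo_plus_circle"
    and sat: "satisfies homeo_plus_circle v (system P)" and P: "p \<in> P"
    and nu: "rot (v Nu) = to_circle (1/3)"
  shows "rot (v Al) \<in> arc_set p"
proof -
  obtain c j j' M where p: "p = (c, j, j', M)" by (cases p)
  have tri: "triangle (v Rt) (v Nu) (v (Tn False)) (v (Tn True)) (v (Tc False)) (v (Tc True))"
    and cube: "v Nu \<circ> v Nu \<circ> v Nu = id"
    and rel: "arc_rel v p" using sat P by (simp_all add: satisfies_system)
  obtain N where N: "N \<in> lifts" "v Nu = circ N" "\<And>x. N (N (N x)) = x + 1" "has_trn N (1/3)"
    using torsion3_rot_third[OF v cube nu] by blast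
  obtain A where A: "A \<in> lifts" "v Rt = circ A" "\<And>x. A (A x) = N x"
    using triangle_lift[OF v v v N(1,3)] tri N(2) by metis
  obtain a where a: "has_trn A a" using has_trn_exists[OF A(1)] by blast
  have "has_trn (A \<circ> A) (a + a)" using A a by (intro has_trn_comp) auto
  moreover have "A \<circ> A = N" using A by auto
  ultimately have "a = 1/6" using has_trn_unique N(4) by fastforce
  then have rt: "rot (v Rt) = to_circle (1/6)" using rot_circ[OF A(1) a] A(2) by (simp only:)
  have gad: "gadget (circ A) (circ N) (v (Arc p s) ^^ m)
      (\<lambda>i. v (Cw p s m i)) (\<lambda>i. v (Ce p s m i)) (v (Cd p s m))" if "m \<in> {1..Suc M}" for s m
    using rel that A N by (simp add: arc_rel_def p)
  have ex: "\<exists>t\<in>{0..1/3}. rot (v (Arc p s) ^^ m) = to_circle t" if "m \<in> {1..Suc M}" for s m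
    using gadget_rot[OF N(1,3,4) A(1,3) v homeo_funpow[OF v] v gad[OF that]] by (metis atLeastAtMost_iff)
  have "\<exists>t\<ge>0. t \<le> 1 / (3 * real (Suc M)) \<and> rot (v (Arc p s)) = to_circle t" for s
  proof -
    obtain t where t: "0 \<le> t" "t \<le> 1/3" "rot (v (Arc p s)) = to_circle t"
      using ex[of 1 s] by auto
    have mult: "\<exists>s\<in>{0..1/3}. to_circle (real m * t) = to_circle s" if "m \<in> {1..Suc M}" for m
      using ex[OF that, of s] rot_funpow[OF v t(3), of m] by metis
    have "real (Suc M) * t \<le> 1/3" by (rule multiples_bound[OF mult t(1,2)]) auto
    then have "t \<le> 1 / (3 * real (Suc M))" by (simp add: field_simps)
    with t show ?thesis by blast
  qed
  then obtain T where T: "\<And>s. 0 \<le> T s" "\<And>s. T s \<le> 1 / (3 * real (Suc M))"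
    "\<And>s. rot (v (Arc p s)) = to_circle (T s)" by metis
  have comm: "f ^^ n \<circ> g ^^ m = g ^^ m \<circ> f ^^ n" if "f \<circ> g = g \<circ> f" for f g :: "circle \<Rightarrow> circle" and n m
  proof -
    have fg: "f (g x) = g (f x)" for x using that by (metis comp_apply)
    have "(f ^^ n) (g x) = g ((f ^^ n) x)" for x by (rule funpow_commute[of f g, OF fg])
    then have "(g ^^ m) ((f ^^ n) x) = (f ^^ n) ((g ^^ m) x)" for x
      by (intro funpow_commute) simp
    then show ?thesis by (simp add: fun_eq_iff)
  qed
  have r: "v Al \<circ> v (Arc p False) ^^ j' = v Rt ^^ c \<circ> v (Arc p True) ^^ j"
    and c1: "v Al \<circ> v (Arc p False) = v (Arc p False) \<circ> v Al"
    and c2: "v Rt \<circ> v (Arc p True) = v (Arc p True) \<circ> v Rt"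
    using rel by (simp_all add: arc_rel_def p)
  have "rot (v Al) + to_circle (real j' * T False) = rot (v Al \<circ> v (Arc p False) ^^ j')"
    using rot_comp[OF v[of Al] homeo_funpow[OF v[of "Arc p False"], of j']] comm[OF c1, of 1 j']
    by (simp add: rot_funpow[OF v T(3)])
  also have "\<dots> = to_circle (real c * (1/6)) + to_circle (real j * T True)"
    unfolding r using rot_comp[OF homeo_funpow[OF v] homeo_funpow[OF v] comm[OF c2]]
    by (simp add: rot_funpow[OF v T(3)] rot_funpow[OF v rt])
  finally have "rot (v Al) = to_circle (real c / 6 + real j * T True - real j' * T False)"
    by (simp add: to_circle_add to_circle_diff algebra_simps)
  moreover have "real j * T True \<le> real j / (3 * real (Suc M))" "0 \<le> real j * T True"
    "real j' * T False \<le> real j' / (3 * real (Suc M))" "0 \<le> real j' * T False"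
    using mult_left_mono[OF T(2)[of True], of "real j"] mult_left_mono[OF T(2)[of False], of "real j'"] T(1)
    by simp_all
  ultimately show ?thesis unfolding arc_set_def p by auto
qed

text \<open>\<nu>, \<alpha>, \<open>Rt\<close> and the arc factors are all taken to be rigid
  rotations, so their commutation is automatic. What remains is to split the angle \<open>t\<close>
  for each arc.\<close>

lemma system_real:
  assumes t: "\<And>p. p \<in> P \<Longrightarrow> to_circle t \<in> arc_set p"
  obtains v where "\<And>x. v x \<in> carrier homeo_plus_circle" "satisfies homeo_plus_circle v (system P)"
    "v Nu = rotation (1/3)" "v Al = rotation t"
proof -
  have ex: "\<exists>T. (\<forall>s. 0 \<le> T s \<and> T s \<le> 1 / (3 * real (Suc M))) \<and>
      (\<exists>k::int. t + real j' * T False = real c / 6 + real j * T True + of_int k)"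
    if p: "(c, j, j', M) \<in> P" for c j j' M
  proof -
    obtain s where s: "to_circle t = to_circle s" "real c / 6 - real j' / (3 * real (Suc M)) \<le> s"
      "s \<le> real c / 6 + real j / (3 * real (Suc M))"
      using t[OF p] by (auto simp: arc_set_def)
    obtain k :: int where k: "t = s + of_int k" using s(1) by (rule to_circle_eqE)
    show ?thesis
    proof (cases "s \<ge> real c / 6")
      case True
      \<comment> \<open>On this side of the base point \<open>c / 6\<close> only the factor
        \<open>True\<close> rotates, on the other only \<open>False\<close>. For
        \<open>j = 0\<close> the bounds force \<open>s = real c / 6\<close>, and division by zero
        yields the right angle 0.\<close>
      define T where "T b = (if b then (s - real c / 6) / real j else 0)" for b
      have "real j * T True = s - real c / 6"
        using True s(3) by (cases "j = 0") (auto simp: T_def)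
      moreover have "T True \<le> 1 / (3 * real (Suc M))"
        using s(3) by (cases "j = 0") (auto simp: T_def field_simps)
      moreover have "0 \<le> T True" "T False = 0" using True by (simp_all add: T_def)
      ultimately have "0 \<le> T b" "T b \<le> 1 / (3 * real (Suc M))"
        and "t + real j' * T False = real c / 6 + real j * T True + of_int k" for b
        using k by (cases b; simp)+
      then show ?thesis by (intro exI[of _ T]) blast
    next
      case False
      define T where "T b = (if b then 0 else (real c / 6 - s) / real j')" for b
      have "real j' * T False = real c / 6 - s"
        using False s(2) by (cases "j' = 0") (auto simp: T_def)
      moreover have "T False \<le> 1 / (3 * real (Suc M))"
        using s(2) by (cases "j' = 0") (auto simp: T_def field_simps)
      moreover have "0 \<le> T False" "T True = 0" using False by (simp_all add: T_def)
      ultimately have "0 \<le> T b" "T b \<le> 1 / (3 * real (Suc M))"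
        and "t + real j' * T False = real c / 6 + real j * T True + of_int k" for b
        using k by (cases b; simp)+
      then show ?thesis by (intro exI[of _ T]) blast
    qed
  qed
  define good where "good p T \<longleftrightarrow> (case p of (c, j, j', M) \<Rightarrow>
      (\<forall>s. 0 \<le> T s \<and> T s \<le> 1 / (3 * real (Suc M))) \<and>
      (\<exists>k::int. t + real j' * T False = real c / 6 + real j * T True + of_int k))" for p T
  have "\<exists>T. good p T" if "p \<in> P" for p
  proof -
    obtain c j j' M where p: "p = (c, j, j', M)" by (cases p)
    then show ?thesis using ex[of c j j' M] that by (simp add: good_def)
  qed
  then obtain T where T0: "\<And>p. p \<in> P \<Longrightarrow> good p (T p)" by metis
  have T: "0 \<le> T (c, j, j', M) s" "T (c, j, j', M) s \<le> 1 / (3 * real (Suc M))"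
    "\<exists>k::int. t + real j' * T (c, j, j', M) False = real c / 6 + real j * T (c, j, j', M) True + of_int k"
    if "(c, j, j', M) \<in> P" for c j j' M s
    using T0[OF that] by (simp_all add: good_def)
  \<comment> \<open>Outside the admissible range trivial data serve as a default, so that the chosen
    elements lie in the carrier for every \<open>x\<close>.\<close>
  have "\<exists>wed :: (nat \<Rightarrow> circle \<Rightarrow> circle) \<times> (nat \<Rightarrow> circle \<Rightarrow> circle) \<times> (circle \<Rightarrow> circle).
     (\<forall>i. fst wed i \<in> carrier homeo_plus_circle \<and> fst (snd wed) i \<in> carrier homeo_plus_circle) \<and>
     snd (snd wed) \<in> carrier homeo_plus_circle \<and>
     (0 \<le> x \<and> x \<le> 1/3 \<longrightarrow> gadget (rotation (1/6)) (rotation (1/3)) (rotation x) (fst wed) (fst (snd wed)) (snd (snd wed)))" for x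
  proof (cases "0 \<le> x \<and> x \<le> 1/3")
    case True
    then obtain w e d where "\<And>i. w i \<in> carrier homeo_plus_circle" "\<And>i. e i \<in> carrier homeo_plus_circle"
      "d \<in> carrier homeo_plus_circle" "gadget (rotation (1/6)) (rotation (1/3)) (rotation x) w e d"
      using gadget_real[of x] by metis
    then show ?thesis by (intro exI[of _ "(w, e, d)"]) simp
  next
    case False
    then show ?thesis
      using rotation_carrier[of 0] by (intro exI[of _ "(\<lambda>_. rotation 0, \<lambda>_. rotation 0, rotation 0)"]) auto
  qed
  then obtain g :: "real \<Rightarrow> (nat \<Rightarrow> circle \<Rightarrow> circle) \<times> (nat \<Rightarrow> circle \<Rightarrow> circle) \<times> (circle \<Rightarrow> circle)"
    where g: "\<And>x i. fst (g x) i \<in> carrier homeo_plus_circle"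
    "\<And>x i. fst (snd (g x)) i \<in> carrier homeo_plus_circle" "\<And>x. snd (snd (g x)) \<in> carrier homeo_plus_circle"
    "\<And>x. 0 \<le> x \<Longrightarrow> x \<le> 1/3 \<Longrightarrow> gadget (rotation (1/6)) (rotation (1/3)) (rotation x)
       (fst (g x)) (fst (snd (g x))) (snd (snd (g x)))"
    by metis
  obtain n1 n2 u1 u2 where tri: "n1 \<in> carrier homeo_plus_circle" "n2 \<in> carrier homeo_plus_circle"
    "u1 \<in> carrier homeo_plus_circle" "u2 \<in> carrier homeo_plus_circle"
    "triangle (rotation (1/6)) (rotation (1/3)) n1 n2 u1 u2"
    by (rule triangle_real)
  define v where "v x = (case x of Nu \<Rightarrow> rotation (1/3) | Al \<Rightarrow> rotation t | Rt \<Rightarrow> rotation (1/6)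
     | Tn b \<Rightarrow> (if b then n2 else n1) | Tc b \<Rightarrow> (if b then u2 else u1)
     | Arc p s \<Rightarrow> rotation (T p s) | Cw p s m i \<Rightarrow> fst (g (real m * T p s)) i
     | Ce p s m i \<Rightarrow> fst (snd (g (real m * T p s))) i | Cd p s m \<Rightarrow> snd (snd (g (real m * T p s))))" for x
  have "v x \<in> carrier homeo_plus_circle" for x
    using tri g rotation_carrier by (simp add: v_def split: letter.split)
  moreover have "satisfies homeo_plus_circle v (system P)"
    unfolding satisfies_system
  proof (intro conjI ballI)
    show "triangle (v Rt) (v Nu) (v (Tn False)) (v (Tn True)) (v (Tc False)) (v (Tc True))"
      using tri by (simp add: v_def)
    show "v Nu \<circ> v Nu \<circ> v Nu = id"
      using rotation_int[of 0 1] by (simp add: v_def rotation_comp flip: rotation_0)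
    fix p assume p: "p \<in> P"
    obtain c j j' M where pe: "p = (c, j, j', M)" by (cases p)
    note T' = T[OF p[unfolded pe], folded pe]
    obtain k :: int where k: "t + real j' * T p False = real c / 6 + real j * T p True + of_int k"
      using T'(3) by blast
    have r: "rotation (t + real j' * T p False) = rotation (real c / 6 + real j * T p True)"
      unfolding k by (rule rotation_int)
    have "gadget (v Rt) (v Nu) (v (Arc p s) ^^ m) (\<lambda>i. v (Cw p s m i)) (\<lambda>i. v (Ce p s m i)) (v (Cd p s m))"
      if m: "m \<in> {1..Suc M}" for s m
    proof -
      have "real m * T p s \<le> real (Suc M) * (1 / (3 * real (Suc M)))"
        using m T' by (intro mult_mono) auto
      also have "\<dots> = 1/3" by (simp add: divide_simps)
      finally have "real m * T p s \<le> 1/3" .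
      with g(4)[of "real m * T p s"] T'(1)[of s] show ?thesis
        by (simp add: v_def rotation_funpow)
    qed
    then show "arc_rel v p"
      unfolding arc_rel_def pe prod.case
      using r by (auto simp: v_def pe rotation_comp rotation_funpow add.commute)
  qed
  moreover have "v Nu = rotation (1/3)" "v Al = rotation t" by (simp_all add: v_def)
  ultimately show thesis using that by blast
qed

section \<open>Closed sets of rotation numbers\<close>

lemma to_circle_repr: "\<exists>t. a \<le> t \<and> t < a + 1 \<and> x = to_circle t"
proof -
  obtain s where s: "x = to_circle s" using to_circle_surj by blast
  have "to_circle (s + of_int (- \<lfloor>s - a\<rfloor>)) = x" unfolding s by (rule to_circle_add_int)
  moreover have "a \<le> s - of_int \<lfloor>s - a\<rfloor>" "s - of_int \<lfloor>s - a\<rfloor> < a + 1" by linarith+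
  ultimately show ?thesis by (intro exI[of _ "s + of_int (- \<lfloor>s - a\<rfloor>)"]) simp
qed

lemma closed_arc:
  assumes "a \<le> b" shows "closed (to_circle ` {a..b})"
proof (cases "a + 1 \<le> b")
  case True
  have "x \<in> to_circle ` {a..b}" for x
    using to_circle_repr[of a x] True by force
  then have "to_circle ` {a..b} = UNIV" by blast
  then show ?thesis by simp
next
  case False
  \<comment> \<open>The complement of a short arc pulls back to the open gaps between consecutive
    integer translates of the interval.\<close>
  have "to_circle -` (- to_circle ` {a..b}) = (\<Union>k::int. {b + of_int k <..< a + 1 + of_int k})"
  proof (intro equalityI subsetI)
    fix x assume x: "x \<in> to_circle -` (- to_circle ` {a..b})"
    obtain t where t: "a \<le> t" "t < a + 1" "to_circle x = to_circle t"
      using to_circle_repr[of a "to_circle x"] by metis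
    then have "b < t" using x by (metis ComplD atLeastAtMost_iff imageI not_le vimageE)
    moreover obtain k :: int where "x = t + of_int k" using t(3) by (rule to_circle_eqE)
    ultimately show "x \<in> (\<Union>k::int. {b + of_int k <..< a + 1 + of_int k})"
      using t by (intro UN_I[of k]) auto
  next
    fix x assume "x \<in> (\<Union>k::int. {b + of_int k <..< a + 1 + of_int k})"
    then obtain k :: int where k: "b + of_int k < x" "x < a + 1 + of_int k" by auto
    have False if s: "s \<in> {a..b}" "to_circle x = to_circle s" for s
    proof -
      obtain l :: int where l: "x = s + of_int l" using s(2) by (rule to_circle_eqE)
      with k s(1) have "of_int k < (of_int l :: real)" "of_int l < (of_int (k + 1) :: real)" by auto
      then have "k < l" "l < k + 1" unfolding of_int_less_iff .
      then show False by linarith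
    qed
    then have "to_circle x \<notin> to_circle ` {a..b}" by blast
    then show "x \<in> to_circle -` (- to_circle ` {a..b})" by simp
  qed
  then show ?thesis unfolding closed_def open_circle_def by (simp add: open_UN)
qed

lemma closed_arc_set: "closed (arc_set p)"
proof -
  obtain c j j' M where p: "p = (c, j, j', M)" by (cases p)
  have "0 \<le> real j' / (3 * real (Suc M))" "0 \<le> real j / (3 * real (Suc M))" by simp_all
  then show ?thesis unfolding arc_set_def p prod.case by (intro closed_arc) linarith
qed

text \<open>Three steps of length \<open>1/3\<close> go once around. This arc keeps the finite
  families nonempty without changing their intersections.\<close>

lemma full_arc: "arc_set (0, 3, 0, 0) = UNIV"
proof -
  have "x \<in> arc_set (0, 3, 0, 0)" for x
    using to_circle_repr[of 0 x] by (auto simp: arc_set_def)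
  then show ?thesis by blast
qed

lemma multiple_below:
  fixes d u :: real
  assumes "0 < d" "0 < u"
  obtains j :: nat where "real j * d < u" "u \<le> real j * d + d"
proof -
  \<comment> \<open>Ceiling minus one instead of floor keeps the inequality strict when
    \<open>u\<close> is a multiple of \<open>d\<close>.\<close>
  define j where "j = nat (\<lceil>u / d\<rceil> - 1)"
  have "0 < u / d" using assms by simp
  then have "real j = of_int \<lceil>u / d\<rceil> - 1" unfolding j_def by (simp add: of_nat_nat)
  then have "real j < u / d" "u / d \<le> real j + 1" by linarith+
  then have "real j * d < u" "u \<le> (real j + 1) * d" using assms by (simp_all add: field_simps)
  then show thesis using that by (simp add: algebra_simps)
qed

text \<open>From a base point \<open>c / 6\<close> other than \<open>x\<close> the arc is extended
  both ways in steps of length \<open>d\<close> and stopped just short of \<open>x\<close>. The gap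
  left reaches at most \<open>d\<close> to either side, so it stays in a ball around
  \<open>x\<close> that avoids \<open>K\<close>.\<close>

lemma arc_set_separates:
  assumes K: "closed K" and x: "x \<notin> K"
  obtains p where "K \<subseteq> arc_set p" "x \<notin> arc_set p"
proof -
  \<comment> \<open>The base point is 0, except that \<open>x = 0\<close> takes
    \<open>3 / 6\<close>; the representative \<open>t = 1\<close> then lies in the unit interval
    after the base point.\<close>
  obtain c :: nat and t where t: "x = to_circle t" "real c / 6 < t" "t < real c / 6 + 1"
  proof (cases "x = 0")
    case True
    have "x = to_circle (0 + of_int 1)" unfolding to_circle_add_int True to_circle_0 ..
    then show thesis using that[of 1 3] by simp
  next
    case False
    obtain t where t: "0 \<le> t" "t < 0 + 1" "x = to_circle t" using to_circle_repr by blast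
    then have "t \<noteq> 0" using False to_circle_0 by auto
    with t show thesis using that[of t 0] by simp
  qed
  have "open (to_circle -` (- K))" using K by (simp add: closed_def open_circle_def)
  moreover have "t \<in> to_circle -` (- K)" using x t by simp
  ultimately obtain e where e: "e > 0" "ball t e \<subseteq> to_circle -` (- K)"
    by (meson open_contains_ball)
  have far: "to_circle s \<notin> K" if "dist s t < e" for s
    using that subsetD[OF e(2), of s] by (simp add: dist_commute)
  obtain M where M: "inverse (real (Suc M)) < e" using reals_Archimedean[OF e(1)] by blast
  define d where "d = 1 / (3 * real (Suc M))"
  have d: "0 < d" by (simp add: d_def)
  have "d \<le> inverse (real (Suc M))" by (simp add: d_def divide_simps)
  with M have "d < e" by simp
  obtain j where j: "real j * d < t - real c / 6" "t - real c / 6 \<le> real j * d + d"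
    using multiple_below[of d "t - real c / 6"] d t by auto
  obtain j' where j': "real j' * d < real c / 6 + 1 - t" "real c / 6 + 1 - t \<le> real j' * d + d"
    using multiple_below[of d "real c / 6 + 1 - t"] d t by auto
  have arc: "arc_set (c, j, j', M) = to_circle ` {real c / 6 - real j' * d .. real c / 6 + real j * d}"
    by (simp add: arc_set_def d_def)
  show thesis
  proof (rule that[of "(c, j, j', M)"])
    show "K \<subseteq> arc_set (c, j, j', M)"
    proof
      fix y assume y: "y \<in> K"
      obtain s where s: "real c / 6 - real j' * d \<le> s" "s < real c / 6 - real j' * d + 1" "y = to_circle s"
        using to_circle_repr by blast
      have "s \<le> real c / 6 + real j * d"
      proof (rule ccontr)
        assume "\<not> s \<le> real c / 6 + real j * d"
        then have "dist s t < e" using s j j' \<open>d < e\<close> by (simp add: dist_real_def)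
        then show False using far s(3) y by blast
      qed
      then show "y \<in> arc_set (c, j, j', M)" unfolding arc using s by auto
    qed
    show "x \<notin> arc_set (c, j, j', M)"
    proof
      assume "x \<in> arc_set (c, j, j', M)"
      then obtain s where s: "to_circle t = to_circle s" "real c / 6 - real j' * d \<le> s" "s \<le> real c / 6 + real j * d"
        unfolding arc t(1) by auto
      obtain k :: int where "t = s + of_int k" using s(1) by (rule to_circle_eqE)
      with s j j' have "(0::real) < of_int k" "of_int k < (1::real)" by linarith+
      then have "0 < k" "k < 1" by simp_all
      then show False by linarith
    qed
  qed
qed

section \<open>Orientation reversal and the remaining rotation numbers\<close>

text \<open>Conjugation by the orientation-reversing map \<open>x \<mapsto> - x\<close>: it
  preserves \<open>homeo_plus_circle\<close> and negates rotation numbers.\<close>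

definition reflect :: "(circle \<Rightarrow> circle) \<Rightarrow> circle \<Rightarrow> circle" where
  "reflect f x = - f (- x)"

lemma reflect_circ:
  assumes F: "F \<in> lifts"
  shows "(\<lambda>x. - F (- x)) \<in> lifts" "reflect (circ F) = circ (\<lambda>x. - F (- x))"
proof -
  have "F (- x - 1) = F (- x) - 1" for x using lifts_int[OF F, of "- x" "-1"] by simp
  then show G: "(\<lambda>x. - F (- x)) \<in> lifts"
    using F unfolding lifts_def strict_mono_def
    by (auto intro!: continuous_intros continuous_on_compose2[of UNIV F UNIV uminus])
  show "reflect (circ F) = circ (\<lambda>x. - F (- x))"
  proof
    fix c obtain x where c: "c = to_circle x" using to_circle_surj by blast
    show "reflect (circ F) c = circ (\<lambda>x. - F (- x)) c"
      unfolding c reflect_def using G F by (simp add: circ_to_circle flip: to_circle_minus)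
  qed
qed

lemma reflect_carrier:
  "f \<in> carrier homeo_plus_circle \<Longrightarrow> reflect f \<in> carrier homeo_plus_circle"
  by (metis carrier_liftE circ_carrier reflect_circ)

lemma rot_reflect:
  assumes "f \<in> carrier homeo_plus_circle" shows "rot (reflect f) = - rot f"
proof -
  obtain F where F: "F \<in> lifts" "f = circ F" using assms carrier_liftE by metis
  obtain r where r: "has_trn F r" using has_trn_exists[OF F(1)] by blast
  have "((\<lambda>x. - F (- x)) ^^ n) 0 = - (F ^^ n) 0" for n by (induction n) simp_all
  then have "has_trn (\<lambda>x. - F (- x)) (- r)"
    using tendsto_minus[OF r[unfolded has_trn_def]] by (simp add: has_trn_def)
  then show ?thesis
    using rot_circ[OF reflect_circ(1)[OF F(1)]] rot_circ[OF F(1) r] F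
    by (simp add: reflect_circ to_circle_minus)
qed

lemma reflect_hom:
  assumes "h \<in> hom G homeo_plus_circle" shows "(\<lambda>g. reflect (h g)) \<in> hom G homeo_plus_circle"
proof (rule homI)
  fix x assume "x \<in> carrier G"
  then show "reflect (h x) \<in> carrier homeo_plus_circle"
    using assms by (intro reflect_carrier) (auto simp: hom_def)
next
  fix x y assume "x \<in> carrier G" "y \<in> carrier G"
  then have "h (x \<otimes>\<^bsub>G\<^esub> y) = h x \<circ> h y" using assms by (simp add: hom_def mult_homeo)
  then show "reflect (h (x \<otimes>\<^bsub>G\<^esub> y)) = reflect (h x) \<otimes>\<^bsub>homeo_plus_circle\<^esub> reflect (h y)"
    by (simp add: mult_homeo reflect_def fun_eq_iff)
qed

text \<open>Reflecting the circle exchanges the actions with \<open>rot (\<rho> \<nu>) = 1/3\<close> and those with \<open>2/3\<close>.\<close>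

lemma rot_values:
  assumes G: "group G" and nu: "\<nu> \<in> carrier G" "\<nu> \<otimes>\<^bsub>G\<^esub> (\<nu> \<otimes>\<^bsub>G\<^esub> \<nu>) = \<one>\<^bsub>G\<^esub>" and al: "\<alpha> \<in> carrier G"
    and kill: "\<And>\<rho>. \<rho> \<in> hom G homeo_plus_circle \<Longrightarrow> \<rho> \<nu> = id \<Longrightarrow> \<rho> \<alpha> = id"
    and vals: "{rot (\<rho> \<alpha>) |\<rho>. \<rho> \<in> hom G homeo_plus_circle \<and> rot (\<rho> \<nu>) = to_circle (1 / 3)} = L"
  shows "\<forall>\<rho>\<in>hom G homeo_plus_circle. rot (\<rho> \<nu>) = 0 \<longrightarrow> \<rho> \<alpha> = \<one>\<^bsub>homeo_plus_circle\<^esub>"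
    and "{rot (\<rho> \<alpha>) |\<rho>. \<rho> \<in> hom G homeo_plus_circle} = {0} \<union> L \<union> uminus ` L"
proof -
  have car: "\<rho> g \<in> carrier homeo_plus_circle" if "\<rho> \<in> hom G homeo_plus_circle" "g \<in> carrier G" for \<rho> g
    using that by (auto simp: hom_def)
  have cube: "\<rho> \<nu> \<circ> \<rho> \<nu> \<circ> \<rho> \<nu> = id" if h: "\<rho> \<in> hom G homeo_plus_circle" for \<rho>
  proof -
    interpret h: group_hom G homeo_plus_circle \<rho>
      using G h group_homeo_plus_circle by (simp add: group_hom_def group_hom_axioms_def)
    have "\<rho> (\<nu> \<otimes>\<^bsub>G\<^esub> (\<nu> \<otimes>\<^bsub>G\<^esub> \<nu>)) = id" unfolding nu(2) by (simp only: h.hom_one one_homeo)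
    then show ?thesis using nu(1) by (simp add: mult_homeo comp_assoc)
  qed
  have zero: "\<rho> \<alpha> = id" if h: "\<rho> \<in> hom G homeo_plus_circle" "rot (\<rho> \<nu>) = 0" for \<rho>
    using kill[OF h(1) torsion3_rot_0[OF car[OF h(1) nu(1)] cube[OF h(1)] h(2)]] .
  then show "\<forall>\<rho>\<in>hom G homeo_plus_circle. rot (\<rho> \<nu>) = 0 \<longrightarrow> \<rho> \<alpha> = \<one>\<^bsub>homeo_plus_circle\<^esub>"
    unfolding one_homeo using zero by blast
  have rr: "rot (reflect (\<rho> \<alpha>)) = - rot (\<rho> \<alpha>)" "rot (reflect (\<rho> \<nu>)) = - rot (\<rho> \<nu>)"
    if "\<rho> \<in> hom G homeo_plus_circle" for \<rho> using that car nu al by (simp_all add: rot_reflect)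
  show "{rot (\<rho> \<alpha>) |\<rho>. \<rho> \<in> hom G homeo_plus_circle} = {0} \<union> L \<union> uminus ` L"
  proof (intro equalityI subsetI)
    fix x assume "x \<in> {rot (\<rho> \<alpha>) |\<rho>. \<rho> \<in> hom G homeo_plus_circle}"
    then obtain \<rho> where h: "\<rho> \<in> hom G homeo_plus_circle" "x = rot (\<rho> \<alpha>)" by blast
    from car[OF h(1) nu(1)] cube[OF h(1)] obtain m :: int
      where m: "m \<in> {0, 1, 2}" "rot (\<rho> \<nu>) = to_circle (of_int m / 3)"
      by (rule torsion3_lift) blast
    then consider "rot (\<rho> \<nu>) = 0" | "rot (\<rho> \<nu>) = to_circle (1/3)" | "rot (\<rho> \<nu>) = to_circle (2/3)"
      by (auto simp: to_circle_0)
    then show "x \<in> {0} \<union> L \<union> uminus ` L"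
    proof cases
      case 1
      then show ?thesis using zero[OF h(1)] h(2) by (simp add: rot_id)
    next
      case 2
      then show ?thesis using h vals by blast
    next
      case 3
      have "to_circle (1/3) = to_circle (- (2/3) + of_int 1)" by simp
      also have "\<dots> = - to_circle (2/3)" unfolding to_circle_add_int to_circle_minus ..
      finally have "rot (reflect (\<rho> \<nu>)) = to_circle (1/3)" using rr(2)[OF h(1)] 3 by simp
      then have "rot (reflect (\<rho> \<alpha>)) \<in> L"
        using reflect_hom[OF h(1)] unfolding vals[symmetric]
        by (intro CollectI exI[of _ "\<lambda>g. reflect (\<rho> g)"] conjI refl)
      then show ?thesis using rr(1)[OF h(1)] h(2) by force
    qed
  next
    fix x assume x: "x \<in> {0} \<union> L \<union> uminus ` L"
    have "(\<lambda>_. id) \<in> hom G homeo_plus_circle"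
      using homeo.one_closed by (auto simp: hom_def mult_homeo one_homeo)
    then have "0 \<in> {rot (\<rho> \<alpha>) |\<rho>. \<rho> \<in> hom G homeo_plus_circle}" using rot_id by force
    moreover have L: "\<exists>\<rho>. y = rot (\<rho> \<alpha>) \<and> \<rho> \<in> hom G homeo_plus_circle" if "y \<in> L" for y
      using that unfolding vals[symmetric] by blast
    moreover have "\<exists>\<rho>. - y = rot (\<rho> \<alpha>) \<and> \<rho> \<in> hom G homeo_plus_circle" if y: "y \<in> L" for y
    proof -
      obtain \<rho> where h: "y = rot (\<rho> \<alpha>)" "\<rho> \<in> hom G homeo_plus_circle" using L[OF y] by blast
      then show ?thesis using rr(1)[OF h(2)] reflect_hom[OF h(2)] by metis
    qed
    ultimately show "x \<in> {rot (\<rho> \<alpha>) |\<rho>. \<rho> \<in> hom G homeo_plus_circle}" using x by blast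
  qed
qed

lemma (in group) ord_eq_3:
  assumes x: "x \<in> carrier G" "x \<otimes> (x \<otimes> x) = \<one>" "x \<noteq> \<one>" shows "ord x = 3"
proof -
  have "x [^] (3::nat) = \<one>" using x by (simp add: numeral_3_eq_3 m_assoc)
  then have "ord x dvd 3" using pow_eq_id x(1) by blast
  then have "ord x = 1 \<or> ord x = 3" using prime_nat_iff[of 3] by (simp add: two_is_prime_nat)
  then show ?thesis using ord_eq_1 x by auto
qed

section \<open>Groups for finite intersections of arcs, for the empty set and for closed
  sets\<close>

definition forces :: "nat monoid \<Rightarrow> nat \<Rightarrow> circle set \<Rightarrow> bool" where
  "forces G \<alpha> L \<longleftrightarrow> finitely_presented G \<and> \<alpha> \<in> carrier G \<and>
     {rot (\<rho> \<alpha>) |\<rho>. \<rho> \<in> hom G homeo_plus_circle} = {0} \<union> L \<union> uminus ` L \<and>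
     (\<exists>\<nu>\<in>carrier G. group.ord G \<nu> = 3 \<and>
       (\<forall>\<rho>\<in>hom G homeo_plus_circle.
          rot (\<rho> \<nu>) = 0 \<longrightarrow> \<rho> \<alpha> = \<one>\<^bsub>homeo_plus_circle\<^esub>) \<and>
       {rot (\<rho> \<alpha>) |\<rho>. \<rho> \<in> hom G homeo_plus_circle \<and> rot (\<rho> \<nu>) = to_circle (1 / 3)} = L)"

lemma forcesI:
  assumes "finitely_presented G" "\<nu> \<in> carrier G" "\<nu> \<otimes>\<^bsub>G\<^esub> (\<nu> \<otimes>\<^bsub>G\<^esub> \<nu>) = \<one>\<^bsub>G\<^esub>" "\<nu> \<noteq> \<one>\<^bsub>G\<^esub>" "\<alpha> \<in> carrier G"
    "\<And>\<rho>. \<rho> \<in> hom G homeo_plus_circle \<Longrightarrow> \<rho> \<nu> = id \<Longrightarrow> \<rho> \<alpha> = id"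
    "{rot (\<rho> \<alpha>) |\<rho>. \<rho> \<in> hom G homeo_plus_circle \<and> rot (\<rho> \<nu>) = to_circle (1 / 3)} = L"
  shows "forces G \<alpha> L"
proof -
  have G: "group G" using assms(1) by (simp add: finitely_presented_def)
  have "\<forall>\<rho>\<in>hom G homeo_plus_circle. rot (\<rho> \<nu>) = 0 \<longrightarrow> \<rho> \<alpha> = \<one>\<^bsub>homeo_plus_circle\<^esub>"
    using G assms(2,3,5,6,7) by (rule rot_values)
  moreover have "{rot (\<rho> \<alpha>) |\<rho>. \<rho> \<in> hom G homeo_plus_circle} = {0} \<union> L \<union> uminus ` L"
    using G assms(2,3,5,6,7) by (rule rot_values)
  ultimately show ?thesis
    unfolding forces_def using assms(1,2,5,7) group.ord_eq_3[OF G assms(2-4)] by blast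
qed

lemma to_circle_third_neq_0: "to_circle (1/3) \<noteq> 0"
  using to_circle_thirds[of 1 0] by (auto simp: to_circle_0)

lemma forces_arcs:
  assumes P: "finite P" "P \<noteq> {}" and ne: "(\<Inter>p\<in>P. arc_set p) \<noteq> {}"
  shows "\<exists>G \<alpha>. forces G \<alpha> (\<Inter>p\<in>P. arc_set p)"
proof -
  define V where "V = (\<Union>(l, r)\<in>system P. set l \<union> set r) \<union> {Nu, Al}"
  have V: "finite V" "system P \<subseteq> lists V \<times> lists V"
    unfolding V_def using finite_system[OF P(1)] by auto
  have VNA: "Nu \<in> V" "Al \<in> V" by (auto simp: V_def)
  obtain G gen where pres: "presents V (system P) G gen" and fp: "finitely_presented G"
    using presents_exists[OF V(1) finite_system[OF P(1)] V(2)] by blast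
  have G: "group G" using fp by (simp add: finitely_presented_def)
  interpret G: group G by fact
  have nu: "gen Nu \<in> carrier G" and al: "gen Al \<in> carrier G"
    using presents_gen(1)[OF pres] VNA by auto
  have real: "\<exists>\<rho>\<in>hom G homeo_plus_circle. \<rho> (gen Nu) = rotation (1/3) \<and> \<rho> (gen Al) = rotation t"
    if t: "to_circle t \<in> (\<Inter>p\<in>P. arc_set p)" for t
  proof -
    obtain v where v: "\<And>x. v x \<in> carrier homeo_plus_circle" "satisfies homeo_plus_circle v (system P)"
      "v Nu = rotation (1/3)" "v Al = rotation t"
      using system_real[of P t] t by blast
    then show ?thesis
      using presents_hom[OF pres group_homeo_plus_circle _ v(2)] VNA by (metis image_subsetI)
  qed
  have val: "\<exists>v. (\<forall>x. v x \<in> carrier homeo_plus_circle) \<and> satisfies homeo_plus_circle v (system P) \<and>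
      v Nu = \<rho> (gen Nu) \<and> v Al = \<rho> (gen Al)" if h: "\<rho> \<in> hom G homeo_plus_circle" for \<rho>
    using presents_val[OF pres group_homeo_plus_circle h] VNA by metis
  have "forces G (gen Al) (\<Inter>p\<in>P. arc_set p)"
  proof (rule forcesI[OF fp nu _ _ al])
    have "list_prod G (map gen [Nu, Nu, Nu]) = list_prod G (map gen [])"
      using presents_gen(2)[OF pres] unfolding satisfies_def system_def base_eqs_def by blast
    then show "gen Nu \<otimes>\<^bsub>G\<^esub> (gen Nu \<otimes>\<^bsub>G\<^esub> gen Nu) = \<one>\<^bsub>G\<^esub>"
      using nu by (simp add: list_prod_def)
  next
    \<comment> \<open>A point of the intersection yields an action in which \<nu> is the rotation by
      \<open>1/3\<close>, so \<nu> is nontrivial.\<close>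
    obtain x where "x \<in> (\<Inter>p\<in>P. arc_set p)" using ne by blast
    moreover obtain t where "x = to_circle t" using to_circle_surj by blast
    ultimately obtain \<rho> where h: "\<rho> \<in> hom G homeo_plus_circle" "\<rho> (gen Nu) = rotation (1/3)"
      using real by blast
    show "gen Nu \<noteq> \<one>\<^bsub>G\<^esub>"
    proof
      assume "gen Nu = \<one>\<^bsub>G\<^esub>"
      then have "rotation (1/3) = id"
        using h hom_one[OF h(1) G group_homeo_plus_circle] by (simp add: one_homeo)
      then show False using rot_rotation[of "1/3"] to_circle_third_neq_0 by (simp add: rot_id)
    qed
  next
    fix \<rho> assume h: "\<rho> \<in> hom G homeo_plus_circle" and "\<rho> (gen Nu) = id"
    then show "\<rho> (gen Al) = id" using val[OF h] system_kill P(2) by (metis ex_in_conv)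
  next
    show "{rot (\<rho> (gen Al)) |\<rho>. \<rho> \<in> hom G homeo_plus_circle \<and> rot (\<rho> (gen Nu)) = to_circle (1 / 3)} =
        (\<Inter>p\<in>P. arc_set p)" (is "?R = ?L")
    proof (intro equalityI subsetI)
      fix x assume "x \<in> ?R"
      then obtain \<rho> where h: "\<rho> \<in> hom G homeo_plus_circle" "rot (\<rho> (gen Nu)) = to_circle (1/3)"
        "x = rot (\<rho> (gen Al))" by blast
      then show "x \<in> ?L" using val[OF h(1)] system_rot by (metis INT_I)
    next
      fix x assume x: "x \<in> ?L"
      obtain t where t: "x = to_circle t" using to_circle_surj by blast
      then obtain \<rho> where "\<rho> \<in> hom G homeo_plus_circle" "\<rho> (gen Nu) = rotation (1/3)" "\<rho> (gen Al) = rotation t"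
        using real x by blast
      moreover from this have "rot (\<rho> (gen Nu)) = to_circle (1/3)" "x = rot (\<rho> (gen Al))"
        by (simp_all add: rot_rotation t)
      ultimately show "x \<in> ?R" by blast
    qed
  qed
  then show ?thesis by blast
qed

text \<open>A circle action of the symmetric group on three letters kills the elements of order three,
  since the rotation number is invariant under conjugation.\<close>

lemma forces_empty: "\<exists>G \<alpha>. forces G \<alpha> {}"
proof -
  \<comment> \<open>The second relation says that conjugation by generator 1 inverts generator
    0.\<close>
  define E :: "(nat list \<times> nat list) set" where "E = {([0, 0, 0], []), ([0, 1, 0], [1])}"
  obtain G and gen :: "nat \<Rightarrow> nat" where pres: "presents {0, 1} E G gen" and fp: "finitely_presented G"
    using presents_exists[of "{0, 1 :: nat}" E] by (auto simp: E_def)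
  have G: "group G" using fp by (simp add: finitely_presented_def)
  interpret G: group G by fact
  have gen: "gen 0 \<in> carrier G" "gen 1 \<in> carrier G" using presents_gen(1)[OF pres] by auto
  have rel: "list_prod G (map gen l) = list_prod G (map gen r)" if "(l, r) \<in> E" for l r
    using presents_gen(2)[OF pres] that unfolding satisfies_def by blast
  have r1: "gen 0 \<otimes>\<^bsub>G\<^esub> (gen 0 \<otimes>\<^bsub>G\<^esub> gen 0) = \<one>\<^bsub>G\<^esub>"
    using rel[of "[0, 0, 0]" "[]"] gen by (simp add: E_def list_prod_def)
  have r2: "gen 0 \<otimes>\<^bsub>G\<^esub> (gen 1 \<otimes>\<^bsub>G\<^esub> gen 0) = gen 1"
    using rel[of "[0, 1, 0]" "[1]"] gen by (simp add: E_def list_prod_def)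
  define H :: "(circle \<Rightarrow> circle) monoid" where "H = \<lparr>carrier = {f. bij f}, mult = (\<circ>), one = id\<rparr>"
  have H: "group H"
  proof (rule groupI)
    fix f assume "f \<in> carrier H"
    then have f: "bij f" by (simp add: H_def)
    then have "inv_into UNIV f \<in> carrier H" "inv_into UNIV f \<otimes>\<^bsub>H\<^esub> f = \<one>\<^bsub>H\<^esub>"
      by (auto simp: H_def bij_imp_bij_inv bij_is_inj)
    then show "\<exists>g\<in>carrier H. g \<otimes>\<^bsub>H\<^esub> f = \<one>\<^bsub>H\<^esub>" by blast
  qed (auto simp: H_def bij_comp comp_assoc)
  define v :: "nat \<Rightarrow> circle \<Rightarrow> circle" where "v n = (if n = 0 then (\<lambda>x. to_circle (1/3) + x) else uminus)" for n
  have "v ` {0, 1} \<subseteq> carrier H"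
    by (auto simp: H_def v_def bij_uminus)
  moreover have "satisfies H v E"
  proof -
    have "to_circle (1/3) + (to_circle (1/3) + (to_circle (1/3) + x)) = x" for x
    proof -
      have "to_circle (1/3) + to_circle (1/3) + to_circle (1/3) = to_circle (0 + of_int 1)"
        by (simp flip: to_circle_add)
      also have "\<dots> = 0" unfolding to_circle_add_int to_circle_0 ..
      finally show ?thesis by (metis add.assoc add_0)
    qed
    then show ?thesis
      by (auto simp: satisfies_def E_def list_prod_def H_def v_def fun_eq_iff)
  qed
  ultimately obtain h where h: "h \<in> hom G H" "h (gen 0) = v 0"
    using presents_hom[OF pres H] by blast
  have n1: "gen 0 \<noteq> \<one>\<^bsub>G\<^esub>"
  proof
    assume "gen 0 = \<one>\<^bsub>G\<^esub>"
    then have "v 0 = id" using h hom_one[OF h(1) G H] by (simp add: H_def)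
    then have "to_circle (1/3) + 0 = 0" by (metis v_def id_apply)
    then show False using to_circle_third_neq_0 by simp
  qed
  have no: False if h: "\<rho> \<in> hom G homeo_plus_circle" and r: "rot (\<rho> (gen 0)) = to_circle (1/3)" for \<rho>
  proof -
    interpret h: group_hom G homeo_plus_circle \<rho>
      using G h group_homeo_plus_circle by (simp add: group_hom_def group_hom_axioms_def)
    define n s where "n = \<rho> (gen 0)" and "s = \<rho> (gen 1)"
    have ns: "n \<in> carrier homeo_plus_circle" "s \<in> carrier homeo_plus_circle"
      using gen by (simp_all add: n_def s_def)
    have "\<rho> (gen 0 \<otimes>\<^bsub>G\<^esub> (gen 0 \<otimes>\<^bsub>G\<^esub> gen 0)) = id" unfolding r1 by (simp only: h.hom_one one_homeo)
    then have nnn: "n \<circ> (n \<circ> n) = id" using gen by (simp add: mult_homeo n_def)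
    have "\<rho> (gen 0 \<otimes>\<^bsub>G\<^esub> (gen 1 \<otimes>\<^bsub>G\<^esub> gen 0)) = s" unfolding r2 s_def ..
    then have nsn: "n \<circ> (s \<circ> n) = s" using gen by (simp add: mult_homeo n_def s_def)
    \<comment> \<open>The relations make \<open>n \<circ> n\<close> conjugate to \<open>n\<close>,
      so \<open>rot n\<close> equals its own double and vanishes.\<close>
    have "(n \<circ> n) \<circ> s = (n \<circ> n) \<circ> (n \<circ> (s \<circ> n))" unfolding nsn ..
    also have "\<dots> = (n \<circ> (n \<circ> n)) \<circ> (s \<circ> n)" by (simp add: comp_assoc)
    also have "\<dots> = s \<circ> n" by (simp add: nnn)
    finally have "rot (n \<circ> n) = rot n" using ns by (intro rot_conj[of s]) auto
    moreover have "rot (n \<circ> n) = rot n + rot n" using ns by (intro rot_comp) auto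
    ultimately show False using r to_circle_third_neq_0 by (simp add: n_def)
  qed
  have "forces G \<one>\<^bsub>G\<^esub> {}"
    using fp gen(1) r1 n1 G.one_closed no hom_one[OF _ G group_homeo_plus_circle]
    by (intro forcesI[of G "gen 0"]) (auto simp: one_homeo)
  then show ?thesis by blast
qed

theorem theoremC:
  fixes K :: "circle set"
  assumes "closed K"
  shows "\<exists>(G :: nat \<Rightarrow> nat monoid) (\<alpha> :: nat \<Rightarrow> nat) (Ks :: nat \<Rightarrow> circle set).
    (\<forall>i. finitely_presented (G i) \<and> \<alpha> i \<in> carrier (G i) \<and> closed (Ks i)) \<and>
    (\<forall>i. Ks (Suc i) \<subseteq> Ks i) \<and>
    (\<Inter>i. Ks i) = K \<and>
    (\<forall>i. {rot (\<rho> (\<alpha> i)) |\<rho>. \<rho> \<in> hom (G i) homeo_plus_circle} = {0} \<union> Ks i \<union> uminus ` Ks i) \<and>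
    (\<forall>i. \<exists>\<nu>\<in>carrier (G i). group.ord (G i) \<nu> = 3 \<and>
       (\<forall>\<rho>\<in>hom (G i) homeo_plus_circle.
          rot (\<rho> \<nu>) = 0 \<longrightarrow> \<rho> (\<alpha> i) = \<one>\<^bsub>homeo_plus_circle\<^esub>) \<and>
       {rot (\<rho> (\<alpha> i)) |\<rho>. \<rho> \<in> hom (G i) homeo_plus_circle \<and> rot (\<rho> \<nu>) = to_circle (1 / 3)} = Ks i)"
proof -
  have "\<exists>Ks. (\<forall>i. closed (Ks i) \<and> (\<exists>G \<alpha>. forces G \<alpha> (Ks i))) \<and>
      (\<forall>i. Ks (Suc i) \<subseteq> Ks i) \<and> (\<Inter>i. Ks i) = K"
  \<comment> \<open>The construction from arcs shows \<nu> nontrivial through a point of the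
    intersection, so the empty set has its own group.\<close>
  proof (cases "K = {}")
    case True
    then show ?thesis using forces_empty by (intro exI[of _ "\<lambda>_. {}"]) simp
  next
    case False
    \<comment> \<open>There are countably many arcs. These families are finite and increasing, and
      every arc containing \<open>K\<close> eventually occurs.\<close>
    define P where "P i = insert (0, 3, 0, 0) {p :: arc. to_nat p \<le> i \<and> K \<subseteq> arc_set p}" for i
    define Ks where "Ks i = (\<Inter>p\<in>P i. arc_set p)" for i
    have fin: "finite (P i)" for i
    proof -
      have "finite (to_nat -` {..i} :: arc set)" by (intro finite_vimageI) auto
      then show ?thesis unfolding P_def by (auto intro: finite_subset[rotated])
    qed
    have sub: "K \<subseteq> Ks i" for i using full_arc by (auto simp: Ks_def P_def)
    have "\<exists>G \<alpha>. forces G \<alpha> (Ks i)" for i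
      unfolding Ks_def using sub[of i] False fin[of i] by (intro forces_arcs) (auto simp: P_def Ks_def)
    moreover have "closed (Ks i)" for i unfolding Ks_def by (intro closed_INT ballI closed_arc_set)
    moreover have "Ks (Suc i) \<subseteq> Ks i" for i unfolding Ks_def P_def by (intro INT_anti_mono) auto
    moreover have "(\<Inter>i. Ks i) = K"
    proof (intro equalityI subsetI)
      fix x assume x: "x \<in> (\<Inter>i. Ks i)"
      show "x \<in> K"
      proof (rule ccontr)
        assume "x \<notin> K"
        then obtain p where p: "K \<subseteq> arc_set p" "x \<notin> arc_set p" using arc_set_separates[OF assms] by blast
        then have "p \<in> P (to_nat p)" by (simp add: P_def)
        then show False using x p(2) by (auto simp: Ks_def)
      qed
    qed (use sub in blast)
    ultimately show ?thesis by blast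
  qed
  then obtain Ks where Ks: "\<And>i. closed (Ks i)" "\<And>i. \<exists>G \<alpha>. forces G \<alpha> (Ks i)"
    "\<And>i. Ks (Suc i) \<subseteq> Ks i" "(\<Inter>i. Ks i) = K" by blast
  then obtain G \<alpha> where "\<And>i. forces (G i) (\<alpha> i) (Ks i)" by metis
  with Ks show ?thesis unfolding forces_def
    by (intro exI[of _ G] exI[of _ \<alpha>] exI[of _ Ks]) auto
qed

end
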